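(* Let $n\ge 1$ be an integer, let $I\subset\mathbb{R}$ be a nonempty open interval and let $m=\lfloor\frac{n-1}{2}\rfloor$. Then $$\dim S_n(I,2/n)\le\begin{cases}\dfrac{m+2}{2m+3}&\text{if } n=2m+1,\\[2ex]\dfrac{m+3}{2m+4}&\text{if } n=2m+2.\end{cases}$$ In both cases the right-hand side is of the form $\frac12+O(n^{-1})$.
   Context: $\dim$ denotes Hausdorff dimension, and $\|y\|$ denotes the distance from $y\in\mathbb{R}$ to the nearest integer. For $x\in\mathbb{R}$, $\lambda_n(x)\in[0,+\infty]$ is the supremum of all real $\lambda$ such that the inequality $\max_{1\le i\le n}\|qx^i\|\le q^{-\lambda}$ has infinitely many positive integer solutions $q$. For an open interval $I\subset\mathbb{R}$, $S_n(I,\lambda):=\{x\in I:\lambda_n(x)>\lambda\}$. *)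

theory Defs
  imports "HOL-Analysis.Analysis" "HOL-Library.Landau_Symbols"
begin

(* The s-th power of the diameter. The empty set contributes 0 and a nonempty set
   contributes 1 for s = 0, whereas 0 powr 0 = 0 in the library.
   Only meaningful for bounded U, since the library's diameter is real-valued. *)
definition diam_pow :: "real \<Rightarrow> 'a::metric_space set \<Rightarrow> ennreal" where
  "diam_pow s U = (if U = {} then 0 else if s = 0 then 1 else ennreal (diameter U powr s))"

(* Countable covers are sequences; finite ones are included, as sets U i may be empty. *)
definition delta_covers :: "real \<Rightarrow> 'a::metric_space set \<Rightarrow> (nat \<Rightarrow> 'a set) set" where
  "delta_covers \<delta> E = {U. E \<subseteq> (\<Union>i. U i) \<and> (\<forall>i. bounded (U i) \<and> diameter (U i) \<le> \<delta>)}"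

definition hausdorff_premeasure :: "real \<Rightarrow> real \<Rightarrow> 'a::metric_space set \<Rightarrow> ennreal" where
  "hausdorff_premeasure s \<delta> E = (INF U\<in>delta_covers \<delta> E. \<Sum>i. diam_pow s (U i))"

definition hausdorff_measure :: "real \<Rightarrow> 'a::metric_space set \<Rightarrow> ennreal" where
  "hausdorff_measure s E = (SUP \<delta>\<in>{0<..}. hausdorff_premeasure s \<delta> E)"

definition hausdorff_dim :: "'a::metric_space set \<Rightarrow> ereal" where
  "hausdorff_dim E = Inf {ereal s |s. 0 \<le> s \<and> hausdorff_measure s E = 0}"

definition dist_nearest_int :: "real \<Rightarrow> real" where
  "dist_nearest_int y = \<bar>y - of_int (round y)\<bar>"

definition lambda_exponent :: "nat \<Rightarrow> real \<Rightarrow> ereal" where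
  "lambda_exponent n x = Sup {ereal l |l.
     infinite {q::nat. 0 < q \<and>
       Max ((\<lambda>i. dist_nearest_int (real q * x ^ i)) ` {1..n}) \<le> real q powr (- l)}}"

definition S_set :: "nat \<Rightarrow> real set \<Rightarrow> real \<Rightarrow> real set" where
  "S_set n I l = {x \<in> I. lambda_exponent n x > ereal l}"

(* For n \<ge> 1 the second branch is exactly the case n = 2 * m + 2. *)
definition dim_bound :: "nat \<Rightarrow> real" where
  "dim_bound n = (let m = nat \<lfloor>(real n - 1) / 2\<rfloor> in
     if n = 2 * m + 1 then (real m + 2) / (2 * real m + 3)
     else (real m + 3) / (2 * real m + 4))"

end

theory Submission
imports Defs "Berlekamp_Zassenhaus.Factor_Bound" "Jordan_Normal_Form.Determinant"
begin

text \<open>Let \<open>d\<close> be the integer with \<open>n \<le> 2 d \<le> n + 1\<close>. If \<open>q\<close> is a good denominator for \<open>x\<close> and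
  \<open>a l\<close> is the integer nearest to \<open>q x\<^sup>l\<close>, then the pigeonhole principle and \<open>\<lambda>\<^sub>n(x) > 2/n\<close> give a nonzero
  integer polynomial \<open>P\<close> of degree at most \<open>d\<close> and Mahler measure \<open>O(q\<^bsup>1/d\<^esup>)\<close> such that \<open>a\<close> satisfies the linear
  recurrence with characteristic polynomial \<open>P\<close>. Applying the cofactor of an irreducible factor \<open>p\<close> of \<open>P\<close>
  to \<open>a\<close> gives an integer sequence \<open>b\<close> with recurrence \<open>p\<close> that still approximates the powers of \<open>x\<close>.
  The Hankel determinant of \<open>b\<close> is a constant times the norm of a number in the field of \<open>p\<close>. A long stretch of
  integers satisfying the recurrence makes it nearly divisible by a power of the leading coefficient of \<open>p\<close>, and the approximation
  makes it small. The comparison bounds the Mahler measure of \<open>p\<close> and the number of possible sequences \<open>b\<close>,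
  hence the cost of covering the points \<open>x\<close> by small balls around \<open>b 1 / b 0\<close>. The costs are multiplicative enough that
  averaging over the factors of \<open>P\<close> yields one whose cost decays like a negative power of \<open>q\<close>. If \<open>2 deg P < d\<close>, the
  value of \<open>P\<close> at \<open>x\<close> is so small that balls around the roots of one factor already give a cheap cover.\<close>

subsection \<open>Covers and Hausdorff measure\<close>

text \<open>The critical exponent is the solution \<open>s\<close> of
  \<open>(1 - s) * (n + 2) = d\<close>. Summed over the factors of \<open>P\<close>, the logarithm
  of the covering cost is, up to a constant, at most an expression linear in the logarithm
  \<open>\<mu>\<close> of the Mahler measure of \<open>P\<close>, where \<open>\<mu>\<close> runs
  between \<open>0\<close> and about \<open>L = ln q / n\<close>. For
  \<open>d \<le> 2 * degree P\<close> both ends of this range are harmless: the end \<open>L\<close>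
  because \<open>degree P + d \<le> n + 1\<close>, the end \<open>0\<close> because
  \<open>(1 - s) * (n + 2) < d\<close>. For smaller degrees the end \<open>0\<close> fails, hence
  the second kind of cover. The pigeonhole alone allows Mahler measures up to the order of
  \<open>q powr (1 / d)\<close>; the Hankel determinants improve the exponent to
  \<open>1 / n\<close>. The obstacle is that \<open>P\<close> may be reducible: no prescribed factor
  need obey the bounds that an irreducible \<open>P\<close> would. The Mahler measure serves as
  height because it is exactly multiplicative, like the value at \<open>x\<close>, so logarithmic
  inequalities for the factors can be added without loss. The leading coefficient of a factor is not
  controlled, but the same power of it occurs in the lower and in the upper bound for the
  determinant and cancels.\<close>

definition finitely_coverable :: "real \<Rightarrow> real set \<Rightarrow> real \<Rightarrow> bool" where
  "finitely_coverable s E \<sigma> \<longleftrightarrow> (\<exists>C :: (real \<times> real) set. finite C \<and> (\<forall>(c, r)\<in>C. 0 \<le> r) \<and>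
     E \<subseteq> (\<Union>(c, r)\<in>C. cball c r) \<and> (\<Sum>(c, r)\<in>C. (2 * r) powr s) \<le> \<sigma>)"

lemma finitely_coverable_mono:
  assumes "finitely_coverable s E \<sigma>" "E' \<subseteq> E" "\<sigma> \<le> \<sigma>'"
  shows "finitely_coverable s E' \<sigma>'"
  using assms unfolding finitely_coverable_def by (meson order_trans)

lemma sum_Un_le:
  fixes f :: "'a \<Rightarrow> real"
  assumes "finite A" "finite B" "\<And>x. x \<in> A \<union> B \<Longrightarrow> 0 \<le> f x"
  shows "sum f (A \<union> B) \<le> sum f A + sum f B"
proof -
  have "0 \<le> sum f (A \<inter> B)" using assms by (intro sum_nonneg) auto
  then show ?thesis using sum.union_inter[OF assms(1,2), of f] by linarith
qed

lemma finitely_coverable_UN: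
  assumes "finite T" "\<And>t. t \<in> T \<Longrightarrow> finitely_coverable s (E t) (\<sigma> t)"
  shows "finitely_coverable s (\<Union>t\<in>T. E t) (\<Sum>t\<in>T. \<sigma> t)"
proof -
  define Q where "Q C t \<longleftrightarrow> finite C \<and> (\<forall>(c, r)\<in>C. 0 \<le> r) \<and>
     E t \<subseteq> (\<Union>(c, r)\<in>C. cball c r) \<and> (\<Sum>(c, r)\<in>C. (2 * r) powr s) \<le> \<sigma> t"
    for C :: "(real \<times> real) set" and t
  have "\<forall>t\<in>T. \<exists>C. Q C t"
    using assms(2) unfolding finitely_coverable_def Q_def by blast
  from bchoice[OF this] obtain C where "\<forall>t\<in>T. Q (C t) t" by blast
  then have C: "\<And>t. t \<in> T \<Longrightarrow> finite (C t)"
    "\<And>t. t \<in> T \<Longrightarrow> (\<forall>(c, r)\<in>C t. 0 \<le> r)" "\<And>t. t \<in> T \<Longrightarrow> E t \<subseteq> (\<Union>(c, r)\<in>C t. cball c r)"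
    "\<And>t. t \<in> T \<Longrightarrow> (\<Sum>(c, r)\<in>C t. (2 * r) powr s) \<le> \<sigma> t"
    unfolding Q_def by blast+
  have "(\<Sum>(c, r)\<in>(\<Union>t\<in>T. C t). (2 * r) powr s) \<le> (\<Sum>t\<in>T. \<Sum>(c, r)\<in>C t. (2 * r) powr s)"
    using assms(1) C(1)
  proof (induction T rule: finite_induct)
    case (insert x F)
    have "(\<Sum>(c, r)\<in>(\<Union>t\<in>insert x F. C t). (2 * r) powr s) \<le>
       (\<Sum>(c, r)\<in>C x. (2 * r) powr s) + (\<Sum>(c, r)\<in>(\<Union>t\<in>F. C t). (2 * r) powr s)"
      unfolding UN_insert using insert.prems insert.hyps(1)
      by (intro sum_Un_le) (blast, blast, auto)
    also have "\<dots> \<le> (\<Sum>(c, r)\<in>C x. (2 * r) powr s) + (\<Sum>t\<in>F. \<Sum>(c, r)\<in>C t. (2 * r) powr s)"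
      using insert by simp
    finally show ?case using insert by simp
  qed simp
  also have "\<dots> \<le> (\<Sum>t\<in>T. \<sigma> t)" using C(4) by (rule sum_mono)
  finally have "(\<Sum>(c, r)\<in>(\<Union>t\<in>T. C t). (2 * r) powr s) \<le> (\<Sum>t\<in>T. \<sigma> t)" .
  moreover have "(\<Union>t\<in>T. E t) \<subseteq> (\<Union>t\<in>T. \<Union>(c, r)\<in>C t. cball c r)"
    using C(3) by (intro UN_mono) auto
  then have "(\<Union>t\<in>T. E t) \<subseteq> (\<Union>(c, r)\<in>(\<Union>t\<in>T. C t). cball c r)"
    by (simp only: UN_UN_flatten)
  moreover have "finite (\<Union>t\<in>T. C t)" using assms(1) C(1) by blast
  moreover have "\<forall>(c, r)\<in>(\<Union>t\<in>T. C t). 0 \<le> r" using C(2) by (simp add: Ball_def) blast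
  ultimately show ?thesis unfolding finitely_coverable_def by blast
qed

lemma finitely_coverable_balls:
  assumes "finite K" "real (card K) \<le> N" "0 \<le> r" "E \<subseteq> (\<Union>c\<in>K. cball c r)"
  shows "finitely_coverable s E (N * (2 * r) powr s)"
proof -
  have "(\<Sum>(c, r)\<in>(\<lambda>c. (c, r)) ` K. (2 * r) powr s) = real (card K) * (2 * r) powr s"
    by (subst sum.reindex) (auto simp: inj_on_def)
  also have "\<dots> \<le> N * (2 * r) powr s" using assms by (intro mult_right_mono) auto
  finally show ?thesis unfolding finitely_coverable_def using assms
    by (intro exI[of _ "(\<lambda>c. (c, r)) ` K"]) auto
qed

lemma diam_pow_cball_le:
  fixes c :: real assumes "0 < s" "0 \<le> r"
  shows "diam_pow s (cball c r) \<le> ennreal ((2 * r) powr s)"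
proof -
  have "diameter (cball c r) \<le> 2 * r"
    using assms by (intro diameter_le) (auto simp: dist_real_def)
  then show ?thesis unfolding diam_pow_def using assms
    by (auto intro!: ennreal_leI powr_mono2 diameter_ge_0)
qed

lemma diam_pow_empty [simp]: "diam_pow s {} = 0"
  by (simp add: diam_pow_def)

text \<open>Covers arise with two indices, one for a level or a piece of a union and one for its
  members; \<open>prod_decode\<close> merges them into the single index of
  \<open>delta_covers\<close>, which does not change a double series of nonnegative terms.\<close>

lemma hausdorff_premeasure_le:
  fixes U :: "nat \<Rightarrow> nat \<Rightarrow> 'a::metric_space set"
  assumes "E \<subseteq> (\<Union>m n. U m n)" "\<And>m n. bounded (U m n) \<and> diameter (U m n) \<le> \<delta>"
  shows "hausdorff_premeasure s \<delta> E \<le> (\<Sum>m. \<Sum>n. diam_pow s (U m n))"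
proof -
  let ?V = "\<lambda>i. U (fst (prod_decode i)) (snd (prod_decode i))"
  have "?V \<in> delta_covers \<delta> E"
    unfolding delta_covers_def
  proof (safe)
    fix x assume "x \<in> E"
    then obtain m n where "x \<in> U m n" using assms(1) by blast
    then show "x \<in> (\<Union>i. ?V i)" by (intro UN_I[of "prod_encode (m, n)"]) auto
  qed (use assms(2) in auto)
  then have "hausdorff_premeasure s \<delta> E \<le> (\<Sum>i. diam_pow s (?V i))"
    unfolding hausdorff_premeasure_def by (rule INF_lower)
  also have "\<dots> = (\<Sum>m. \<Sum>n. diam_pow s (U m n))"
    using suminf_ennreal_2dimen[of "\<lambda>m. \<Sum>n. diam_pow s (U m n)" "\<lambda>(m, n). diam_pow s (U m n)"]
    by (simp add: comp_def case_prod_beta)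
  finally show ?thesis .
qed

lemma hausdorff_measure_zeroI:
  assumes "\<And>\<delta> e. 0 < \<delta> \<Longrightarrow> 0 < e \<Longrightarrow> hausdorff_premeasure s \<delta> E \<le> ennreal e"
  shows "hausdorff_measure s E = 0"
proof -
  have "hausdorff_premeasure s \<delta> E = 0" if "0 < \<delta>" for \<delta>
  proof -
    have "hausdorff_premeasure s \<delta> E \<le> 0"
      by (rule ennreal_le_epsilon) (use assms[OF that] in auto)
    then show ?thesis by simp
  qed
  then show ?thesis unfolding hausdorff_measure_def by (simp add: SUP_constant)
qed

text \<open>The Borel-Cantelli argument for Hausdorff measure: every point lies in
  \<open>E j\<close> for arbitrarily large \<open>j\<close>, so the covers of the levels beyond any
  \<open>J\<close> cover \<open>A\<close>, at the cost of a tail of a convergent series.\<close>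

lemma hausdorff_measure_limsup_zero:
  fixes A :: "real set"
  assumes s: "0 < s" and cov: "\<And>j. finitely_coverable s (E j) (\<sigma> j)" and "summable \<sigma>"
    and lim: "\<And>x. x \<in> A \<Longrightarrow> infinite {j. x \<in> E j}"
  shows "hausdorff_measure s A = 0"
proof (rule hausdorff_measure_zeroI)
  fix \<delta> e :: real assume pos: "0 < \<delta>" "0 < e"
  define Q where "Q C j \<longleftrightarrow> finite C \<and> (\<forall>(c, r)\<in>C. 0 \<le> r) \<and>
     E j \<subseteq> (\<Union>(c, r)\<in>C. cball c r) \<and> (\<Sum>(c, r)\<in>C. (2 * r) powr s) \<le> \<sigma> j"
    for C :: "(real \<times> real) set" and j
  have "\<forall>j. \<exists>C. Q C j"
    using cov unfolding finitely_coverable_def Q_def by blast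
  from choice[OF this] obtain C where "\<forall>j. Q (C j) j" by blast
  then have C: "\<And>j. finite (C j)"
    "\<And>j. (\<forall>(c, r)\<in>C j. 0 \<le> r)" "\<And>j. E j \<subseteq> (\<Union>(c, r)\<in>C j. cball c r)"
    "\<And>j. (\<Sum>(c, r)\<in>C j. (2 * r) powr s) \<le> \<sigma> j"
    unfolding Q_def by blast+
  have \<sigma>0: "0 \<le> \<sigma> j" for j
    by (rule order_trans[OF _ C(4)]) (auto intro!: sum_nonneg)
  have "\<forall>j. \<exists>xs. set xs = C j \<and> distinct xs" using C(1) finite_distinct_list by blast
  then obtain xs where xs: "\<And>j. set (xs j) = C j" "\<And>j. distinct (xs j)" by metis
  \<comment> \<open>One bound on the tail serves twice: it keeps the total cost below
    \<open>e\<close>, and since a single term \<open>(2 * r) powr s\<close> is at most the tail, it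
    keeps each diameter below \<open>\<delta>\<close>.\<close>
  define t where "t = min e (\<delta> powr s)"
  have "0 < t" using pos by (auto simp: t_def)
  then obtain J where J: "norm (\<Sum>i. \<sigma> (i + J)) < t"
    using suminf_exist_split[OF _ \<open>summable \<sigma>\<close>] by blast
  \<comment> \<open>Level \<open>j + J\<close> has finitely many balls; the rest of its sequence is
    padded with empty sets, which cost nothing.\<close>
  define U where "U j i = (if i < length (xs (j + J)) then (case xs (j + J) ! i of (c, r) \<Rightarrow> cball c r) else {})"
    for j i
  have sm: "summable (\<lambda>i. \<sigma> (i + J))" using assms(3) by (simp add: summable_iff_shift)
  have \<sigma>t: "\<sigma> (j + J) \<le> t" for j
  proof -
    have "(\<Sum>i\<in>{j}. \<sigma> (i + J)) \<le> (\<Sum>i. \<sigma> (i + J))"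
      by (rule sum_le_suminf[OF sm]) (use \<sigma>0 in auto)
    then show ?thesis using J by simp
  qed
  have "hausdorff_premeasure s \<delta> A \<le> (\<Sum>j. \<Sum>i. diam_pow s (U j i))"
  proof (rule hausdorff_premeasure_le)
    show "A \<subseteq> (\<Union>m n. U m n)"
    proof
      fix x assume "x \<in> A"
      from lim[OF this] obtain j where j: "j \<ge> J" "x \<in> E j"
        by (metis (no_types, lifting) infinite_nat_iff_unbounded_le mem_Collect_eq)
      then obtain c r where cr: "(c, r) \<in> C j" "x \<in> cball c r" using C(3)[of j] by blast
      then obtain i where "i < length (xs j)" "xs j ! i = (c, r)"
        using xs(1)[of j] by (metis in_set_conv_nth)
      then have "x \<in> U (j - J) i" using cr j by (simp add: U_def)
      then show "x \<in> (\<Union>m n. U m n)" by blast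
    qed
  next
    fix j i
    show "bounded (U j i) \<and> diameter (U j i) \<le> \<delta>"
    proof (cases "i < length (xs (j + J))")
      case True
      obtain c r where cr: "xs (j + J) ! i = (c, r)" by fastforce
      then have mem: "(c, r) \<in> C (j + J)" using xs(1) True by (metis nth_mem)
      then have r: "0 \<le> r" using C(2) by fast
      have "(2 * r) powr s = (\<Sum>(c, r)\<in>{(c, r)}. (2 * r) powr s)" by simp
      also have "\<dots> \<le> (\<Sum>(c, r)\<in>C (j + J). (2 * r) powr s)"
        using mem C(1) by (intro sum_mono2) auto
      also have "\<dots> \<le> \<delta> powr s" using C(4)[of "j + J"] \<sigma>t[of j] by (simp add: t_def)
      finally have le: "(2 * r) powr s \<le> \<delta> powr s" .
      have "2 * r \<le> \<delta>"
        using powr_less_mono2[OF s, of \<delta> "2 * r"] le pos by (meson less_imp_le not_less)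
      moreover have "diameter (cball c r) \<le> 2 * r"
        using r by (intro diameter_le) (auto simp: dist_real_def)
      ultimately show ?thesis using True cr by (simp add: U_def)
    qed (use pos in \<open>simp add: U_def\<close>)
  qed
  also have "\<dots> \<le> (\<Sum>j. ennreal (\<sigma> (j + J)))"
  proof (intro suminf_le)
    fix j
    have "(\<Sum>i. diam_pow s (U j i)) = (\<Sum>i<length (xs (j + J)). diam_pow s (U j i))"
      by (rule suminf_finite) (auto simp: U_def)
    also have "\<dots> \<le> (\<Sum>i<length (xs (j + J)). ennreal ((2 * snd (xs (j + J) ! i)) powr s))"
    proof (rule sum_mono)
      fix i assume i: "i \<in> {..<length (xs (j + J))}"
      obtain c r where cr: "xs (j + J) ! i = (c, r)" by fastforce
      then have "(c, r) \<in> C (j + J)" using xs(1) i by (metis nth_mem lessThan_iff)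
      then have "0 \<le> r" using C(2) by fast
      then show "diam_pow s (U j i) \<le> ennreal ((2 * snd (xs (j + J) ! i)) powr s)"
        using i cr diam_pow_cball_le[OF s] by (simp add: U_def)
    qed
    also have "\<dots> = ennreal (\<Sum>i<length (xs (j + J)). (2 * snd (xs (j + J) ! i)) powr s)"
      by (simp add: sum_ennreal)
    also have "(\<Sum>i<length (xs (j + J)). (2 * snd (xs (j + J) ! i)) powr s) = (\<Sum>(c, r)\<in>C (j + J). (2 * r) powr s)"
    proof -
      have "(\<Sum>(c, r)\<in>C (j + J). (2 * r) powr s) = (\<Sum>y\<leftarrow>xs (j + J). (2 * snd y) powr s)"
        using xs(2)[of "j + J"] xs(1)[of "j + J", symmetric]
        by (simp add: sum_list_distinct_conv_sum_set case_prod_beta)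
      then show ?thesis by (simp add: sum_list_sum_nth atLeast0LessThan)
    qed
    finally show "(\<Sum>i. diam_pow s (U j i)) \<le> ennreal (\<sigma> (j + J))"
      using C(4)[of "j + J"] by (meson ennreal_leI order_trans)
  qed auto
  also have "\<dots> = ennreal (\<Sum>j. \<sigma> (j + J))"
    by (rule suminf_ennreal2) (use \<sigma>0 sm in auto)
  also have "\<dots> \<le> ennreal e" using J by (intro ennreal_leI) (auto simp: t_def)
  finally show "hausdorff_premeasure s \<delta> A \<le> ennreal e" .
qed

section \<open>Countable unions and the passage from measure to dimension\<close>

lemma hausdorff_measure_countable_UN_zero:
  fixes A :: "nat \<Rightarrow> 'a::metric_space set"
  assumes "\<And>m. hausdorff_measure s (A m) = 0"
  shows "hausdorff_measure s (\<Union>m. A m) = 0"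
proof (rule hausdorff_measure_zeroI)
  fix \<delta> e :: real assume pos: "0 < \<delta>" "0 < e"
  have "\<exists>U. U \<in> delta_covers \<delta> (A m) \<and> (\<Sum>i. diam_pow s (U i)) < ennreal (e * (1/2) ^ Suc m)" for m
  proof -
    have "hausdorff_premeasure s \<delta> (A m) \<le> hausdorff_measure s (A m)"
      unfolding hausdorff_measure_def using pos by (intro SUP_upper) auto
    then have "hausdorff_premeasure s \<delta> (A m) < ennreal (e * (1/2) ^ Suc m)" using assms[of m] pos by simp
    then show ?thesis unfolding hausdorff_premeasure_def by (simp add: INF_less_iff Bex_def)
  qed
  then obtain U where U: "\<And>m. U m \<in> delta_covers \<delta> (A m)"
    "\<And>m. (\<Sum>i. diam_pow s (U m i)) < ennreal (e * (1/2) ^ Suc m)" by metis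
  have "hausdorff_premeasure s \<delta> (\<Union>m. A m) \<le> (\<Sum>m. \<Sum>n. diam_pow s (U m n))"
    by (rule hausdorff_premeasure_le) (use U(1) in \<open>fastforce simp: delta_covers_def\<close>)+
  also have "\<dots> \<le> (\<Sum>m. ennreal (e * (1/2) ^ Suc m))"
    by (intro suminf_le) (use U(2) in \<open>auto intro: less_imp_le\<close>)
  also have "\<dots> = ennreal (\<Sum>m. e * (1/2) ^ Suc m)"
    using pos by (intro suminf_ennreal2) (auto intro!: summable_mult)
  also have "(\<Sum>m. e * (1/2) ^ Suc m) = e"
    using sums_mult[OF power_half_series, of e] by (simp add: sums_iff)
  finally show "hausdorff_premeasure s \<delta> (\<Union>m. A m) \<le> ennreal e" .
qed

text \<open>Exponents just above \<open>t\<close> already determine the upper bound; the upper limit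
  \<open>t'\<close> allows the covering estimates to assume \<open>s \<le> 1\<close>.\<close>

lemma hausdorff_dim_le:
  assumes "0 \<le> t" "t < t'" "\<And>s. t < s \<Longrightarrow> s < t' \<Longrightarrow> hausdorff_measure s E = 0"
  shows "hausdorff_dim E \<le> ereal t"
proof (rule dense_ge)
  fix z assume "ereal t < z"
  then obtain s where s: "ereal t < ereal s" "ereal s < min z (ereal t')"
    using ereal_dense2[of "ereal t" "min z (ereal t')"] assms(2) by auto
  then have "hausdorff_dim E \<le> ereal s"
    unfolding hausdorff_dim_def using assms by (intro Inf_lower) auto
  then show "hausdorff_dim E \<le> z" using s by (auto intro: order_trans less_imp_le)
qed

hide_const (open) Coset.order Module.smult UnivPoly.coeff UnivPoly.monom

subsection \<open>Separation of integer polynomials\<close>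

definition bounded_polys :: "nat \<Rightarrow> int \<Rightarrow> int \<Rightarrow> int poly set" where
  "bounded_polys K a b = {p. (\<forall>i\<ge>K. coeff p i = 0) \<and> (\<forall>i<K. a \<le> coeff p i \<and> coeff p i \<le> b)}"

lemma card_bounded_polys:
  assumes "a \<le> b + 1"
  shows "finite (bounded_polys K a b) \<and> card (bounded_polys K a b) = nat (b - a + 1) ^ K"
proof -
  let ?F = "PiE {..<K} (\<lambda>_. {a..b})"
  have "bij_betw (\<lambda>p. restrict (coeff p) {..<K}) (bounded_polys K a b) ?F"
  proof (rule bij_betw_imageI)
    show "inj_on (\<lambda>p. restrict (coeff p) {..<K}) (bounded_polys K a b)"
    proof (rule inj_onI)
      fix p q assume pq: "p \<in> bounded_polys K a b" "q \<in> bounded_polys K a b"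
        and eq: "restrict (coeff p) {..<K} = restrict (coeff q) {..<K}"
      show "p = q"
      proof (rule poly_eqI)
        fix i show "coeff p i = coeff q i"
          using pq fun_cong[OF eq, of i] by (cases "i < K") (auto simp: bounded_polys_def)
      qed
    qed
    show "(\<lambda>p. restrict (coeff p) {..<K}) ` bounded_polys K a b = ?F"
    proof (intro equalityI subsetI)
      fix f assume f: "f \<in> ?F"
      let ?p = "Poly (map f [0..<K])"
      have co: "coeff ?p i = (if i < K then f i else 0)" for i
        by (simp add: coeff_Poly_eq nth_default_def)
      have "?p \<in> bounded_polys K a b" using f by (auto simp: bounded_polys_def co PiE_iff simp del: coeff_Poly_eq)
      moreover have "f = restrict (coeff ?p) {..<K}" using f
        by (intro ext) (auto simp: co PiE_iff extensional_def simp del: coeff_Poly_eq)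
      ultimately show "f \<in> (\<lambda>p. restrict (coeff p) {..<K}) ` bounded_polys K a b" by blast
    next
      fix f assume "f \<in> (\<lambda>p. restrict (coeff p) {..<K}) ` bounded_polys K a b"
      then show "f \<in> ?F" by (auto simp: bounded_polys_def PiE_iff)
    qed
  qed
  moreover have "finite ?F" by (simp add: finite_PiE)
  moreover have "card ?F = nat (b - a + 1) ^ K" by (simp add: card_PiE)
  ultimately show ?thesis using bij_betw_finite bij_betw_same_card by metis
qed

lemma bounded_polys_bound:
  assumes "p \<in> bounded_polys K a b" "0 \<le> B" "- B \<le> a" "b \<le> B"
  shows "\<bar>coeff p i\<bar> \<le> B"
  using assms by (cases "i < K") (force simp: bounded_polys_def)+

lemma degree_bounded_polys: "p \<in> bounded_polys K a b \<Longrightarrow> degree p < K \<or> p = 0"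
  by (cases "K = 0") (auto simp: bounded_polys_def poly_eq_iff intro: degree_lessI)

text \<open>The constant coefficient of a polynomial that is small at a given point is determined by
  the others up to a short interval.\<close>
lemma card_polys_small_at:
  fixes z :: complex
  assumes "0 \<le> B" "0 \<le> t"
  shows "finite {p \<in> bounded_polys (Suc K) (- B) B. cmod (poly (of_int_poly p) z) \<le> t}"
    "real (card {p \<in> bounded_polys (Suc K) (- B) B. cmod (poly (of_int_poly p) z) \<le> t})
       \<le> (2 * real_of_int B + 1) ^ K * (2 * t + 1)"
proof -
  let ?S = "{p \<in> bounded_polys (Suc K) (- B) B. cmod (poly (of_int_poly p) z) \<le> t}"
  have fin: "finite (bounded_polys K' (- B) B)" for K'
    using card_bounded_polys[of "- B" B K'] assms by auto
  show "finite ?S" using fin by auto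
  let ?tl = "poly_shift 1 :: int poly \<Rightarrow> _"
  have dec: "p = pCons (coeff p 0) (?tl p)" for p :: "int poly"
    by (rule poly_eqI) (auto simp: coeff_pCons coeff_poly_shift split: nat.split)
  have tl: "?tl p \<in> bounded_polys K (- B) B" if "p \<in> ?S" for p
    using that by (auto simp: bounded_polys_def coeff_poly_shift)
  have fib: "real (card {p \<in> ?S. ?tl p = q}) \<le> 2 * t + 1" for q
  proof -
    let ?T = "{p \<in> ?S. ?tl p = q}"
    let ?w = "Re (z * poly (of_int_poly q) z)"
    have "(\<lambda>p. coeff p 0) ` ?T \<subseteq> {\<lceil>- t - ?w\<rceil>..\<lfloor>t - ?w\<rfloor>}"
    proof safe
      fix p assume p: "p \<in> bounded_polys (Suc K) (- B) B" "cmod (poly (of_int_poly p) z) \<le> t"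
         "q = ?tl p"
      have "poly (of_int_poly p) z = of_int (coeff p 0) + z * poly (of_int_poly (?tl p)) z"
        by (subst dec) (simp add: of_int_hom.map_poly_pCons_hom)
      then have "\<bar>real_of_int (coeff p 0) + Re (z * poly (of_int_poly (?tl p)) z)\<bar> \<le> t"
        using p(2) abs_Re_le_cmod[of "poly (of_int_poly p) z"] by simp
      then show "coeff p 0 \<in> {\<lceil>- t - Re (z * poly (of_int_poly (?tl p)) z)\<rceil>..\<lfloor>t - Re (z * poly (of_int_poly (?tl p)) z)\<rfloor>}"
        by (simp add: ceiling_le_iff le_floor_iff abs_le_iff)
    qed
    moreover have "inj_on (\<lambda>p. coeff p 0) ?T"
    proof (rule inj_onI)
      fix p p' assume "p \<in> ?T" "p' \<in> ?T" "coeff p 0 = coeff p' 0"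
      then show "p = p'" using dec[of p] dec[of p'] by simp
    qed
    ultimately have "card ?T \<le> card {\<lceil>- t - ?w\<rceil>..\<lfloor>t - ?w\<rfloor>}"
      by (intro card_inj_on_le) auto
    also have "real \<dots> \<le> 2 * t + 1"
    proof -
      have "real_of_int (\<lfloor>t - ?w\<rfloor> - \<lceil>- t - ?w\<rceil> + 1) \<le> 2 * t + 1"
        unfolding of_int_add of_int_diff of_int_1
        using of_int_floor_le[of "t - ?w"] le_of_int_ceiling[of "- t - ?w"] by linarith
      then show ?thesis using assms by (simp add: of_nat_nat)
    qed
    finally show ?thesis by simp
  qed
  have "card ?S \<le> (\<Sum>q\<in>bounded_polys K (- B) B. card {p \<in> ?S. ?tl p = q})"
  proof -
    have "?S = (\<Union>q\<in>bounded_polys K (- B) B. {p \<in> ?S. ?tl p = q})" using tl by blast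
    then have "card ?S = card (\<Union>q\<in>bounded_polys K (- B) B. {p \<in> ?S. ?tl p = q})" by (rule arg_cong)
    also have "\<dots> \<le> (\<Sum>q\<in>bounded_polys K (- B) B. card {p \<in> ?S. ?tl p = q})"
      by (rule card_UN_le[OF fin])
    finally show ?thesis .
  qed
  then have "real (card ?S) \<le> (\<Sum>q\<in>bounded_polys K (- B) B. real (card {p \<in> ?S. ?tl p = q}))"
    unfolding of_nat_sum[symmetric] of_nat_le_iff .
  also have "\<dots> \<le> (\<Sum>q\<in>bounded_polys K (- B) B. 2 * t + 1)" using fib by (rule sum_mono)
  also have "\<dots> = (2 * real_of_int B + 1) ^ K * (2 * t + 1)"
    using card_bounded_polys[of "- B" B K] assms by (simp add: algebra_simps)
  finally show "real (card ?S) \<le> (2 * real_of_int B + 1) ^ K * (2 * t + 1)" .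
qed

lemma abs_coeff_mult_le:
  fixes A P :: "int poly"
  assumes "\<And>j. j \<ge> K \<Longrightarrow> coeff A j = 0" "\<And>j. \<bar>coeff A j\<bar> \<le> a" "\<And>j. \<bar>coeff P j\<bar> \<le> b"
  shows "\<bar>coeff (A * P) i\<bar> \<le> int K * a * b"
proof -
  have ab: "0 \<le> a" "0 \<le> b" using assms(2)[of 0] assms(3)[of 0] by linarith+
  have "\<bar>coeff (A * P) i\<bar> \<le> (\<Sum>j\<le>i. \<bar>coeff A j * coeff P (i - j)\<bar>)"
    unfolding coeff_mult by (rule sum_abs)
  also have "\<dots> = (\<Sum>j\<in>{..i} \<inter> {..<K}. \<bar>coeff A j * coeff P (i - j)\<bar>)"
    by (rule sum.mono_neutral_right) (use assms(1) in \<open>auto simp: not_less\<close>)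
  also have "\<dots> \<le> (\<Sum>j\<in>{..i} \<inter> {..<K}. a * b)"
    using assms(2,3) ab by (intro sum_mono) (simp add: abs_mult mult_mono)
  also have "\<dots> = int (card ({..i} \<inter> {..<K})) * (a * b)" by simp
  also have "\<dots> \<le> int K * (a * b)"
    using ab card_mono[of "{..<K}" "{..i} \<inter> {..<K}"] by (intro mult_right_mono) auto
  finally show ?thesis by (simp add: mult.assoc)
qed

lemma cmod_poly_le:
  fixes A :: "int poly" and z :: complex
  assumes "\<And>j. j \<ge> K \<Longrightarrow> coeff A j = 0" "\<And>j. \<bar>coeff A j\<bar> \<le> a"
  shows "cmod (poly (of_int_poly A) z) \<le> real K * real_of_int a * (1 + cmod z) ^ K"
proof -
  have a0: "0 \<le> a" using assms(2)[of 0] by linarith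
  have "poly (of_int_poly A) z = (\<Sum>j<K. of_int (coeff A j) * z ^ j)"
  proof (cases "A = 0")
    case False
    then have "degree A < K" using assms(1) by (metis leading_coeff_0_iff not_less)
    then have "(\<Sum>j\<le>degree A. of_int (coeff A j) * z ^ j) = (\<Sum>j<K. of_int (coeff A j) * z ^ j)"
      by (intro sum.mono_neutral_left) (auto simp: coeff_eq_0)
    then show ?thesis by (simp add: poly_altdef)
  qed simp
  also have "cmod \<dots> \<le> (\<Sum>j<K. real_of_int a * (1 + cmod z) ^ K)"
  proof (rule sum_norm_le)
    fix j assume "j \<in> {..<K}"
    have "cmod z ^ j \<le> (1 + cmod z) ^ j" by (intro power_mono) auto
    also have "\<dots> \<le> (1 + cmod z) ^ K" using \<open>j \<in> {..<K}\<close> by (intro power_increasing) auto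
    finally have "cmod z ^ j \<le> (1 + cmod z) ^ K" .
    moreover have "\<bar>real_of_int (coeff A j)\<bar> \<le> real_of_int a"
      using assms(2)[of j] by (metis of_int_abs of_int_le_iff)
    ultimately show "cmod (of_int (coeff A j) * z ^ j) \<le> real_of_int a * (1 + cmod z) ^ K"
      using a0 by (auto simp: norm_mult norm_power intro!: mult_mono)
  qed
  finally show ?thesis by (simp add: algebra_simps)
qed

text \<open>Pigeonhole replaces the resultant: the combinations \<open>A P + B N\<close> are pairwise distinct because
  \<open>P\<close> is prime, and too many of them would be small at \<open>z\<close>.\<close>
lemma irreducible_poly_separation:
  assumes "1 \<le> k"
  shows "\<exists>c>0. \<forall>(P :: int poly) N H z. irreducible P \<longrightarrow> degree P = k \<longrightarrow> N \<noteq> 0 \<longrightarrow> degree N < k \<longrightarrow> 1 \<le> H \<longrightarrow>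
     (\<forall>i. \<bar>coeff P i\<bar> \<le> H) \<longrightarrow> (\<forall>i. \<bar>coeff N i\<bar> \<le> H) \<longrightarrow>
     c / ((1 + cmod z) ^ k * real_of_int H ^ (2 * k - 1))
       \<le> cmod (poly (of_int_poly P) z) + cmod (poly (of_int_poly N) z)"
proof (intro exI conjI allI impI)
  let ?c = "1 / (4 * real k * (5 * real k) ^ (2 * k - 1))"
  show "?c > 0" using assms by simp
  fix P N :: "int poly" and H z
  assume irr: "irreducible P" and deg: "degree P = k" "N \<noteq> 0" "degree N < k" and H: "1 \<le> H"
    and cP: "\<forall>i. \<bar>coeff P i\<bar> \<le> H" and cN: "\<forall>i. \<bar>coeff N i\<bar> \<le> H"
  let ?\<eta> = "cmod (poly (of_int_poly P) z) + cmod (poly (of_int_poly N) z)"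
  let ?Z = "(1 + cmod z) ^ k"
  define a where "a = (5 * real k * real_of_int H) ^ (2 * k - 1)"
  have a: "a > 0" using assms H by (simp add: a_def)
  \<comment> \<open>The \<open>(X + 1) ^ (2 * k)\<close> pairs \<open>(A, B)\<close> are mapped
    injectively to polynomials with \<open>2 * k - 1\<close> free coefficients of size
    \<open>O(X)\<close> and a constant coefficient that is confined by the value at
    \<open>z\<close>. Cancelling \<open>X ^ (2 * k - 1)\<close> leaves an inequality linear in
    \<open>X\<close>.\<close>
  have key: "real X \<le> a * (2 * real X * real k * ?\<eta> * ?Z + 1)" if X: "1 \<le> X" for X :: nat
  proof -
    let ?D = "bounded_polys k 0 (int X)"
    let ?B = "2 * int k * int X * H"
    let ?t = "real k * real X * ?Z * ?\<eta>"
    let ?S = "{p \<in> bounded_polys (Suc (2 * k - 1)) (- ?B) ?B. cmod (poly (of_int_poly p) z) \<le> ?t}"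
    let ?g = "\<lambda>(A, B). A * P + B * N"
    have bd: "\<bar>coeff p i\<bar> \<le> int X" if "p \<in> ?D" for p i
      using bounded_polys_bound[OF that, of "int X"] by simp
    have z0: "coeff p i = 0" if "p \<in> ?D" "i \<ge> k" for p i
      using that by (simp add: bounded_polys_def)
    have dg: "degree p < k" if "p \<in> ?D" for p using degree_bounded_polys[OF that] assms by auto
    have B0: "0 \<le> ?B" using H by simp
    have "?g ` (?D \<times> ?D) \<subseteq> ?S"
    proof safe
      fix A B assume AB: "A \<in> ?D" "B \<in> ?D"
      have "\<bar>coeff (A * P + B * N) i\<bar> \<le> ?B" for i
      proof -
        have "\<bar>coeff (A * P) i\<bar> \<le> int k * int X * H" "\<bar>coeff (B * N) i\<bar> \<le> int k * int X * H"
          using bd AB z0 cP cN by (auto intro!: abs_coeff_mult_le)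
        then show ?thesis unfolding coeff_add by linarith
      qed
      moreover have "coeff (A * P + B * N) i = 0" if "i \<ge> Suc (2 * k - 1)" for i
      proof (rule coeff_eq_0)
        have "degree (A * P + B * N) \<le> max (degree A + degree P) (degree B + degree N)"
          by (meson degree_add_le_max degree_mult_le max.mono order_trans)
        also have "\<dots> < i" using that dg[OF AB(1)] dg[OF AB(2)] deg assms by auto
        finally show "degree (A * P + B * N) < i" .
      qed
      ultimately show "A * P + B * N \<in> bounded_polys (Suc (2 * k - 1)) (- ?B) ?B"
        unfolding bounded_polys_def by (auto simp: abs_le_iff minus_le_iff)
      have "cmod (poly (of_int_poly (A * P + B * N)) z) \<le>
         cmod (poly (of_int_poly A) z) * cmod (poly (of_int_poly P) z) +
         cmod (poly (of_int_poly B) z) * cmod (poly (of_int_poly N) z)"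
        by (simp add: hom_distribs norm_mult[symmetric] norm_triangle_ineq)
      also have "\<dots> \<le> (real k * real X * ?Z) * cmod (poly (of_int_poly P) z) +
          (real k * real X * ?Z) * cmod (poly (of_int_poly N) z)"
        using cmod_poly_le[of k A "int X" z] cmod_poly_le[of k B "int X" z] AB z0 bd
        by (intro add_mono mult_right_mono) auto
      finally show "cmod (poly (of_int_poly (A * P + B * N)) z) \<le> ?t"
        by (simp add: algebra_simps)
    qed
    then have sub: "?g ` (?D \<times> ?D) \<subseteq> ?S" .
    have inj: "inj_on ?g (?D \<times> ?D)"
    proof (rule inj_onI, safe)
      fix A B A' B' assume AB: "A \<in> ?D" "B \<in> ?D" "A' \<in> ?D" "B' \<in> ?D"
        and eq: "A * P + B * N = A' * P + B' * N"
      have e: "(A - A') * P = (B' - B) * N" using eq by (simp add: algebra_simps)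
      then have "P dvd (B' - B) * N" by (metis dvd_triv_right)
      moreover have "\<not> P dvd N" using deg dvd_imp_degree_le[of P N] by linarith
      ultimately have "P dvd B' - B"
        using prime_elem_dvd_mult_iff[OF irreducible_imp_prime_elem[OF irr]] by simp
      moreover have "degree (B' - B) < k" using dg AB degree_diff_le_max[of B' B]
        by (meson le_less_trans max_less_iff_conj)
      ultimately have "B' = B" using deg(1) dvd_imp_degree_le[of P "B' - B"] by auto
      then have "A = A'" using e irr by auto
      then show "A = A'" "B = B'" using \<open>B' = B\<close> by auto
    qed
    have t0: "0 \<le> ?t" by (intro mult_nonneg_nonneg add_nonneg_nonneg zero_le_power) auto
    have "card (?D \<times> ?D) \<le> card ?S"
      by (rule card_inj_on_le[OF inj sub card_polys_small_at(1)[OF B0 t0]])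
    moreover have "card (?D \<times> ?D) = (X + 1) ^ (2 * k)"
      using card_bounded_polys[of 0 "int X" k]
      by (simp add: card_cartesian_product power_add[symmetric] mult_2 nat_add_distrib)
    ultimately have "real ((X + 1) ^ (2 * k)) \<le> real (card ?S)" by (simp only: of_nat_le_iff)
    also have "\<dots> \<le> (2 * real_of_int ?B + 1) ^ (2 * k - 1) * (2 * ?t + 1)"
      by (rule card_polys_small_at(2)[OF B0 t0])
    also have "\<dots> \<le> (5 * real k * real_of_int H * real X) ^ (2 * k - 1) * (2 * ?t + 1)"
    proof (intro mult_right_mono power_mono)
      have "1 \<le> real k * real_of_int H * real X"
        using assms H X by (intro mult_ge1_I) (auto intro!: mult_ge1_I)
      then show "2 * real_of_int ?B + 1 \<le> 5 * real k * real_of_int H * real X"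
        by (simp add: algebra_simps)
    qed (use H t0 in auto)
    finally have "real ((X + 1) ^ (2 * k)) \<le> a * real X ^ (2 * k - 1) * (2 * ?t + 1)"
      by (simp add: a_def power_mult_distrib)
    moreover have "real X ^ (2 * k - 1) * real X \<le> real ((X + 1) ^ (2 * k))"
      using assms by (simp add: power_Suc2[symmetric] del: power_Suc)
    ultimately have "real X ^ (2 * k - 1) * real X \<le> real X ^ (2 * k - 1) * (a * (2 * ?t + 1))"
      by (simp add: algebra_simps)
    then have "real X \<le> a * (2 * ?t + 1)" using X by simp
    then show ?thesis by (simp add: algebra_simps)
  qed
  \<comment> \<open>The slopes in \<open>key\<close> are compared for large \<open>X\<close>: if the
    coefficient of \<open>X\<close> on the right were at most \<open>1 / 2\<close>, then
    \<open>X \<le> X / 2 + a\<close> for all \<open>X\<close>.\<close>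
  have "1 / 2 < 2 * a * real k * ?\<eta> * ?Z"
  proof (rule ccontr)
    assume le: "\<not> 1 / 2 < 2 * a * real k * ?\<eta> * ?Z"
    obtain X :: nat where X: "real X > 2 * a + 1" using reals_Archimedean2 by blast
    have "real X \<le> real X * (2 * a * real k * ?\<eta> * ?Z) + a"
      using key[of X] X a by (simp add: algebra_simps)
    also have "\<dots> \<le> real X * (1 / 2) + a"
      using le by (intro add_mono mult_left_mono) auto
    finally show False using X by simp
  qed
  then have "1 / (4 * real k * a * ?Z) \<le> ?\<eta>"
  proof -
    assume *: "1 / 2 < 2 * a * real k * ?\<eta> * ?Z"
    have "0 < 4 * real k * a * ?Z" using a assms by (intro mult_pos_pos zero_less_power add_pos_nonneg) auto
    moreover have "1 \<le> ?\<eta> * (4 * real k * a * ?Z)" using * by (simp add: algebra_simps)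
    ultimately show ?thesis by (simp only: pos_divide_le_eq)
  qed
  then show "?c / (?Z * real_of_int H ^ (2 * k - 1)) \<le> ?\<eta>"
    by (simp add: a_def power_mult_distrib mult_ac)
qed

subsection \<open>Linear recurrences and Hankel determinants\<close>

definition poly_pairing :: "'a::comm_ring_1 poly \<Rightarrow> (nat \<Rightarrow> 'a) \<Rightarrow> 'a" where
  "poly_pairing p b = (\<Sum>i\<le>degree p. coeff p i * b i)"

text \<open>The module structure on sequences in which the variable acts as the shift; a zero at
  \<open>l\<close> is one instance of the linear recurrence with characteristic polynomial
  \<open>p\<close>.\<close>

definition shift_act :: "'a::comm_ring_1 poly \<Rightarrow> (nat \<Rightarrow> 'a) \<Rightarrow> nat \<Rightarrow> 'a" where
  "shift_act p b l = poly_pairing p (\<lambda>i. b (l + i))"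

lemma shift_act_fun: "shift_act p b = (\<lambda>l. poly_pairing p (\<lambda>i. b (l + i)))"
  by (simp add: shift_act_def fun_eq_iff)

lemma poly_pairing_alt:
  assumes "degree p < K"
  shows "poly_pairing p b = (\<Sum>i<K. coeff p i * b i)"
  unfolding poly_pairing_def using assms by (intro sum.mono_neutral_left) (auto simp: coeff_eq_0)

lemma poly_pairing_0 [simp]: "poly_pairing 0 b = 0"
  by (simp add: poly_pairing_def)

lemma poly_pairing_add: "poly_pairing (p + q) b = poly_pairing p b + poly_pairing q b"
proof -
  let ?K = "Suc (max (degree p) (degree q))"
  have "degree (p + q) < ?K" using degree_add_le_max[of p q] by simp
  then show ?thesis
    using poly_pairing_alt[of "p + q" ?K b] poly_pairing_alt[of p ?K b] poly_pairing_alt[of q ?K b]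
    by (simp add: sum.distrib algebra_simps)
qed

lemma poly_pairing_smult: "poly_pairing (Polynomial.smult c p) b = c * poly_pairing p b"
proof -
  have "degree (Polynomial.smult c p) < Suc (degree p)" using degree_smult_le[of c p] by simp
  then show ?thesis
    using poly_pairing_alt[of "Polynomial.smult c p" "Suc (degree p)" b] poly_pairing_alt[of p "Suc (degree p)" b]
    by (simp add: sum_distrib_left mult.assoc algebra_simps del: sum.lessThan_Suc)
qed

lemma poly_pairing_pCons: "poly_pairing (pCons a p) b = a * b 0 + poly_pairing p (\<lambda>i. b (Suc i))"
proof -
  have "degree (pCons a p) < Suc (Suc (degree p))" using degree_pCons_le[of a p] by simp
  then show ?thesis
    using poly_pairing_alt[of "pCons a p" "Suc (Suc (degree p))" b] poly_pairing_alt[of p "Suc (degree p)" "\<lambda>i. b (Suc i)"]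
    by (simp add: sum.lessThan_Suc_shift del: sum.lessThan_Suc)
qed

text \<open>The pairing is the linear functional that sends the monomial of degree \<open>i\<close>
  to \<open>b i\<close>, so moving \<open>q\<close> from the polynomial to the sequence is an
  adjunction. It makes \<open>shift_act\<close> a module action, and factors of a characteristic
  polynomial may act one after the other.\<close>

lemma poly_pairing_mult: "poly_pairing (p * q) b = poly_pairing p (shift_act q b)"
proof (induction p arbitrary: b)
  case (pCons a p)
  have "poly_pairing (pCons a p * q) b = a * poly_pairing q b + poly_pairing (p * q) (\<lambda>i. b (Suc i))"
    by (simp add: poly_pairing_add poly_pairing_smult poly_pairing_pCons)
  moreover have "shift_act q (\<lambda>i. b (Suc i)) = (\<lambda>i. shift_act q b (Suc i))"
    by (simp add: shift_act_fun)
  ultimately show ?case using pCons.IH[of "\<lambda>i. b (Suc i)"]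
    by (simp add: poly_pairing_pCons shift_act_fun)
qed simp

lemma shift_act_mult: "shift_act (p * q) b l = shift_act p (shift_act q b) l"
  by (simp add: shift_act_def[of "p * q"] poly_pairing_mult) (simp add: shift_act_fun add.assoc)

lemma shift_act_linear: "shift_act [:- m, 1:] b l = b (Suc l) - m * b l"
  by (simp add: shift_act_def poly_pairing_pCons) (simp add: poly_pairing_def)

lemma poly_pairing_diff_seq: "poly_pairing p (\<lambda>i. b i - b' i) = poly_pairing p b - poly_pairing p b'"
  by (simp add: poly_pairing_def algebra_simps sum_subtractf)

lemma poly_pairing_of_int:
  "poly_pairing (of_int_poly p) (\<lambda>i. of_int (b i)) = (of_int (poly_pairing p b) :: 'a::{comm_ring_1,ring_char_0})"
  by (simp add: poly_pairing_def)

lemma poly_pairing_cong: "(\<And>i. i \<le> degree p \<Longrightarrow> b i = b' i) \<Longrightarrow> poly_pairing p b = poly_pairing p b'"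
  by (auto simp: poly_pairing_def)

section \<open>Hankel determinants as norms\<close>

definition hankel :: "nat \<Rightarrow> (nat \<Rightarrow> 'a) \<Rightarrow> 'a mat" where
  "hankel k b = mat k k (\<lambda>(i, j). b (i + j))"

definition croots :: "int poly \<Rightarrow> complex set" where
  "croots P = {\<alpha>. poly (of_int_poly P) \<alpha> = 0}"

text \<open>If \<open>b l\<close> is the sum of \<open>w \<alpha> * \<alpha> ^ l\<close> over the roots \<open>\<alpha>\<close> of \<open>P\<close>, then this is \<open>w \<alpha>\<close> times \<open>P'(\<alpha>)\<close>.\<close>
definition spectral_coeff :: "int poly \<Rightarrow> complex \<Rightarrow> (nat \<Rightarrow> complex) \<Rightarrow> complex" where
  "spectral_coeff P \<alpha> b = poly_pairing (synthetic_div (of_int_poly P) \<alpha>) b"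

text \<open>Splitting off the root writes the polynomial as \<open>[:- \<alpha>, 1:]\<close> times
  its synthetic quotient. Moving the linear factor to the sequence shows that, on sequences with the
  recurrence, the functional is an eigenvector of the shift with eigenvalue
  \<open>\<alpha>\<close>.\<close>

lemma spectral_coeff_shift:
  assumes "\<alpha> \<in> croots P"
  shows "spectral_coeff P \<alpha> (\<lambda>i. b (Suc i)) = \<alpha> * spectral_coeff P \<alpha> b + poly_pairing (of_int_poly P) b"
proof -
  let ?D = "synthetic_div (of_int_poly P) \<alpha>"
  have "poly_pairing (of_int_poly P) b = poly_pairing ([:- \<alpha>, 1:] * ?D) b"
    using synthetic_div_correct'[of \<alpha> "of_int_poly P"] assms by (simp add: croots_def)
  also have "\<dots> = poly_pairing (?D * [:- \<alpha>, 1:]) b" by (simp only: mult.commute)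
  also have "\<dots> = poly_pairing ?D (\<lambda>l. b (Suc l) - \<alpha> * b l)"
    by (simp only: poly_pairing_mult shift_act_linear[abs_def])
  also have "\<dots> = poly_pairing ?D (\<lambda>l. b (Suc l)) - \<alpha> * poly_pairing ?D b"
    by (simp add: poly_pairing_def algebra_simps sum_subtractf sum_distrib_left)
  finally show ?thesis by (simp add: spectral_coeff_def)
qed

lemma spectral_coeff_shift_pow:
  assumes "\<alpha> \<in> croots P" "\<And>l. l < i \<Longrightarrow> shift_act (of_int_poly P) b l = 0"
  shows "spectral_coeff P \<alpha> (\<lambda>l. b (i + l)) = \<alpha> ^ i * spectral_coeff P \<alpha> b"
  using assms(2)
proof (induction i)
  case (Suc i)
  have "spectral_coeff P \<alpha> (\<lambda>l. b (Suc i + l)) =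
      \<alpha> * spectral_coeff P \<alpha> (\<lambda>l. b (i + l)) + poly_pairing (of_int_poly P) (\<lambda>l. b (i + l))"
    using spectral_coeff_shift[OF assms(1), of "\<lambda>l. b (i + l)"] by simp
  then show ?case using Suc by (simp add: shift_act_def)
qed simp

text \<open>This is Horner's scheme; it is the reason why spectral coefficients of integer sequences
  are values of integer polynomials at \<open>\<alpha>\<close>.\<close>

lemma coeff_synthetic_div: "coeff (synthetic_div p c) l = poly (poly_shift (Suc l) p) c"
proof (induction p arbitrary: l)
  case (pCons a p)
  have "poly_shift (Suc (Suc l)) (pCons a p) = poly_shift (Suc l) p" for l
    by (rule poly_eqI) (simp add: coeff_poly_shift)
  moreover have "poly_shift (Suc 0) (pCons a p) = p"
    by (rule poly_eqI) (simp add: coeff_poly_shift)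
  ultimately show ?case using pCons.IH by (cases l) (simp_all add: synthetic_div_pCons)
qed (simp add: poly_shift_0)

text \<open>The polynomial part of \<open>P(X)\<close> times the series of all
  \<open>b l * X^(-l-1)\<close>. If \<open>b\<close> obeys the recurrence everywhere, this is the
  numerator of the series written as a fraction with denominator \<open>P\<close>.\<close>

definition numerator_poly :: "int poly \<Rightarrow> (nat \<Rightarrow> int) \<Rightarrow> int poly" where
  "numerator_poly P b = (\<Sum>l<degree P. Polynomial.smult (b l) (poly_shift (Suc l) P))"

lemma degree_synthetic_div_less: "1 \<le> degree P \<Longrightarrow> degree (synthetic_div (of_int_poly P :: complex poly) \<alpha>) < degree P"
  by (simp add: degree_synthetic_div)

text \<open>Since the numerator has integer coefficients and smaller degree than \<open>P\<close>,
  \<open>irreducible_poly_separation\<close> can bound spectral coefficients from below.\<close>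

lemma spectral_coeff_numerator:
  assumes "1 \<le> degree P"
  shows "spectral_coeff P \<alpha> (\<lambda>i. of_int (b i)) = poly (of_int_poly (numerator_poly P b)) \<alpha>"
proof -
  have sh: "poly_shift n (of_int_poly P) = (of_int_poly (poly_shift n P) :: complex poly)" for n
    by (rule poly_eqI) (simp add: coeff_poly_shift)
  have "spectral_coeff P \<alpha> (\<lambda>i. of_int (b i)) =
    (\<Sum>l<degree P. poly (of_int_poly (poly_shift (Suc l) P)) \<alpha> * of_int (b l))"
    unfolding spectral_coeff_def
    by (subst poly_pairing_alt[OF degree_synthetic_div_less[OF assms]]) (simp add: coeff_synthetic_div sh)
  also have "\<dots> = poly (of_int_poly (numerator_poly P b)) \<alpha>"
    unfolding numerator_poly_def by (simp add: hom_distribs poly_sum mult.commute)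
  finally show ?thesis .
qed

lemma coeff_numerator_poly: "coeff (numerator_poly P b) i = (\<Sum>l<degree P. b l * coeff P (i + Suc l))"
  by (simp add: numerator_poly_def coeff_sum coeff_poly_shift)

lemma degree_numerator_poly: "1 \<le> degree P \<Longrightarrow> degree (numerator_poly P b) < degree P"
  by (intro degree_lessI) (auto simp: coeff_numerator_poly coeff_eq_0)

text \<open>The first nonzero term \<open>b l0\<close> meets the leading coefficient of
  \<open>P\<close> in degree \<open>degree P - Suc l0\<close>, and no other term contributes
  there.\<close>

lemma numerator_poly_nonzero:
  assumes "l < degree P" "b l \<noteq> 0"
  shows "numerator_poly P b \<noteq> 0"
proof -
  define l0 where "l0 = (LEAST l. b l \<noteq> 0)"
  have l0: "b l0 \<noteq> 0" "\<And>i. i < l0 \<Longrightarrow> b i = 0" "l0 \<le> l"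
    using assms(2) not_less_Least LeastI[of "\<lambda>l. b l \<noteq> 0"] Least_le[of "\<lambda>l. b l \<noteq> 0"]
    by (auto simp: l0_def)
  define i where "i = degree P - Suc l0"
  have i: "i + Suc l0 = degree P" using l0(3) assms(1) by (simp add: i_def)
  have "coeff (numerator_poly P b) i = (\<Sum>l<degree P. if l = l0 then b l0 * lead_coeff P else 0)"
    unfolding coeff_numerator_poly
  proof (rule sum.cong)
    fix l assume "l \<in> {..<degree P}"
    show "b l * coeff P (i + Suc l) = (if l = l0 then b l0 * lead_coeff P else 0)"
      using l0(2)[of l] i by (cases "l < l0"; cases "l = l0") (auto simp: coeff_eq_0)
  qed simp
  also have "\<dots> = b l0 * lead_coeff P" using l0(3) assms(1) by simp
  also have "\<dots> \<noteq> 0" using l0(1) assms(1) by auto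
  finally show ?thesis by auto
qed

text \<open>At a common root both values in \<open>irreducible_poly_separation\<close> would vanish,
  against its positive lower bound for a height \<open>H\<close> that exceeds all
  coefficients.\<close>

lemma irreducible_no_common_root:
  assumes "irreducible (P :: int poly)" "N \<noteq> 0" "degree N < degree P" "\<alpha> \<in> croots P"
  shows "poly (of_int_poly N) \<alpha> \<noteq> 0"
proof -
  have "1 \<le> degree P" using assms(3) by simp
  from irreducible_poly_separation[OF this] obtain c :: real where c: "c > 0" and
    *: "\<And>(P' :: int poly) N H z. irreducible P' \<Longrightarrow> degree P' = degree P \<Longrightarrow> N \<noteq> 0 \<Longrightarrow> degree N < degree P \<Longrightarrow> 1 \<le> H \<Longrightarrow>
     (\<forall>i. \<bar>coeff P' i\<bar> \<le> H) \<Longrightarrow> (\<forall>i. \<bar>coeff N i\<bar> \<le> H) \<Longrightarrow>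
     c / ((1 + cmod z) ^ degree P * real_of_int H ^ (2 * degree P - 1))
       \<le> cmod (poly (of_int_poly P') z) + cmod (poly (of_int_poly N) z)"
    by metis
  define H where "H = 1 + (\<Sum>i\<le>degree P. \<bar>coeff P i\<bar>) + (\<Sum>i\<le>degree N. \<bar>coeff N i\<bar>)"
  have sm: "\<bar>coeff Q i\<bar> \<le> (\<Sum>i\<le>degree Q. \<bar>coeff Q i\<bar>)" for Q :: "int poly" and i
    by (cases "i \<le> degree Q") (auto intro!: member_le_sum sum_nonneg simp: coeff_eq_0)
  have nn: "0 \<le> (\<Sum>i\<le>degree Q. \<bar>coeff Q i\<bar>)" for Q :: "int poly" by (intro sum_nonneg) auto
  have HP: "\<bar>coeff P i\<bar> \<le> H" "\<bar>coeff N i\<bar> \<le> H" "1 \<le> H" for i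
    using sm[of P i] sm[of N i] nn[of P] nn[of N] by (auto simp: H_def)
  have "0 < c / ((1 + cmod \<alpha>) ^ degree P * real_of_int H ^ (2 * degree P - 1))"
    using c HP(3) by (intro divide_pos_pos mult_pos_pos zero_less_power add_pos_nonneg) auto
  also have "\<dots> \<le> cmod (poly (of_int_poly P) \<alpha>) + cmod (poly (of_int_poly N) \<alpha>)"
    using assms HP by (intro *) auto
  finally show ?thesis using assms(4) by (auto simp: croots_def)
qed

lemma irreducible_roots_simple:
  assumes "irreducible (P :: int poly)" "\<alpha> \<in> croots P" "1 \<le> degree P"
  shows "poly (pderiv (of_int_poly P)) \<alpha> \<noteq> 0"
proof -
  have "pderiv P \<noteq> 0" "degree (pderiv P) < degree P"
    using assms(3) by (auto simp: pderiv_eq_0_iff degree_pderiv)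
  then have "poly (of_int_poly (pderiv P)) \<alpha> \<noteq> 0"
    using irreducible_no_common_root[OF assms(1)] assms(2) by blast
  then show ?thesis by (simp add: of_int_hom.map_poly_pderiv)
qed

lemma irreducible_factorization:
  assumes "irreducible (P :: int poly)" "1 \<le> degree P"
  shows "finite (croots P)" "card (croots P) = degree P"
    "(of_int_poly P :: complex poly) = Polynomial.smult (of_int (lead_coeff P)) (\<Prod>\<alpha>\<in>croots P. [:- \<alpha>, 1:])"
proof -
  let ?p = "of_int_poly P :: complex poly"
  have nz: "?p \<noteq> 0" using assms by auto
  show fin: "finite (croots P)" unfolding croots_def using poly_roots_finite[OF nz] .
  have "rsquarefree ?p"
    unfolding rsquarefree_roots using irreducible_roots_simple[OF assms(1) _ assms(2)] by (auto simp: croots_def)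
  from complex_poly_decompose_rsquarefree[OF this]
  show *: "?p = Polynomial.smult (of_int (lead_coeff P)) (\<Prod>\<alpha>\<in>croots P. [:- \<alpha>, 1:])"
    by (simp add: croots_def)
  have "degree (\<Prod>\<alpha>\<in>croots P. [:- \<alpha>, 1:]) = card (croots P)"
    by (subst degree_prod_eq_sum_degree) auto
  then show "card (croots P) = degree P"
    using arg_cong[OF *, of degree] assms by auto
qed

lemma det_map_of_int: "Determinant.det (map_mat of_int A) = (of_int (Determinant.det A) :: 'a::{comm_ring_1,ring_char_0})"
  by (simp add: of_int_hom.hom_det)

lemma det_hankel_of_int:
  "Determinant.det (hankel k (\<lambda>i. of_int (b i))) = (of_int (Determinant.det (hankel k b)) :: 'a::{comm_ring_1,ring_char_0})"
proof -
  have "hankel k (\<lambda>i. of_int (b i)) = (map_mat of_int (hankel k b) :: 'a mat)"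
    by (rule eq_matI) (auto simp: hankel_def)
  then show ?thesis by (simp add: det_map_of_int)
qed

lemma det_diagonal_mult:
  fixes D :: "'a::comm_ring_1 mat"
  assumes "A \<in> carrier_mat k k"
  shows "Determinant.det (mat k k (\<lambda>(i, j). d i * A $$ (i, j))) = (\<Prod>i<k. d i) * Determinant.det A"
proof -
  let ?D = "mat k k (\<lambda>(i, j). if i = j then d i else 0)"
  have "mat k k (\<lambda>(i, j). d i * A $$ (i, j)) = ?D * A"
    using assms by (intro eq_matI) (auto simp: scalar_prod_def if_distrib[of "\<lambda>x. x * _"] sum.delta cong: if_cong)
  moreover have "Determinant.det ?D = (\<Prod>i<k. d i)"
    by (subst det_upper_triangular[of _ k]) (auto simp: diag_mat_def prod.list_conv_set_nth atLeast0LessThan)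
  ultimately show ?thesis using det_mult[of ?D k A] assms by simp
qed

text \<open>Writing \<open>f\<close> for the spectral coefficients, the matrix of the functionals \<open>f\<close> times the
  Hankel matrix of \<open>b\<close> is the diagonal matrix of the \<open>f b\<close> times the Vandermonde matrix of the roots.\<close>
lemma det_hankel_spectral:
  assumes irr: "irreducible (P :: int poly)" and k: "1 \<le> degree P"
  shows "\<exists>\<kappa>. \<kappa> \<noteq> 0 \<and> (\<forall>b. (\<forall>l. Suc l < degree P \<longrightarrow> shift_act (of_int_poly P) b l = 0) \<longrightarrow>
     Determinant.det (hankel (degree P) b) = \<kappa> * (\<Prod>\<alpha>\<in>croots P. spectral_coeff P \<alpha> b))"
proof -
  define k where "k = degree P"
  let ?p = "of_int_poly P :: complex poly"
  obtain rs where rs: "set rs = croots P" "distinct rs"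
    using finite_distinct_list[OF irreducible_factorization(1)[OF assms]] by blast
  have len: "length rs = k"
    using irreducible_factorization(2)[OF assms] rs distinct_card k_def by metis
  have rt: "rs ! j \<in> croots P" if "j < k" for j using that len rs nth_mem by blast
  have prs: "(\<Prod>j<k. g (rs ! j)) = (\<Prod>\<alpha>\<in>croots P. g \<alpha>)" for g :: "complex \<Rightarrow> complex"
    using prod.distinct_set_conv_list[OF rs(2), of g] rs(1) len
    by (simp add: prod.list_conv_set_nth atLeast0LessThan)
  define F where "F = mat k k (\<lambda>(j, l). coeff (synthetic_div ?p (rs ! j)) l)"
  define V where "V = mat k k (\<lambda>(j, i). (rs ! j) ^ i)"
  have carr: "F \<in> carrier_mat k k" "V \<in> carrier_mat k k" "hankel k b \<in> carrier_mat k k" for b :: "nat \<Rightarrow> complex"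
    by (auto simp: F_def V_def hankel_def)
  have pair: "poly_pairing (synthetic_div ?p \<alpha>) b = (\<Sum>l<k. coeff (synthetic_div ?p \<alpha>) l * b l)" for \<alpha> b
    by (rule poly_pairing_alt) (use degree_synthetic_div_less[OF k] in \<open>simp add: k_def\<close>)
  \<comment> \<open>Hankel entries reach only up to \<open>b (2 * k - 2)\<close>, so
    \<open>k - 1\<close> instances of the recurrence suffice.\<close>
  have FH: "Determinant.det F * Determinant.det (hankel k b) = (\<Prod>\<alpha>\<in>croots P. spectral_coeff P \<alpha> b) * Determinant.det V"
    if "\<forall>l. Suc l < k \<longrightarrow> shift_act ?p b l = 0" for b
  proof -
    have "F * hankel k b = mat k k (\<lambda>(j, i). spectral_coeff P (rs ! j) b * V $$ (j, i))"
    proof (rule eq_matI)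
      fix j i assume "j < dim_row (mat k k (\<lambda>(j, i). spectral_coeff P (rs ! j) b * V $$ (j, i)))"
        "i < dim_col (mat k k (\<lambda>(j, i). spectral_coeff P (rs ! j) b * V $$ (j, i)))"
      then have ji: "j < k" "i < k" by auto
      have "(F * hankel k b) $$ (j, i) = spectral_coeff P (rs ! j) (\<lambda>l. b (i + l))"
        using ji by (simp add: F_def hankel_def scalar_prod_def spectral_coeff_def pair atLeast0LessThan add.commute)
      also have "\<dots> = (rs ! j) ^ i * spectral_coeff P (rs ! j) b"
        by (rule spectral_coeff_shift_pow[OF rt]) (use that ji in auto)
      finally show "(F * hankel k b) $$ (j, i) = mat k k (\<lambda>(j, i). spectral_coeff P (rs ! j) b * V $$ (j, i)) $$ (j, i)"
        using ji by (simp add: V_def)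
    qed (auto simp: F_def hankel_def)
    then have "Determinant.det (F * hankel k b) = (\<Prod>j<k. spectral_coeff P (rs ! j) b) * Determinant.det V"
      by (simp add: det_diagonal_mult[OF carr(2)])
    then show ?thesis by (simp add: prs[of "\<lambda>\<alpha>. spectral_coeff P \<alpha> b"] det_mult[OF carr(1,3)])
  qed
  \<comment> \<open>Row \<open>i\<close> of \<open>F\<close> is the quotient of \<open>P\<close> by
    its linear factor at root \<open>i\<close>, and the product with the transpose of
    \<open>V\<close> evaluates it at all roots. Only the diagonal survives, with the values of the
    derivative of \<open>P\<close>, nonzero because the roots are simple. So both determinants are
    nonzero and \<open>\<kappa>\<close> can be their quotient.\<close>
  have "F * transpose_mat V = mat k k (\<lambda>(i, j). poly (pderiv ?p) (rs ! i) * 1\<^sub>m k $$ (i, j))"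
  proof (rule eq_matI)
    fix i j assume "i < dim_row (mat k k (\<lambda>(i, j). poly (pderiv ?p) (rs ! i) * 1\<^sub>m k $$ (i, j)))"
      "j < dim_col (mat k k (\<lambda>(i, j). poly (pderiv ?p) (rs ! i) * 1\<^sub>m k $$ (i, j)))"
    then have ij: "i < k" "j < k" by auto
    let ?D = "synthetic_div ?p (rs ! i)"
    have pD: "?p = [:- (rs ! i), 1:] * ?D"
      using synthetic_div_correct'[of "rs ! i" ?p] rt[OF ij(1)] by (simp add: croots_def)
    have "(F * transpose_mat V) $$ (i, j) = (\<Sum>l<k. coeff ?D l * (rs ! j) ^ l)"
      using ij by (simp add: F_def V_def scalar_prod_def atLeast0LessThan)
    also have "\<dots> = poly ?D (rs ! j)"
    proof -
      have "(\<Sum>l\<le>degree ?D. coeff ?D l * (rs ! j) ^ l) = (\<Sum>l<k. coeff ?D l * (rs ! j) ^ l)"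
        by (intro sum.mono_neutral_left)
          (use degree_synthetic_div_less[OF k, of "rs ! i"] in \<open>auto simp: coeff_eq_0 k_def\<close>)
      then show ?thesis by (simp add: poly_altdef)
    qed
    also have "\<dots> = poly (pderiv ?p) (rs ! i) * 1\<^sub>m k $$ (i, j)"
    proof (cases "i = j")
      case True
      have "poly (pderiv ?p) (rs ! i) = poly (pderiv ([:- (rs ! i), 1:] * ?D)) (rs ! i)"
        using pD by (rule arg_cong)
      also have "\<dots> = poly ?D (rs ! i)" by (simp add: pderiv_mult pderiv_pCons del: mult_pCons_left)
      finally show ?thesis using True ij by simp
    next
      case False
      have "poly ([:- (rs ! i), 1:] * ?D) (rs ! j) = 0" using pD rt[OF ij(2)] by (simp add: croots_def)
      moreover have "rs ! i \<noteq> rs ! j" using False ij len rs(2) nth_eq_iff_index_eq by blast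
      ultimately show ?thesis using False ij by simp
    qed
    finally show "(F * transpose_mat V) $$ (i, j) = mat k k (\<lambda>(i, j). poly (pderiv ?p) (rs ! i) * 1\<^sub>m k $$ (i, j)) $$ (i, j)"
      using ij by simp
  qed (auto simp: F_def V_def)
  then have "Determinant.det F * Determinant.det V = (\<Prod>j<k. poly (pderiv ?p) (rs ! j))"
    using det_mult[of F k "transpose_mat V"] det_diagonal_mult[of "1\<^sub>m k" k "\<lambda>i. poly (pderiv ?p) (rs ! i)"] carr
    by (simp add: det_transpose det_one)
  also have "\<dots> \<noteq> 0" using irreducible_roots_simple[OF irr rt k] by simp
  finally have nz: "Determinant.det F \<noteq> 0" "Determinant.det V \<noteq> 0" by auto
  show ?thesis
    unfolding k_def[symmetric]
  proof (intro exI conjI allI impI)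
    show "Determinant.det V / Determinant.det F \<noteq> 0" using nz by simp
    fix b assume "\<forall>l. Suc l < k \<longrightarrow> shift_act ?p b l = 0"
    from FH[OF this] show "Determinant.det (hankel k b) =
       Determinant.det V / Determinant.det F * (\<Prod>\<alpha>\<in>croots P. spectral_coeff P \<alpha> b)"
      using nz by (simp add: field_simps)
  qed
qed

text \<open>The sequences in use are close to a geometric progression only up to some index
  \<open>N\<close>, so just the instances of the recurrence inside this window are required; for
  \<open>N < degree P\<close> there are none.\<close>

definition recurs :: "int poly \<Rightarrow> (nat \<Rightarrow> int) \<Rightarrow> nat \<Rightarrow> bool" where
  "recurs P b N \<longleftrightarrow> (\<forall>l. l + degree P \<le> N \<longrightarrow> shift_act P b l = 0)"

text \<open>The action of \<open>X - m\<close>. On the field element that corresponds to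
  \<open>b\<close> it is multiplication by \<open>\<alpha> - m\<close>, whose norm is, up to sign,
  the value of \<open>P\<close> at \<open>m\<close> over the leading coefficient.\<close>

definition shift_minus :: "int \<Rightarrow> (nat \<Rightarrow> int) \<Rightarrow> nat \<Rightarrow> int" where
  "shift_minus m b l = b (Suc l) - m * b l"

lemma shift_minus_eq: "shift_minus m b = shift_act [:- m, 1:] b"
  by (rule ext) (simp only: shift_minus_def shift_act_linear)

lemma recurs_shift_minus: "recurs P b (Suc N) \<Longrightarrow> recurs P (shift_minus m b) N"
proof -
  assume r: "recurs P b (Suc N)"
  have "shift_act P (shift_minus m b) l = shift_minus m (shift_act P b) l" for l
    unfolding shift_minus_eq by (metis mult.commute shift_act_mult)
  then show ?thesis using r by (auto simp: recurs_def shift_minus_def)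
qed

lemma shift_act_of_int:
  "shift_act (of_int_poly P) (\<lambda>i. of_int (b i)) l = (of_int (shift_act P b l) :: 'a::{comm_ring_1,ring_char_0})"
  by (simp add: shift_act_def poly_pairing_of_int)

lemma det_hankel_nonzero:
  assumes irr: "irreducible (P :: int poly)" and k: "1 \<le> degree P"
    and r: "recurs P b (2 * degree P - 2)" and l: "l < degree P" "b l \<noteq> 0"
  shows "Determinant.det (hankel (degree P) b) \<noteq> 0"
proof -
  obtain \<kappa> where \<kappa>: "\<kappa> \<noteq> 0" "\<And>b. (\<forall>l. Suc l < degree P \<longrightarrow> shift_act (of_int_poly P) b l = 0) \<Longrightarrow>
     Determinant.det (hankel (degree P) b) = \<kappa> * (\<Prod>\<alpha>\<in>croots P. spectral_coeff P \<alpha> b)"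
    using det_hankel_spectral[OF irr k] by blast
  have "of_int (Determinant.det (hankel (degree P) b)) =
      \<kappa> * (\<Prod>\<alpha>\<in>croots P. spectral_coeff P \<alpha> (\<lambda>i. of_int (b i)))"
    using \<kappa>(2)[of "\<lambda>i. of_int (b i)"] r by (auto simp: det_hankel_of_int shift_act_of_int recurs_def)
  also have "\<dots> \<noteq> 0"
    using \<kappa>(1) irreducible_factorization(1)[OF irr k] irreducible_no_common_root[OF irr numerator_poly_nonzero[where b = b, OF l] degree_numerator_poly[OF k]]
    by (simp add: spectral_coeff_numerator[OF k])
  finally show ?thesis by simp
qed

text \<open>Every spectral coefficient is multiplied by \<open>\<alpha> - m\<close>, and the product
  of these factors over the roots is \<open>poly P m\<close> divided by the leading coefficient, up
  to sign. The shift uses one more term of the recurrence, whence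
  \<open>2 * degree P - 1\<close>.\<close>

lemma det_hankel_shift_minus:
  assumes irr: "irreducible (P :: int poly)" and k: "1 \<le> degree P"
    and r: "recurs P b (2 * degree P - 1)"
  shows "lead_coeff P * Determinant.det (hankel (degree P) (shift_minus m b)) =
    (- 1) ^ degree P * poly P m * Determinant.det (hankel (degree P) b)"
proof -
  obtain \<kappa> where \<kappa>: "\<kappa> \<noteq> 0" "\<And>b. (\<forall>l. Suc l < degree P \<longrightarrow> shift_act (of_int_poly P) b l = 0) \<Longrightarrow>
     Determinant.det (hankel (degree P) b) = \<kappa> * (\<Prod>\<alpha>\<in>croots P. spectral_coeff P \<alpha> b)"
    using det_hankel_spectral[OF irr k] by blast
  have det: "of_int (Determinant.det (hankel (degree P) b)) =
      \<kappa> * (\<Prod>\<alpha>\<in>croots P. spectral_coeff P \<alpha> (\<lambda>i. of_int (b i)))" if "recurs P b (2 * degree P - 2)" for b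
    using \<kappa>(2)[of "\<lambda>i. of_int (b i)"] that by (auto simp: det_hankel_of_int shift_act_of_int recurs_def)
  have rm: "recurs P (shift_minus m b) (2 * degree P - 2)"
  proof -
    have "2 * degree P - 1 = Suc (2 * degree P - 2)" using k by simp
    then show ?thesis using recurs_shift_minus[of P b "2 * degree P - 2" m] r by metis
  qed
  have rb: "recurs P b (2 * degree P - 2)" using r by (auto simp: recurs_def)
  have p0: "poly_pairing (of_int_poly P) (\<lambda>i. of_int (b i)) = (0 :: complex)"
    using r k unfolding poly_pairing_of_int recurs_def by (auto simp: shift_act_def dest: spec[of _ 0])
  have sc: "spectral_coeff P \<alpha> (\<lambda>i. of_int (shift_minus m b i)) = (\<alpha> - of_int m) * spectral_coeff P \<alpha> (\<lambda>i. of_int (b i))"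
    if "\<alpha> \<in> croots P" for \<alpha>
  proof -
    have "spectral_coeff P \<alpha> (\<lambda>i. of_int (shift_minus m b i)) =
       spectral_coeff P \<alpha> (\<lambda>i. of_int (b (Suc i))) - of_int m * spectral_coeff P \<alpha> (\<lambda>i. of_int (b i))"
      by (simp add: spectral_coeff_def poly_pairing_def shift_minus_def algebra_simps sum_subtractf sum_distrib_left)
    then show ?thesis using spectral_coeff_shift[OF that, of "\<lambda>i. of_int (b i)"] p0 by (simp add: algebra_simps)
  qed
  have "of_int (lead_coeff P) * (\<Prod>\<alpha>\<in>croots P. of_int m - \<alpha>) = poly (of_int_poly P) (of_int m)"
    using arg_cong[OF irreducible_factorization(3)[OF irr k], of "\<lambda>q. poly q (of_int m)"] by (simp add: poly_prod)
  also have "(\<Prod>\<alpha>\<in>croots P. of_int m - \<alpha>) = (\<Prod>\<alpha>\<in>croots P. (- 1) * (\<alpha> - of_int m))"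
    by (rule prod.cong) auto
  also have "\<dots> = (- 1) ^ degree P * (\<Prod>\<alpha>\<in>croots P. \<alpha> - of_int m)"
    by (subst prod.distrib) (simp add: irreducible_factorization(2)[OF irr k])
  finally have pr: "of_int (lead_coeff P) * (\<Prod>\<alpha>\<in>croots P. \<alpha> - of_int m) = (- 1) ^ degree P * (of_int (poly P m) :: complex)"
  proof -
    assume *: "of_int (lead_coeff P) * ((- 1) ^ degree P * (\<Prod>\<alpha>\<in>croots P. \<alpha> - of_int m)) = poly (of_int_poly P) (of_int m :: complex)"
    have one: "(- 1) ^ degree P * (- 1) ^ degree P = (1 :: complex)" by (simp flip: power_mult_distrib)
    have "of_int (lead_coeff P) * (\<Prod>\<alpha>\<in>croots P. \<alpha> - of_int m) =
      (- 1) ^ degree P * (of_int (lead_coeff P) * ((- 1) ^ degree P * (\<Prod>\<alpha>\<in>croots P. \<alpha> - of_int m)))"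
      using one by (simp add: mult.left_commute mult.assoc[symmetric])
    then show ?thesis unfolding * by simp
  qed
  have "(of_int (lead_coeff P * Determinant.det (hankel (degree P) (shift_minus m b))) :: complex) =
     of_int (lead_coeff P) * (\<Prod>\<alpha>\<in>croots P. \<alpha> - of_int m) * (\<kappa> * (\<Prod>\<alpha>\<in>croots P. spectral_coeff P \<alpha> (\<lambda>i. of_int (b i))))"
    using det[OF rm] sc by (simp add: prod.distrib)
  also have "\<dots> = of_int ((- 1) ^ degree P * poly P m * Determinant.det (hankel (degree P) b))"
    unfolding pr using det[OF rb] by simp
  finally show ?thesis by (simp only: of_int_eq_iff)
qed

text \<open>Each shift consumes one term. This is the origin of the windows
  \<open>2 * k - 2 + g\<close> from here on: the Hankel determinant occupies
  \<open>2 * k - 2\<close>, and \<open>g\<close> shifts remain available.\<close>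

lemma det_hankel_fold_shift_minus:
  assumes irr: "irreducible (P :: int poly)" and k: "1 \<le> degree P"
    and "recurs P b (2 * degree P - 2 + length ms)"
  shows "\<bar>lead_coeff P\<bar> ^ length ms * \<bar>Determinant.det (hankel (degree P) (fold shift_minus ms b))\<bar> =
    (\<Prod>m\<leftarrow>ms. \<bar>poly P m\<bar>) * \<bar>Determinant.det (hankel (degree P) b)\<bar>"
  using assms(3)
proof (induction ms arbitrary: b)
  case (Cons m ms)
  have r: "recurs P (shift_minus m b) (2 * degree P - 2 + length ms)"
    using Cons.prems by (intro recurs_shift_minus) simp
  have "recurs P b (2 * degree P - 1)"
    using Cons.prems k by (auto simp: recurs_def)
  from det_hankel_shift_minus[OF irr k this, of m]
  have "\<bar>lead_coeff P\<bar> * \<bar>Determinant.det (hankel (degree P) (shift_minus m b))\<bar> =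
    \<bar>poly P m\<bar> * \<bar>Determinant.det (hankel (degree P) b)\<bar>"
    by (metis (no_types, lifting) abs_mult abs_neg_one mult_1 power_abs power_one)
  then show ?case using Cons.IH[OF r] by (simp add: algebra_simps)
qed simp

subsection \<open>Arithmetic and analytic bounds for Hankel determinants\<close>

text \<open>Interpolation at \<open>0, ..., k\<close> with cleared denominators: up to sign, the
  adjugate of the Vandermonde matrix supplies \<open>L\<close> and its determinant supplies
  \<open>D\<close>, and both depend on \<open>k\<close> only.\<close>

lemma coeff_from_values:
  "\<exists>D>0. \<exists>L :: nat \<Rightarrow> nat \<Rightarrow> int. \<forall>P. degree P \<le> k \<longrightarrow> (\<forall>i\<le>k. D * coeff P i = (\<Sum>j\<le>k. L i j * poly P (int j)))"
proof -
  let ?n = "Suc k"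
  define A :: "int mat" where "A = mat ?n ?n (\<lambda>(j, i). int j ^ i)"
  have A: "A \<in> carrier_mat ?n ?n" by (simp add: A_def)
  \<comment> \<open>A kernel vector would be the coefficient list of a nonzero polynomial of degree
    at most \<open>k\<close> with \<open>k + 1\<close> roots.\<close>
  have "Determinant.det A \<noteq> 0"
  proof
    assume "Determinant.det A = 0"
    then obtain v where v: "v \<in> carrier_vec ?n" "v \<noteq> 0\<^sub>v ?n" "A *\<^sub>v v = 0\<^sub>v ?n"
      using det_0_iff_vec_prod_zero[OF A] by blast
    let ?q = "Poly (map (vec_index v) [0..<?n])"
    have co: "coeff ?q i = (if i < ?n then vec_index v i else 0)" for i
      by (simp add: coeff_Poly_eq nth_default_def del: upt_Suc)
    have "?q \<noteq> 0"
    proof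
      assume q0: "?q = 0"
      have "v = 0\<^sub>v ?n"
      proof (rule eq_vecI)
        fix i assume "i < dim_vec (0\<^sub>v ?n :: int vec)"
        then show "vec_index v i = vec_index (0\<^sub>v ?n) i" using co[of i] unfolding q0 by simp
      qed (use v in auto)
      then show False using v by simp
    qed
    have deg: "degree ?q \<le> k" by (rule degree_le) (use co in auto)
    have "poly ?q (int j) = 0" if "j < ?n" for j
    proof -
      have "poly ?q (int j) = (\<Sum>i<?n. coeff ?q i * int j ^ i)"
        unfolding poly_altdef using deg by (intro sum.mono_neutral_left) (auto simp: coeff_eq_0 simp del: coeff_Poly_eq)
      also have "\<dots> = (\<Sum>i<?n. vec_index v i * int j ^ i)" by (intro sum.cong) (auto simp only: co, simp)
      also have "\<dots> = vec_index (A *\<^sub>v v) j"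
        using that v(1) unfolding A_def by (simp add: scalar_prod_def atLeast0LessThan mult.commute del: sum.lessThan_Suc)
      also have "\<dots> = 0" using v that by simp
      finally show ?thesis .
    qed
    then have "int ` {..<?n} \<subseteq> {x. poly ?q x = 0}" by auto
    then have "card (int ` {..<?n}) \<le> card {x. poly ?q x = 0}"
      using poly_roots_finite[OF \<open>?q \<noteq> 0\<close>] by (intro card_mono)
    also have "\<dots> \<le> k" using card_poly_roots_bound[OF \<open>?q \<noteq> 0\<close>] deg by (simp add: order_trans)
    finally show False by (simp add: card_image)
  qed
  define D where "D = \<bar>Determinant.det A\<bar>"
  define L where "L i j = sgn (Determinant.det A) * adj_mat A $$ (i, j)" for i j
  have "D * coeff P i = (\<Sum>j\<le>k. L i j * poly P (int j))" if "degree P \<le> k" "i \<le> k" for P i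
  proof -
    have pj: "poly P (int j) = (\<Sum>l<?n. A $$ (j, l) * coeff P l)" if "j \<le> k" for j
    proof -
      have "poly P (int j) = (\<Sum>l<?n. coeff P l * int j ^ l)"
        unfolding poly_altdef using \<open>degree P \<le> k\<close> by (intro sum.mono_neutral_left) (auto simp: coeff_eq_0)
      then show ?thesis using that by (simp add: A_def mult.commute)
    qed
    have "(\<Sum>j\<le>k. adj_mat A $$ (i, j) * poly P (int j)) = (\<Sum>j\<le>k. \<Sum>l<?n. adj_mat A $$ (i, j) * A $$ (j, l) * coeff P l)"
      by (intro sum.cong refl) (simp only: pj atMost_iff sum_distrib_left mult.assoc)
    also have "\<dots> = (\<Sum>l<?n. (\<Sum>j<?n. adj_mat A $$ (i, j) * A $$ (j, l)) * coeff P l)"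
      unfolding lessThan_Suc_atMost by (subst sum.swap) (simp add: sum_distrib_right)
    also have "\<dots> = (\<Sum>l<?n. (adj_mat A * A) $$ (i, l) * coeff P l)"
      using A adj_mat(1)[OF A] \<open>i \<le> k\<close> by (intro sum.cong refl) (simp add: scalar_prod_def atLeast0LessThan)
    also have "\<dots> = (\<Sum>l<?n. if l = i then Determinant.det A * coeff P i else 0)"
      unfolding adj_mat(3)[OF A] using \<open>i \<le> k\<close> by (intro sum.cong refl) auto
    also have "\<dots> = Determinant.det A * coeff P i" using \<open>i \<le> k\<close> by simp
    finally have "sgn (Determinant.det A) * (\<Sum>j\<le>k. adj_mat A $$ (i, j) * poly P (int j)) = D * coeff P i"
      by (simp add: D_def abs_sgn mult_ac)
    then show ?thesis by (simp add: L_def sum_distrib_left mult.assoc)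
  qed
  then show ?thesis using \<open>Determinant.det A \<noteq> 0\<close> by (intro exI[of _ D] exI[of _ L]) (auto simp: D_def)
qed

text \<open>In lowest terms the denominator of \<open>y\<close> divides every coefficient of
  \<open>P\<close>, hence the content \<open>1\<close>.\<close>

lemma Ints_of_mult_coeffs_primitive:
  fixes P :: "int poly" and y :: real
  assumes "y \<in> \<rat>" "content P = 1" "\<And>i. y * of_int (coeff P i) \<in> \<int>"
  shows "y \<in> \<int>"
proof -
  obtain a b where ab: "0 < b" "algebraic_semidom_class.coprime a b" "y = of_int a / of_int b"
    using Rats_cases'[OF assms(1)] by metis
  have "b dvd coeff P i" for i
  proof -
    obtain n where "y * of_int (coeff P i) = of_int n" using assms(3)[of i] by (auto elim: Ints_cases)
    then have "real_of_int (a * coeff P i) = real_of_int (n * b)" using ab by (simp add: field_simps)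
    then have "a * coeff P i = n * b" by (simp only: of_int_eq_iff)
    then have "b dvd a * coeff P i" by simp
    moreover have "algebraic_semidom_class.coprime b a" using ab(2) by (simp add: algebraic_semidom_class.coprime_commute)
    ultimately show ?thesis using coprime_dvd_mult_right_iff by blast
  qed
  then have "b dvd content P" by (auto simp: content_iff coeffs_def split: if_splits)
  then have "b = 1" using assms(2) ab(1) by simp
  then show ?thesis using ab by simp
qed

text \<open>Interpolation trades one of the \<open>g\<close> values of \<open>P\<close> for an
  arbitrary coefficient at the cost of a factor \<open>D\<close>, and primitivity then removes this
  coefficient. The induction removes the \<open>g\<close> values one at a time.\<close>

lemma Ints_of_mult_values_primitive:
  fixes P :: "int poly" and y :: real
  assumes DL: "\<And>i. i \<le> k \<Longrightarrow> D * coeff P i = (\<Sum>j\<le>k. L i j * poly P (int j))"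
    and P: "degree P \<le> k" "content P = 1"
    and "y \<in> \<rat>" "\<And>ms. length ms = g \<Longrightarrow> y * of_int (\<Prod>m\<leftarrow>ms. poly P m) \<in> \<int>"
  shows "y * of_int D ^ g \<in> \<int>"
  using assms(4,5)
proof (induction g arbitrary: y)
  case 0
  then show ?case using 0(2)[of "[]"] by simp
next
  case (Suc g)
  have "(y * of_int D) * of_int (\<Prod>m\<leftarrow>ms. poly P m) \<in> \<int>" if ms: "length ms = g" for ms
  proof (rule Ints_of_mult_coeffs_primitive[OF _ P(2)])
    show "y * of_int D * of_int (\<Prod>m\<leftarrow>ms. poly P m) \<in> \<rat>" using Suc.prems(1) by simp
    fix i
    show "y * of_int D * of_int (\<Prod>m\<leftarrow>ms. poly P m) * of_int (coeff P i) \<in> \<int>"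
    proof (cases "i \<le> k")
      case True
      have "y * of_int D * of_int (\<Prod>m\<leftarrow>ms. poly P m) * of_int (coeff P i) =
         y * of_int (\<Prod>m\<leftarrow>ms. poly P m) * of_int (D * coeff P i)" by simp
      also have "\<dots> = (\<Sum>j\<le>k. of_int (L i j) * (y * of_int (\<Prod>m\<leftarrow>int j # ms. poly P m)))"
        unfolding DL[OF True] by (simp add: sum_distrib_left mult_ac)
      also have "\<dots> \<in> \<int>" using ms by (intro Ints_sum Ints_mult Suc.prems(2)) auto
      finally show ?thesis .
    qed (use P(1) in \<open>simp add: coeff_eq_0\<close>)
  qed
  then have "(y * of_int D) * of_int D ^ g \<in> \<int>" using Suc.prems(1) by (intro Suc.IH) auto
  then show ?case by (simp add: mult.assoc)
qed

text \<open>The determinant over the \<open>g\<close>-th power of the leading coefficient becomes an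
  integer when multiplied by any product of \<open>g\<close> values of \<open>P\<close> at integers,
  being then up to sign the Hankel determinant of a \<open>g\<close>-fold shifted sequence. By
  primitivity a bounded factor does the same as these products, and the resulting integer is
  nonzero.\<close>

lemma det_hankel_lower:
  "\<exists>D>0. \<forall>P b. irreducible (P :: int poly) \<longrightarrow> content P = 1 \<longrightarrow> 1 \<le> degree P \<longrightarrow> degree P = k \<longrightarrow>
     recurs P b (2 * k - 2 + g) \<longrightarrow> (\<exists>l<k. b l \<noteq> 0) \<longrightarrow>
     \<bar>real_of_int (lead_coeff P)\<bar> ^ g \<le> D * \<bar>real_of_int (Determinant.det (hankel k b))\<bar>"
proof -
  obtain D L where DL: "D > 0" "\<And>P i. degree P \<le> k \<Longrightarrow> i \<le> k \<Longrightarrow> D * coeff P i = (\<Sum>j\<le>k. L i j * poly P (int j))"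
    using coeff_from_values[of k] by blast
  show ?thesis
  proof (intro exI[of _ "of_int D ^ g"] conjI allI impI)
    fix P :: "int poly" and b
    assume irr: "irreducible P" and P: "content P = 1" "1 \<le> degree P" "degree P = k"
      and r: "recurs P b (2 * k - 2 + g)" and nz: "\<exists>l<k. b l \<noteq> 0"
    define c where "c = \<bar>real_of_int (lead_coeff P)\<bar>"
    have c: "c > 0" using P by (auto simp: c_def)
    let ?d = "\<bar>real_of_int (Determinant.det (hankel k b))\<bar>"
    have "?d / c ^ g * of_int D ^ g \<in> \<int>"
    proof (rule Ints_of_mult_values_primitive[OF _ _ P(1)])
      show "D * coeff P i = (\<Sum>j\<le>k. L i j * poly P (int j))" if "i \<le> k" for i using DL(2) P(3) that by simp
      show "degree P \<le> k" using P by simp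
      show "?d / c ^ g \<in> \<rat>" unfolding c_def by simp
      fix ms :: "int list" assume ms: "length ms = g"
      have "\<bar>lead_coeff P\<bar> ^ g * \<bar>Determinant.det (hankel k (fold shift_minus ms b))\<bar> =
         (\<Prod>m\<leftarrow>ms. \<bar>poly P m\<bar>) * \<bar>Determinant.det (hankel k b)\<bar>"
        using det_hankel_fold_shift_minus[OF irr P(2), of b ms] r P(3) ms by simp
      from arg_cong[OF this, of real_of_int]
      have "c ^ g * of_int \<bar>Determinant.det (hankel k (fold shift_minus ms b))\<bar> = of_int (\<Prod>m\<leftarrow>ms. \<bar>poly P m\<bar>) * ?d"
        by (simp add: c_def)
      then have e: "?d / c ^ g * of_int (\<Prod>m\<leftarrow>ms. \<bar>poly P m\<bar>) = of_int \<bar>Determinant.det (hankel k (fold shift_minus ms b))\<bar>"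
        using c by (simp add: field_simps)
      have "(\<Prod>m\<leftarrow>ms. \<bar>poly P m\<bar>) = \<bar>\<Prod>m\<leftarrow>ms. poly P m\<bar>"
        by (induction ms) (auto simp: abs_mult)
      then have "?d / c ^ g * of_int (\<Prod>m\<leftarrow>ms. poly P m) = of_int \<bar>Determinant.det (hankel k (fold shift_minus ms b))\<bar> \<or>
        ?d / c ^ g * of_int (\<Prod>m\<leftarrow>ms. poly P m) = - of_int \<bar>Determinant.det (hankel k (fold shift_minus ms b))\<bar>"
        using e by (cases "(\<Prod>m\<leftarrow>ms. poly P m) \<ge> 0") auto
      then show "?d / c ^ g * of_int (\<Prod>m\<leftarrow>ms. poly P m) \<in> \<int>"
        by (metis Ints_minus Ints_of_int)
    qed
    moreover have "?d \<noteq> 0"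
    proof -
      have "recurs P b (2 * degree P - 2)" using r P(3) by (auto simp: recurs_def)
      then show ?thesis using det_hankel_nonzero[OF irr P(2)] nz P(3) by auto
    qed
    then have "0 < ?d / c ^ g * of_int D ^ g" using c DL(1) by simp
    ultimately have "1 \<le> ?d / c ^ g * of_int D ^ g" by (auto elim!: Ints_cases)
    then show "\<bar>real_of_int (lead_coeff P)\<bar> ^ g \<le> of_int D ^ g * ?d"
      using c by (simp add: c_def[symmetric] field_simps)
  qed (use DL in simp)
qed

text \<open>Subtracting \<open>x\<close> times the preceding row from every row but the first leaves
  entries of size at most \<open>E\<close> there, so each of the \<open>k!\<close> terms of the
  Leibniz expansion has one factor bounded by \<open>B\<close> and \<open>k - 1\<close> factors
  bounded by \<open>E\<close>.\<close>

lemma det_hankel_upper: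
  fixes b :: "nat \<Rightarrow> real"
  assumes "1 \<le> k" "\<And>l. l \<le> 2 * k - 2 \<Longrightarrow> \<bar>b l\<bar> \<le> B" "\<And>l. l < 2 * k - 2 \<Longrightarrow> \<bar>b (Suc l) - x * b l\<bar> \<le> E"
  shows "\<bar>Determinant.det (hankel k b)\<bar> \<le> fact k * B * E ^ (k - 1)"
proof -
  define L where "L = mat k k (\<lambda>(i, j). if i = j then 1 else if i = Suc j then - x else (0::real))"
  define M where "M = mat k k (\<lambda>(i, j). if i = 0 then b j else b (i + j) - x * b (i - 1 + j))"
  have carr: "L \<in> carrier_mat k k" "hankel k b \<in> carrier_mat k k" "M \<in> carrier_mat k k"
    by (auto simp: L_def M_def hankel_def)
  have "L * hankel k b = M"
  proof (rule eq_matI)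
    fix i j assume "i < dim_row M" "j < dim_col M"
    then have ij: "i < k" "j < k" by (auto simp: M_def)
    have "(L * hankel k b) $$ (i, j) = (\<Sum>l<k. (if i = l then b (l + j) else 0) + (if i = Suc l then - x * b (l + j) else 0))"
      using ij by (simp add: L_def hankel_def scalar_prod_def atLeast0LessThan) (intro sum.cong, auto)
    also have "\<dots> = b (i + j) + (\<Sum>l<k. if i = Suc l then - x * b (l + j) else 0)"
      using ij by (simp add: sum.distrib)
    also have "(\<Sum>l<k. if i = Suc l then - x * b (l + j) else 0) = (if i = 0 then 0 else - x * b (i - 1 + j))"
    proof (cases i)
      case (Suc i')
      have "(\<Sum>l<k. if i = Suc l then - x * b (l + j) else 0) = (\<Sum>l<k. if l = i' then - x * b (l + j) else 0)"
        using Suc by (intro sum.cong) auto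
      then show ?thesis using Suc ij by simp
    qed simp
    finally show "(L * hankel k b) $$ (i, j) = M $$ (i, j)" using ij by (simp add: M_def)
  qed (auto simp: L_def M_def hankel_def)
  moreover have "Determinant.det L = 1"
    by (subst det_lower_triangular[of k]) (auto simp: L_def diag_mat_def prod.list_conv_set_nth)
  ultimately have "Determinant.det (hankel k b) = Determinant.det M"
    using det_mult[OF carr(1,2)] by simp
  also have "\<bar>\<dots>\<bar> \<le> (\<Sum>p | p permutes {0..<k}. \<bar>of_int (sign p) * (\<Prod>i = 0..<k. M $$ (i, p i))\<bar>)"
    unfolding det_def'[OF carr(3)] by (rule sum_abs)
  also have "\<dots> \<le> (\<Sum>p | p permutes {0..<k}. B * E ^ (k - 1))"
  proof (rule sum_mono)
    fix p assume "p \<in> {p. p permutes {0..<k}}"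
    then have p: "p i < k" if "i < k" for i using permutes_in_image[of p "{0..<k}" i] that by auto
    obtain k' where k': "k = Suc k'" using assms(1) by (cases k) auto
    have "\<bar>of_int (sign p) * (\<Prod>i = 0..<k. M $$ (i, p i))\<bar> = (\<Prod>i = 0..<k. \<bar>M $$ (i, p i)\<bar>)"
      by (simp add: abs_mult abs_prod sign_def)
    also have "\<dots> = \<bar>M $$ (0, p 0)\<bar> * (\<Prod>i = 0..<k'. \<bar>M $$ (Suc i, p (Suc i))\<bar>)"
      unfolding k' by (rule prod.atLeast0_lessThan_Suc_shift[unfolded comp_def])
    also have "\<dots> \<le> B * (\<Prod>i = 0..<k'. E)"
    proof (intro mult_mono prod_mono conjI)
      show "\<bar>M $$ (0, p 0)\<bar> \<le> B" using p[of 0] k' assms(2)[of "p 0"] by (auto simp: M_def)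
      show "0 \<le> B" using assms(2)[of 0] by linarith
      fix i assume "i \<in> {0..<k'}"
      then show "\<bar>M $$ (Suc i, p (Suc i))\<bar> \<le> E"
        using p[of "Suc i"] k' assms(3)[of "i + p (Suc i)"] by (auto simp: M_def)
    qed (auto intro: prod_nonneg)
    also have "\<dots> = B * E ^ (k - 1)" by (simp add: k')
    finally show "\<bar>of_int (sign p) * (\<Prod>i = 0..<k. M $$ (i, p i))\<bar> \<le> B * E ^ (k - 1)" .
  qed
  also have "\<dots> = fact k * B * E ^ (k - 1)" by (simp add: card_permutations)
  finally show ?thesis .
qed

lemma fold_shift_minus_bounds:
  fixes b :: "nat \<Rightarrow> int" and x :: real and m :: int
  assumes "\<And>l. l \<le> N + g \<Longrightarrow> \<bar>real_of_int (b l)\<bar> \<le> B"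
    "\<And>l. l < N + g \<Longrightarrow> \<bar>real_of_int (b (Suc l)) - x * real_of_int (b l)\<bar> \<le> E"
  shows "(\<forall>l\<le>N. \<bar>real_of_int (fold shift_minus (replicate g m) b l)\<bar> \<le> (1 + \<bar>real_of_int m\<bar>) ^ g * B) \<and>
    (\<forall>l<N. \<bar>real_of_int (fold shift_minus (replicate g m) b (Suc l)) -
       x * real_of_int (fold shift_minus (replicate g m) b l)\<bar> \<le> (1 + \<bar>real_of_int m\<bar>) ^ g * E)"
  using assms
proof (induction g arbitrary: b B E)
  case (Suc g)
  let ?b = "shift_minus m b"
  have 1: "\<bar>real_of_int (?b l)\<bar> \<le> (1 + \<bar>real_of_int m\<bar>) * B" if "l \<le> N + g" for l
  proof -
    have "\<bar>real_of_int (?b l)\<bar> \<le> \<bar>real_of_int (b (Suc l))\<bar> + \<bar>real_of_int m\<bar> * \<bar>real_of_int (b l)\<bar>"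
      unfolding shift_minus_def abs_mult[symmetric] of_int_diff of_int_mult by (rule abs_triangle_ineq4)
    also have "\<dots> \<le> B + \<bar>real_of_int m\<bar> * B" using that Suc.prems(1) by (intro add_mono mult_left_mono) auto
    finally show ?thesis by (simp add: algebra_simps)
  qed
  have 2: "\<bar>real_of_int (?b (Suc l)) - x * real_of_int (?b l)\<bar> \<le> (1 + \<bar>real_of_int m\<bar>) * E" if "l < N + g" for l
  proof -
    let ?e = "\<lambda>l. real_of_int (b (Suc l)) - x * real_of_int (b l)"
    have "real_of_int (?b (Suc l)) - x * real_of_int (?b l) = ?e (Suc l) - real_of_int m * ?e l"
      by (simp add: shift_minus_def algebra_simps)
    also have "\<bar>\<dots>\<bar> \<le> \<bar>?e (Suc l)\<bar> + \<bar>real_of_int m\<bar> * \<bar>?e l\<bar>"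
      unfolding abs_mult[symmetric] by (rule abs_triangle_ineq4)
    also have "\<dots> \<le> E + \<bar>real_of_int m\<bar> * E" using that Suc.prems(2) by (intro add_mono mult_left_mono) auto
    finally show ?thesis by (simp add: algebra_simps)
  qed
  show ?case
    using Suc.IH[where b = "?b" and B = "(1 + \<bar>real_of_int m\<bar>) * B" and E = "(1 + \<bar>real_of_int m\<bar>) * E", OF 1 2]
    by (simp add: mult_ac)
qed simp

section \<open>Mahler measure compared with values at integers\<close>

lemma mahler_measure_le_sum_coeffs: "mahler_measure P \<le> (\<Sum>i\<le>degree P. \<bar>real_of_int (coeff P i)\<bar>)"
proof (cases "P = 0")
  case False
  have "(\<Sum>a\<leftarrow>coeffs P. a * a) = (\<Sum>i\<le>degree P. (coeff P i)\<^sup>2)"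
    using False by (simp add: coeffs_def sum_list_sum_nth atLeast0LessThan lessThan_Suc_atMost power2_eq_square del: upt_Suc)
  then have "mahler_measure P \<le> L2_set (\<lambda>i. real_of_int (coeff P i)) {..degree P}"
    using Landau_inequality_mahler_measure[of P] by (simp add: L2_set_def)
  also have "\<dots> \<le> (\<Sum>i\<le>degree P. \<bar>real_of_int (coeff P i)\<bar>)" by (rule L2_set_le_sum_abs)
  finally show ?thesis .
qed (simp add: mahler_measure_def)

text \<open>Interpolation bounds the coefficients by the values at \<open>0, ..., k\<close>, so the
  largest of these values dominates the Mahler measure. The point \<open>m\<close> where it occurs
  is the one to shift by.\<close>

lemma mahler_measure_le_value:
  "\<exists>C>0. \<forall>P. degree P \<le> k \<longrightarrow> (\<exists>m\<le>k. mahler_measure P \<le> C * \<bar>real_of_int (poly P (int m))\<bar>)"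
proof -
  obtain D L where DL: "D > 0" "\<And>P i. degree P \<le> k \<Longrightarrow> i \<le> k \<Longrightarrow> D * coeff P i = (\<Sum>j\<le>k. L i j * poly P (int j))"
    using coeff_from_values[of k] by blast
  define C where "C = 1 + (\<Sum>i\<le>k. \<Sum>j\<le>k. \<bar>real_of_int (L i j)\<bar>)"
  have "C > 0" unfolding C_def by (intro add_pos_nonneg sum_nonneg) auto
  moreover have "\<exists>m\<le>k. mahler_measure P \<le> C * \<bar>real_of_int (poly P (int m))\<bar>" if P: "degree P \<le> k" for P
  proof -
    define V where "V = Max ((\<lambda>j. \<bar>real_of_int (poly P (int j))\<bar>) ` {..k})"
    have "V \<in> (\<lambda>j. \<bar>real_of_int (poly P (int j))\<bar>) ` {..k}" unfolding V_def by (rule Max_in) auto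
    then obtain m where m: "m \<le> k" "V = \<bar>real_of_int (poly P (int m))\<bar>" by auto
    have V: "\<bar>real_of_int (poly P (int j))\<bar> \<le> V" if "j \<le> k" for j
      unfolding V_def using that by (intro Max_ge) auto
    have "mahler_measure P \<le> (\<Sum>i\<le>degree P. \<bar>real_of_int (coeff P i)\<bar>)" by (rule mahler_measure_le_sum_coeffs)
    also have "\<dots> \<le> (\<Sum>i\<le>k. \<bar>real_of_int (coeff P i)\<bar>)" using P by (intro sum_mono2) auto
    also have "\<dots> \<le> (\<Sum>i\<le>k. \<Sum>j\<le>k. \<bar>real_of_int (L i j)\<bar> * V)"
    proof (rule sum_mono)
      fix i assume "i \<in> {..k}"
      have "\<bar>real_of_int (coeff P i)\<bar> \<le> \<bar>real_of_int (D * coeff P i)\<bar>"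
        using mult_right_mono[of 1 D "\<bar>coeff P i\<bar>"] DL(1) by (simp add: abs_mult flip: of_int_abs of_int_mult)
      also have "\<dots> = \<bar>\<Sum>j\<le>k. real_of_int (L i j) * real_of_int (poly P (int j))\<bar>"
        using DL(2)[OF P, of i] \<open>i \<in> {..k}\<close> by simp
      also have "\<dots> \<le> (\<Sum>j\<le>k. \<bar>real_of_int (L i j)\<bar> * V)"
        using V by (intro order_trans[OF sum_abs] sum_mono) (auto simp: abs_mult intro!: mult_left_mono)
      finally show "\<bar>real_of_int (coeff P i)\<bar> \<le> (\<Sum>j\<le>k. \<bar>real_of_int (L i j)\<bar> * V)" .
    qed
    also have "\<dots> \<le> C * V" using V[of 0] by (simp add: C_def sum_distrib_right[symmetric] distrib_right)
    finally show ?thesis using m by auto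
  qed
  ultimately show ?thesis by blast
qed

text \<open>The determinant of \<open>b\<close> is not estimated directly. After \<open>g\<close>
  shifts by a good integer \<open>m\<close> the sequence approximates as well as before up to
  constants, while its determinant has been multiplied by the \<open>g\<close>-th power of the value
  of \<open>P\<close> at \<open>m\<close> over the leading coefficient. Bounding the shifted
  determinant therefore gains \<open>mahler_measure P ^ g\<close>.\<close>

lemma det_hankel_approximable:
  assumes "1 \<le> k"
  shows "\<exists>C>0. \<forall>P b x W E. irreducible (P :: int poly) \<longrightarrow> degree P = k \<longrightarrow> recurs P b (2 * k - 2 + g) \<longrightarrow>
     (\<forall>l \<le> 2 * k - 2 + g. \<bar>real_of_int (b l)\<bar> \<le> W) \<longrightarrow>
     (\<forall>l < 2 * k - 2 + g. \<bar>real_of_int (b (Suc l)) - x * real_of_int (b l)\<bar> \<le> E) \<longrightarrow> 0 \<le> E \<longrightarrow>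
     \<bar>real_of_int (Determinant.det (hankel k b))\<bar> * mahler_measure P ^ g \<le> C * \<bar>real_of_int (lead_coeff P)\<bar> ^ g * W * E ^ (k - 1)"
proof -
  obtain C where C: "C > 0" "\<And>P. degree P \<le> k \<Longrightarrow> \<exists>m\<le>k. mahler_measure P \<le> C * \<bar>real_of_int (poly P (int m))\<bar>"
    using mahler_measure_le_value[of k] by blast
  let ?K = "(1 + real k) ^ g"
  define C' where "C' = C ^ g * (fact k * ?K * ?K ^ (k - 1))"
  have "C' > 0" using C by (simp add: C'_def)
  moreover have "\<bar>real_of_int (Determinant.det (hankel k b))\<bar> * mahler_measure P ^ g \<le> C' * \<bar>real_of_int (lead_coeff P)\<bar> ^ g * W * E ^ (k - 1)"
    if irr: "irreducible P" and deg: "degree P = k" and r: "recurs P b (2 * k - 2 + g)" and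
     W: "\<forall>l \<le> 2 * k - 2 + g. \<bar>real_of_int (b l)\<bar> \<le> W" and
     E: "\<forall>l < 2 * k - 2 + g. \<bar>real_of_int (b (Suc l)) - x * real_of_int (b l)\<bar> \<le> E" and E0: "0 \<le> E"
    for P b x W E
  proof -
    obtain m where m: "m \<le> k" "mahler_measure P \<le> C * \<bar>real_of_int (poly P (int m))\<bar>"
      using C(2)[of P] deg by auto
    let ?b = "fold shift_minus (replicate g (int m)) b"
    have W0: "0 \<le> W" using W by force
    have le: "(1 + \<bar>real_of_int (int m)\<bar>) ^ g \<le> ?K" using m(1) by (intro power_mono) auto
    have bd: "(\<forall>l\<le>2 * k - 2. \<bar>real_of_int (?b l)\<bar> \<le> (1 + \<bar>real_of_int (int m)\<bar>) ^ g * W) \<and>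
      (\<forall>l<2 * k - 2. \<bar>real_of_int (?b (Suc l)) - x * real_of_int (?b l)\<bar> \<le> (1 + \<bar>real_of_int (int m)\<bar>) ^ g * E)"
      by (rule fold_shift_minus_bounds) (use W E in auto)
    have "\<bar>Determinant.det (hankel k (\<lambda>i. real_of_int (?b i)))\<bar> \<le> fact k * (?K * W) * (?K * E) ^ (k - 1)"
    proof (rule det_hankel_upper[OF assms])
      show "\<bar>real_of_int (?b l)\<bar> \<le> ?K * W" if "l \<le> 2 * k - 2" for l
        using bd that mult_right_mono[OF le W0] by (meson order_trans)
      show "\<bar>real_of_int (?b (Suc l)) - x * real_of_int (?b l)\<bar> \<le> ?K * E" if "l < 2 * k - 2" for l
        using bd that mult_right_mono[OF le E0] by (meson order_trans)
    qed
    then have up: "\<bar>real_of_int (Determinant.det (hankel k ?b))\<bar> \<le> fact k * (?K * W) * (?K * E) ^ (k - 1)"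
      by (simp add: det_hankel_of_int)
    have "\<bar>lead_coeff P\<bar> ^ g * \<bar>Determinant.det (hankel k ?b)\<bar> = \<bar>poly P (int m)\<bar> ^ g * \<bar>Determinant.det (hankel k b)\<bar>"
      using det_hankel_fold_shift_minus[OF irr, of b "replicate g (int m)"] r deg assms
      by (simp add: map_replicate prod_list_replicate)
    from arg_cong[OF this, of real_of_int]
    have eq: "\<bar>real_of_int (lead_coeff P)\<bar> ^ g * \<bar>real_of_int (Determinant.det (hankel k ?b))\<bar> =
       \<bar>real_of_int (poly P (int m))\<bar> ^ g * \<bar>real_of_int (Determinant.det (hankel k b))\<bar>"
      by simp
    have "\<bar>real_of_int (Determinant.det (hankel k b))\<bar> * mahler_measure P ^ g \<le>
      \<bar>real_of_int (Determinant.det (hankel k b))\<bar> * (C * \<bar>real_of_int (poly P (int m))\<bar>) ^ g"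
      using m(2) by (intro mult_left_mono power_mono mahler_measure_ge_0) auto
    also have "\<dots> = C ^ g * (\<bar>real_of_int (lead_coeff P)\<bar> ^ g * \<bar>real_of_int (Determinant.det (hankel k ?b))\<bar>)"
      unfolding eq by (simp add: power_mult_distrib mult_ac)
    also have "\<dots> \<le> C ^ g * (\<bar>real_of_int (lead_coeff P)\<bar> ^ g * (fact k * (?K * W) * (?K * E) ^ (k - 1)))"
      using up C(1) by (intro mult_left_mono) auto
    also have "\<dots> = C' * \<bar>real_of_int (lead_coeff P)\<bar> ^ g * W * E ^ (k - 1)"
      by (simp add: C'_def power_mult_distrib mult_ac)
    finally show ?thesis .
  qed
  ultimately show ?thesis by blast
qed

subsection \<open>Counting approximants\<close>

text \<open>Terms beyond \<open>N\<close> are set to \<open>0\<close> so that the sequences can be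
  counted as functions. The point \<open>x\<close> is quantified inside, so the set collects the
  approximants of all points of the interval from \<open>- R\<close> to \<open>R\<close> at
  once.\<close>

definition approximants :: "int poly \<Rightarrow> nat \<Rightarrow> real \<Rightarrow> real \<Rightarrow> real \<Rightarrow> (nat \<Rightarrow> int) set" where
  "approximants P N R W E = {b. (\<forall>l>N. b l = 0) \<and> recurs P b N \<and> b 0 \<noteq> 0 \<and> \<bar>real_of_int (b 0)\<bar> \<le> W \<and>
     (\<exists>x. \<bar>x\<bar> \<le> R \<and> (\<forall>l<N. \<bar>real_of_int (b (Suc l)) - x * real_of_int (b l)\<bar> \<le> E))}"

abbreviation spectral :: "int poly \<Rightarrow> complex \<Rightarrow> (nat \<Rightarrow> int) \<Rightarrow> complex" where
  "spectral P \<alpha> b \<equiv> spectral_coeff P \<alpha> (\<lambda>i. of_int (b i))"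

lemma approximants_bound:
  assumes "b \<in> approximants P N R W E" "0 \<le> R" "1 \<le> W" "E \<le> 1" "l \<le> N"
  shows "\<bar>real_of_int (b l)\<bar> \<le> (R + 1) ^ N * W"
proof -
  obtain x where x: "\<bar>x\<bar> \<le> R" "\<forall>l<N. \<bar>real_of_int (b (Suc l)) - x * real_of_int (b l)\<bar> \<le> E"
    and b0: "\<bar>real_of_int (b 0)\<bar> \<le> W"
    using assms(1) by (auto simp: approximants_def)
  have "\<bar>real_of_int (b l)\<bar> \<le> (R + 1) ^ l * W" using \<open>l \<le> N\<close>
  proof (induction l)
    case (Suc l)
    have "\<bar>real_of_int (b (Suc l))\<bar> \<le> \<bar>x\<bar> * \<bar>real_of_int (b l)\<bar> + E"
      using x(2) Suc.prems by (auto simp: abs_mult[symmetric] dest!: spec[of _ l])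
    also have "\<dots> \<le> R * ((R + 1) ^ l * W) + 1"
      using x(1) Suc assms by (intro add_mono mult_mono) auto
    also have "\<dots> \<le> R * ((R + 1) ^ l * W) + (R + 1) ^ l * W"
      using assms by (intro add_left_mono mult_ge1_I one_le_power) auto
    finally show ?case by (simp add: algebra_simps)
  qed (use b0 in simp)
  also have "\<dots> \<le> (R + 1) ^ N * W" using assms by (intro mult_right_mono power_increasing) auto
  finally show ?thesis .
qed

lemma cmod_root_le_mahler:
  assumes "P \<noteq> 0" "\<alpha> \<in> croots P"
  shows "cmod \<alpha> \<le> mahler_measure P"
proof -
  let ?p = "of_int_poly P :: complex poly" and ?D = "synthetic_div (of_int_poly P) \<alpha>"
  have p: "?p = [:- \<alpha>, 1:] * ?D"
    using synthetic_div_correct'[of \<alpha> ?p] assms(2) by (simp add: croots_def)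
  have "lead_coeff ?p = lead_coeff ?D" using arg_cong[OF p, of lead_coeff] by (simp add: lead_coeff_mult del: mult_pCons_left)
  then have "cmod (lead_coeff ?D) = real_of_int \<bar>lead_coeff P\<bar>" using norm_of_int[of "lead_coeff P", where ?'a = complex] by simp
  moreover have "1 \<le> \<bar>lead_coeff P\<bar>" using leading_coeff_0_iff[of P] assms(1) by linarith
  ultimately have "1 \<le> cmod (lead_coeff ?D)" by linarith
  also have "\<dots> \<le> mahler_measure_poly ?D"
    unfolding mahler_measure_poly_via_monic using mahler_measure_monic_ge_1[of ?D] mult_left_mono[of 1 _ "cmod (lead_coeff ?D)"] by simp
  finally have "1 \<le> mahler_measure_poly ?D" .
  moreover have "mahler_measure P = max 1 (cmod \<alpha>) * mahler_measure_poly ?D"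
    unfolding mahler_measure_def by (subst p, subst measure_eq_prod) simp
  moreover have "max 1 (cmod \<alpha>) * 1 \<le> max 1 (cmod \<alpha>) * mahler_measure_poly ?D"
    using calculation(1) by (intro mult_left_mono) auto
  ultimately show ?thesis by simp
qed

lemma abs_coeff_le_mahler: "\<bar>real_of_int (coeff P i)\<bar> \<le> 2 ^ degree P * mahler_measure P"
proof -
  have "\<bar>real_of_int (coeff P i)\<bar> \<le> real (degree P choose i) * mahler_measure P"
    using Mignotte_bound[of P i] by simp
  also have "\<dots> \<le> 2 ^ degree P * mahler_measure P"
  proof (rule mult_right_mono[OF _ mahler_measure_ge_0])
    have "real (degree P choose i) \<le> real (2 ^ degree P)"
      using binomial_le_pow2[of "degree P" i] by (simp only: of_nat_le_iff)
    then show "real (degree P choose i) \<le> 2 ^ degree P" by simp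
  qed
  finally show ?thesis .
qed

text \<open>The upper bound comes from the heights of \<open>P\<close> and \<open>b\<close>, the
  lower one from separating \<open>P\<close> and its numerator polynomial at the root. As both are
  powers of \<open>W * mahler_measure P\<close> up to constants, only logarithmically many orders of
  magnitude remain for each spectral coefficient.\<close>

lemma spectral_bounds:
  assumes "1 \<le> k" "0 \<le> R"
  shows "\<exists>K>0. \<forall>P W E b \<alpha>. irreducible (P :: int poly) \<longrightarrow> degree P = k \<longrightarrow> 1 \<le> W \<longrightarrow> E \<le> 1 \<longrightarrow>
     b \<in> approximants P (2 * k - 2 + g) R W E \<longrightarrow> \<alpha> \<in> croots P \<longrightarrow>
     exp (- K * (1 + ln (W * mahler_measure P))) \<le> cmod (spectral P \<alpha> b) \<and>
     cmod (spectral P \<alpha> b) \<le> exp (K * (1 + ln (W * mahler_measure P)))"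
proof -
  obtain c where c: "c > 0" and sep: "\<And>(P :: int poly) N H z. irreducible P \<Longrightarrow> degree P = k \<Longrightarrow> N \<noteq> 0 \<Longrightarrow> degree N < k \<Longrightarrow> 1 \<le> H \<Longrightarrow>
     (\<forall>i. \<bar>coeff P i\<bar> \<le> H) \<Longrightarrow> (\<forall>i. \<bar>coeff N i\<bar> \<le> H) \<Longrightarrow>
     c / ((1 + cmod z) ^ k * real_of_int H ^ (2 * k - 1))
       \<le> cmod (poly (of_int_poly P) z) + cmod (poly (of_int_poly N) z)"
    using irreducible_poly_separation[OF assms(1)] by metis
  \<comment> \<open>Half of \<open>K1 * (W * mahler_measure P)\<close> dominates the coefficients of
    both \<open>P\<close> and its numerator polynomial: \<open>k\<close> summands, the growth of
    \<open>b\<close> along the window, and the factor \<open>2 ^ k\<close> from Mignotte's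
    bound.\<close>
  define K1 where "K1 = 2 * real k * (R + 1) ^ (2 * k - 2 + g) * 2 ^ k"
  have K1: "2 \<le> K1"
  proof -
    have "1 \<le> real k * ((R + 1) ^ (2 * k - 2 + g) * 2 ^ k)"
      using assms by (intro mult_ge1_I one_le_power) auto
    then show ?thesis by (simp add: K1_def)
  qed
  define K where "K = (1 + ln K1) * (3 * real k + 1) + ln (real k) + \<bar>ln c\<bar>"
  have lnK1: "0 \<le> ln K1" "0 \<le> ln (real k)" using K1 assms by auto
  have "K > 0" using lnK1 unfolding K_def using assms by (intro add_pos_nonneg mult_pos_pos) auto
  moreover have "exp (- K * (1 + ln (W * mahler_measure P))) \<le> cmod (spectral P \<alpha> b) \<and>
     cmod (spectral P \<alpha> b) \<le> exp (K * (1 + ln (W * mahler_measure P)))"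
    if irr: "irreducible P" and deg: "degree P = k" and W: "1 \<le> W" and E: "E \<le> 1" and
     b: "b \<in> approximants P (2 * k - 2 + g) R W E" and \<alpha>: "\<alpha> \<in> croots P" for P W E b \<alpha>
  proof -
    let ?h = "mahler_measure P"
    have P0: "P \<noteq> 0" using irr by auto
    have h1: "1 \<le> ?h" using mahler_measure_poly_ge_1[OF P0] .
    define N where "N = numerator_poly P b"
    define A where "A = K1 * (W * ?h)"
    have Wh: "1 \<le> W * ?h" using W h1 by (rule mult_ge1_I)
    define H where "H = \<lceil>A / 2\<rceil>"
    define L where "L = 1 + ln (W * ?h)"
    have L: "1 \<le> L" using Wh by (simp add: L_def)
    have "2 * 1 \<le> K1 * (W * ?h)" using K1 Wh by (intro mult_mono) auto
    then have A2: "2 \<le> A" by (simp add: A_def)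
    have H: "1 \<le> H" "real_of_int H \<le> A" "A / 2 \<le> real_of_int H"
      using A2 by (auto simp: H_def) linarith
    have "ln A = ln K1 + ln (W * ?h)" unfolding A_def using K1 Wh by (intro ln_mult_pos) auto
    also have "\<dots> \<le> (1 + ln K1) * L" using lnK1 L mult_left_mono[OF L lnK1(1)] by (simp add: L_def algebra_simps)
    finally have lnA: "ln A \<le> (1 + ln K1) * L" .
    have Wk: "real k * ((R + 1) ^ (2 * k - 2 + g) * W) * (2 ^ k * ?h) = A / 2"
      by (simp add: A_def K1_def)
    have cP: "\<bar>real_of_int (coeff P i)\<bar> \<le> 2 ^ k * ?h" for i using abs_coeff_le_mahler[of P i] deg by simp
    have "2 ^ k * ?h \<le> A / 2"
    proof -
      have "1 \<le> real k * ((R + 1) ^ (2 * k - 2 + g) * W)" using assms W by (intro mult_ge1_I one_le_power) auto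
      from mult_right_mono[OF this, of "2 ^ k * ?h"] show ?thesis using h1 unfolding Wk by simp
    qed
    then have "\<bar>real_of_int (coeff P i)\<bar> \<le> real_of_int H" for i using cP[of i] H(3) by linarith
    then have HP: "\<bar>coeff P i\<bar> \<le> H" for i by (metis of_int_abs of_int_le_iff)
    have bl: "\<bar>real_of_int (b l)\<bar> \<le> (R + 1) ^ (2 * k - 2 + g) * W" if "l < k" for l
      using that by (intro approximants_bound[OF b assms(2) W E]) auto
    have "\<bar>real_of_int (coeff N i)\<bar> \<le> real_of_int H" for i
    proof -
      have "\<bar>real_of_int (coeff N i)\<bar> \<le> (\<Sum>l<k. \<bar>real_of_int (b l)\<bar> * \<bar>real_of_int (coeff P (i + Suc l))\<bar>)"
        unfolding N_def coeff_numerator_poly deg by (simp add: order_trans[OF sum_abs] abs_mult)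
      also have "\<dots> \<le> (\<Sum>l<k. ((R + 1) ^ (2 * k - 2 + g) * W) * (2 ^ k * ?h))"
        using bl cP assms W h1 by (intro sum_mono mult_mono) auto
      also have "\<dots> = A / 2" unfolding Wk[symmetric] by (simp only: sum_constant card_lessThan mult.assoc)
      finally show ?thesis using H(3) by simp
    qed
    then have HN: "\<bar>coeff N i\<bar> \<le> H" for i by (metis of_int_abs of_int_le_iff)
    have b0: "b 0 \<noteq> 0" using b by (auto simp: approximants_def)
    have N: "N \<noteq> 0" "degree N < k" unfolding N_def
      using numerator_poly_nonzero[where b = b, OF _ b0] degree_numerator_poly[of P b] assms deg by auto
    have f: "spectral P \<alpha> b = poly (of_int_poly N) \<alpha>"
      unfolding N_def using assms deg by (intro spectral_coeff_numerator) auto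
    have "1 + cmod \<alpha> \<le> 2 * ?h" using cmod_root_le_mahler[OF P0 \<alpha>] h1 by simp
    also have "\<dots> \<le> A" using mult_mono[of 2 K1 1 W] K1 W h1 mult_right_mono[of 2 "K1 * W" ?h] by (simp add: A_def mult.assoc)
    finally have \<alpha>A: "1 + cmod \<alpha> \<le> A" .
    have powA: "A ^ j \<le> exp (real j * (1 + ln K1) * L)" for j
    proof -
      have "A ^ j = exp (real j * ln A)" using A2 by (simp add: exp_of_nat_mult)
      then show ?thesis using lnA by (simp add: mult_left_mono mult.assoc)
    qed
    have low: "c / A ^ (3 * k) \<le> cmod (spectral P \<alpha> b)"
    proof -
      have "(1 + cmod \<alpha>) ^ k * real_of_int H ^ (2 * k - 1) \<le> A ^ k * A ^ (2 * k - 1)"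
        using \<alpha>A H A2 by (intro mult_mono power_mono) auto
      also have "\<dots> \<le> A ^ (3 * k)" unfolding power_add[symmetric] using A2 by (intro power_increasing) auto
      finally have "c / A ^ (3 * k) \<le> c / ((1 + cmod \<alpha>) ^ k * real_of_int H ^ (2 * k - 1))"
        using c H by (intro divide_left_mono mult_pos_pos zero_less_power add_pos_nonneg) (auto intro: A2)
      also have "\<dots> \<le> cmod (poly (of_int_poly P) \<alpha>) + cmod (poly (of_int_poly N) \<alpha>)"
        using sep[OF irr deg N H(1)] HP HN by blast
      also have "\<dots> = cmod (spectral P \<alpha> b)" using \<alpha> f by (simp add: croots_def)
      finally show ?thesis .
    qed
    have "cmod (spectral P \<alpha> b) \<le> real k * real_of_int H * (1 + cmod \<alpha>) ^ k"
      unfolding f using HN N(2) by (intro cmod_poly_le) (auto simp: coeff_eq_0)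
    also have "\<dots> \<le> real k * A * A ^ k" using H \<alpha>A A2 by (intro mult_mono power_mono) auto
    also have "\<dots> = exp (ln (real k)) * A ^ Suc k" using assms by simp
    also have "\<dots> \<le> exp (ln (real k)) * exp (real (Suc k) * (1 + ln K1) * L)"
      using powA[of "Suc k"] by (intro mult_left_mono) auto
    also have "\<dots> \<le> exp (K * L)"
    proof -
      have "ln (real k) * 1 \<le> ln (real k) * L" "0 \<le> \<bar>ln c\<bar> * L" using lnK1 L by (auto intro: mult_left_mono simp del: mult_1_right)
      moreover have "real (Suc k) * (1 + ln K1) * L \<le> (3 * real k + 1) * (1 + ln K1) * L"
        using lnK1 L by (intro mult_right_mono) auto
      ultimately show ?thesis unfolding exp_add[symmetric] by (simp add: K_def algebra_simps)
    qed
    finally have up: "cmod (spectral P \<alpha> b) \<le> exp (K * L)" .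
    have "exp (- K * L) \<le> exp (ln c - real (3 * k) * (1 + ln K1) * L)"
    proof -
      have "0 \<le> ln (real k) * L" "\<bar>ln c\<bar> * 1 \<le> \<bar>ln c\<bar> * L" "0 \<le> (1 + ln K1) * L" using lnK1 L by (auto intro: mult_left_mono simp del: mult_1_right)
      then have "real (3 * k) * (1 + ln K1) * L - ln c \<le> K * L" by (simp add: K_def algebra_simps)
      then show ?thesis by simp
    qed
    also have "\<dots> = c / exp (real (3 * k) * (1 + ln K1) * L)" using c by (simp add: exp_diff)
    also have "\<dots> \<le> c / A ^ (3 * k)" using powA[of "3 * k"] c A2 by (intro divide_left_mono) auto
    finally show ?thesis using low up unfolding L_def by auto
  qed
  ultimately show ?thesis by blast
qed

section \<open>Counting approximants by cells of spectral coefficients\<close>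

lemma cnj_poly_of_int: "cnj (poly (of_int_poly p) z) = poly (of_int_poly p) (cnj z)"
  by (induction p) auto

lemma cnj_mem_croots: "\<alpha> \<in> croots P \<Longrightarrow> cnj \<alpha> \<in> croots P"
  using cnj_poly_of_int[of P \<alpha>] by (simp add: croots_def)

lemma spectral_cnj: "1 \<le> degree P \<Longrightarrow> spectral P (cnj \<alpha>) b = cnj (spectral P \<alpha> b)"
  by (simp add: spectral_coeff_numerator cnj_poly_of_int)

text \<open>The constant relating determinant and spectral coefficients depends on \<open>P\<close>
  alone and cancels; the ratio \<open>\<rho>\<close> enters once for every root.\<close>

lemma det_hankel_spectral_ratio:
  assumes irr: "irreducible (P :: int poly)" and k: "1 \<le> degree P"
    and "recurs P b (2 * degree P - 2)" "recurs P b' (2 * degree P - 2)"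
    and "\<And>\<alpha>. \<alpha> \<in> croots P \<Longrightarrow> cmod (spectral P \<alpha> b') \<le> \<rho> * cmod (spectral P \<alpha> b)"
  shows "\<bar>real_of_int (Determinant.det (hankel (degree P) b'))\<bar> \<le>
    \<rho> ^ degree P * \<bar>real_of_int (Determinant.det (hankel (degree P) b))\<bar>"
proof -
  obtain \<kappa> where \<kappa>: "\<kappa> \<noteq> 0" "\<And>b. (\<forall>l. Suc l < degree P \<longrightarrow> shift_act (of_int_poly P) b l = 0) \<Longrightarrow>
     Determinant.det (hankel (degree P) b) = \<kappa> * (\<Prod>\<alpha>\<in>croots P. spectral_coeff P \<alpha> b)"
    using det_hankel_spectral[OF irr k] by blast
  have det: "\<bar>real_of_int (Determinant.det (hankel (degree P) b))\<bar> = cmod \<kappa> * (\<Prod>\<alpha>\<in>croots P. cmod (spectral P \<alpha> b))"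
    if "recurs P b (2 * degree P - 2)" for b
  proof -
    have "of_int (Determinant.det (hankel (degree P) b)) = \<kappa> * (\<Prod>\<alpha>\<in>croots P. spectral P \<alpha> b)"
      using \<kappa>(2)[of "\<lambda>i. of_int (b i)"] that by (auto simp: det_hankel_of_int shift_act_of_int recurs_def)
    from arg_cong[OF this, of cmod] show ?thesis by (simp add: norm_mult prod_norm)
  qed
  have "(\<Prod>\<alpha>\<in>croots P. cmod (spectral P \<alpha> b')) \<le> (\<Prod>\<alpha>\<in>croots P. \<rho> * cmod (spectral P \<alpha> b))"
    using assms(5) by (intro prod_mono) auto
  also have "\<dots> = \<rho> ^ degree P * (\<Prod>\<alpha>\<in>croots P. cmod (spectral P \<alpha> b))"
    by (simp add: prod.distrib irreducible_factorization(2)[OF irr k])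
  finally show ?thesis unfolding det[OF assms(3)] det[OF assms(4)]
    using mult_left_mono[of _ _ "cmod \<kappa>"] by (simp add: mult.left_commute)
qed

text \<open>The first bound is \<open>det_hankel_approximable\<close>. Inserting
  \<open>det_hankel_lower\<close> for the determinant makes the powers of the leading coefficient
  cancel, which bounds the Mahler measure itself.\<close>

lemma mahler_measure_power_le_approximant:
  assumes k: "1 \<le> k" and R: "0 \<le> R"
  shows "\<exists>C\<ge>1. \<forall>P W E b. irreducible (P :: int poly) \<longrightarrow> content P = 1 \<longrightarrow> degree P = k \<longrightarrow> 1 \<le> W \<longrightarrow> 0 \<le> E \<longrightarrow> E \<le> 1 \<longrightarrow>
     b \<in> approximants P (2 * k - 2 + g) R W E \<longrightarrow>
     \<bar>real_of_int (Determinant.det (hankel k b))\<bar> * mahler_measure P ^ g \<le> C * \<bar>real_of_int (lead_coeff P)\<bar> ^ g * W * E ^ (k - 1) \<and>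
     mahler_measure P ^ g \<le> C * W * E ^ (k - 1)"
proof -
  obtain C0 where C0: "C0 > 0" and up: "\<And>P b x W E. irreducible (P :: int poly) \<Longrightarrow> degree P = k \<Longrightarrow> recurs P b (2 * k - 2 + g) \<Longrightarrow>
     (\<forall>l \<le> 2 * k - 2 + g. \<bar>real_of_int (b l)\<bar> \<le> W) \<Longrightarrow>
     (\<forall>l < 2 * k - 2 + g. \<bar>real_of_int (b (Suc l)) - x * real_of_int (b l)\<bar> \<le> E) \<Longrightarrow> 0 \<le> E \<Longrightarrow>
     \<bar>real_of_int (Determinant.det (hankel k b))\<bar> * mahler_measure P ^ g \<le> C0 * \<bar>real_of_int (lead_coeff P)\<bar> ^ g * W * E ^ (k - 1)"
    using det_hankel_approximable[OF k, of g] by blast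
  obtain D where D: "D > 0" and low: "\<And>P b. irreducible (P :: int poly) \<Longrightarrow> content P = 1 \<Longrightarrow> 1 \<le> degree P \<Longrightarrow> degree P = k \<Longrightarrow>
     recurs P b (2 * k - 2 + g) \<Longrightarrow> (\<exists>l<k. b l \<noteq> 0) \<Longrightarrow>
     \<bar>real_of_int (lead_coeff P)\<bar> ^ g \<le> D * \<bar>real_of_int (Determinant.det (hankel k b))\<bar>"
    using det_hankel_lower[of k g] by blast
  let ?N = "2 * k - 2 + g"
  define C1 where "C1 = C0 * (R + 1) ^ ?N"
  define C where "C = max 1 (max C1 (D * C1))"
  have C1: "0 < C1" using C0 R by (simp add: C1_def)
  have "\<bar>real_of_int (Determinant.det (hankel k b))\<bar> * mahler_measure P ^ g \<le> C * \<bar>real_of_int (lead_coeff P)\<bar> ^ g * W * E ^ (k - 1) \<and>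
     mahler_measure P ^ g \<le> C * W * E ^ (k - 1)"
    if irr: "irreducible P" and con: "content P = 1" and deg: "degree P = k" and W: "1 \<le> W" and E: "0 \<le> E" "E \<le> 1"
     and b: "b \<in> approximants P ?N R W E" for P W E b
  proof -
    obtain x where x: "\<forall>l<?N. \<bar>real_of_int (b (Suc l)) - x * real_of_int (b l)\<bar> \<le> E" and r: "recurs P b ?N" and b0: "b 0 \<noteq> 0"
      using b by (auto simp: approximants_def)
    let ?c = "\<bar>real_of_int (lead_coeff P)\<bar>" and ?d = "\<bar>real_of_int (Determinant.det (hankel k b))\<bar>"
    have c: "0 < ?c" using irr by auto
    have "?d * mahler_measure P ^ g \<le> C0 * ?c ^ g * ((R + 1) ^ ?N * W) * E ^ (k - 1)"
      using approximants_bound[OF b R W E(2)] x E by (intro up[OF irr deg r]) auto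
    then have 1: "?d * mahler_measure P ^ g \<le> C1 * (?c ^ g * W * E ^ (k - 1))" by (simp add: C1_def mult_ac)
    have nn: "0 \<le> ?c ^ g * W * E ^ (k - 1)" "0 \<le> W * E ^ (k - 1)" using W E by auto
    have "?d * mahler_measure P ^ g \<le> C * (?c ^ g * W * E ^ (k - 1))"
      by (rule order_trans[OF 1 mult_right_mono[OF _ nn(1)]]) (simp add: C_def)
    moreover have "?c ^ g * mahler_measure P ^ g \<le> ?c ^ g * (C * W * E ^ (k - 1))"
    proof -
      have "?c ^ g * mahler_measure P ^ g \<le> D * ?d * mahler_measure P ^ g"
      proof (intro mult_right_mono zero_le_power mahler_measure_ge_0)
        have "\<exists>l<k. b l \<noteq> 0" using b0 k by (intro exI[of _ 0]) auto
        then show "?c ^ g \<le> D * ?d" using low[OF irr con _ deg r] k deg by simp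
      qed
      also have "\<dots> \<le> D * (C1 * (?c ^ g * W * E ^ (k - 1)))"
        using mult_left_mono[OF 1, of D] D by (simp add: mult.assoc)
      also have "\<dots> = D * C1 * (?c ^ g * W * E ^ (k - 1))" by simp
      also have "\<dots> \<le> C * (?c ^ g * W * E ^ (k - 1))"
        using nn by (intro mult_right_mono) (auto simp: C_def)
      finally show ?thesis by (simp add: mult_ac)
    qed
    then have "mahler_measure P ^ g \<le> C * W * E ^ (k - 1)" using c by simp
    ultimately show ?thesis by (simp add: mult.assoc)
  qed
  then show ?thesis by (intro exI[of _ C]) (auto simp: C_def)
qed

lemma card_cells:
  fixes S :: "complex set" and M Z :: int
  assumes "finite S" "0 \<le> M" "0 \<le> Z"
    "card {\<alpha>\<in>S. Im \<alpha> = 0} + 2 * card {\<alpha>\<in>S. Im \<alpha> \<noteq> 0} \<le> k"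
  defines "T \<equiv> PiE S (\<lambda>\<alpha>. {-M..M} \<times> {-Z..Z} \<times> (if Im \<alpha> = 0 then {0} else {-Z..Z}))"
  shows "finite T" "real (card T) \<le> (2 * real_of_int M + 1) ^ k * (2 * real_of_int Z + 1) ^ k"
proof -
  show "finite T" unfolding T_def using assms(1) by (intro finite_PiE) auto
  let ?m = "2 * real_of_int M + 1" and ?z = "2 * real_of_int Z + 1"
  let ?A = "{\<alpha>\<in>S. Im \<alpha> = 0}" and ?B = "{\<alpha>\<in>S. Im \<alpha> \<noteq> 0}"
  have "real (card T) = (\<Prod>\<alpha>\<in>S. ?m * (?z * (if Im \<alpha> = 0 then 1 else ?z)))"
    unfolding T_def card_PiE[OF assms(1)] of_nat_prod
    using assms(2,3) by (intro prod.cong refl) (simp add: card_cartesian_product)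
  also have "\<dots> = (\<Prod>\<alpha>\<in>?A. ?m * (?z * (if Im \<alpha> = 0 then 1 else ?z))) * (\<Prod>\<alpha>\<in>?B. ?m * (?z * (if Im \<alpha> = 0 then 1 else ?z)))"
  proof -
    have S: "?A \<union> ?B = S" and dis: "?A \<inter> ?B = {}" by blast+
    have "finite ?A" "finite ?B" using assms(1) by auto
    from prod.union_disjoint[OF this dis] show ?thesis unfolding S .
  qed
  also have "\<dots> = (?m * ?z) ^ card ?A * (?m * (?z * ?z)) ^ card ?B" by simp
  also have "\<dots> = ?m ^ (card ?A + card ?B) * ?z ^ (card ?A + 2 * card ?B)"
    by (simp add: power_add power_mult_distrib mult_2 mult_ac)
  also have "\<dots> \<le> ?m ^ k * ?z ^ k"
    using assms(2-4) by (intro mult_mono power_increasing) auto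
  finally show "real (card T) \<le> ?m ^ k * ?z ^ k" .
qed

lemma card_root_representatives:
  assumes irr: "irreducible (P :: int poly)" and k: "1 \<le> degree P"
  defines "S \<equiv> {\<alpha> \<in> croots P. 0 \<le> Im \<alpha>}"
  shows "finite S" "card {\<alpha>\<in>S. Im \<alpha> = 0} + 2 * card {\<alpha>\<in>S. Im \<alpha> \<noteq> 0} \<le> degree P"
proof -
  have fin: "finite (croots P)" by (rule irreducible_factorization(1)[OF assms(1,2)])
  then show "finite S" by (simp add: S_def)
  let ?A = "{\<alpha>\<in>S. Im \<alpha> = 0}" and ?B = "{\<alpha>\<in>S. Im \<alpha> \<noteq> 0}"
  have "card ?B = card (cnj ` ?B)" by (rule card_image[symmetric]) (auto simp: inj_on_def)
  moreover have "card (?A \<union> ?B \<union> cnj ` ?B) = card ?A + card ?B + card (cnj ` ?B)"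
    using fin by (subst card_Un_disjoint, auto simp: S_def)+
  moreover have "card (?A \<union> ?B \<union> cnj ` ?B) \<le> card (croots P)"
    using fin by (intro card_mono) (auto simp: S_def cnj_mem_croots)
  ultimately show "card ?A + 2 * card ?B \<le> degree P" using irreducible_factorization(2)[OF assms(1,2)] by simp
qed

text \<open>Two approximants whose spectral coefficients lie in the same cell differ by a sequence whose
  Hankel determinant is too small, so the cells separate them. Real roots need one-dimensional cells
  and pairs of conjugate roots need one two-dimensional cell, which gives \<open>k\<close> real dimensions.\<close>
lemma card_approximants:
  assumes k: "1 \<le> k" and R: "0 \<le> R"
  shows "\<exists>C>0. \<forall>P W E. irreducible (P :: int poly) \<longrightarrow> content P = 1 \<longrightarrow> degree P = k \<longrightarrow> 1 \<le> W \<longrightarrow> 0 < E \<longrightarrow> E \<le> 1 \<longrightarrow>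
     finite (approximants P (2 * k - 2 + g) R W E) \<and>
     real (card (approximants P (2 * k - 2 + g) R W E)) \<le>
       C * (1 + ln (W * mahler_measure P)) ^ k * (W * E ^ (k - 1) / mahler_measure P ^ g)"
proof -
  let ?N = "2 * k - 2 + g"
  obtain K where K: "K > 0" and sb: "\<And>P W E b \<alpha>. irreducible (P :: int poly) \<Longrightarrow> degree P = k \<Longrightarrow> 1 \<le> W \<Longrightarrow> E \<le> 1 \<Longrightarrow>
     b \<in> approximants P ?N R W E \<Longrightarrow> \<alpha> \<in> croots P \<Longrightarrow>
     exp (- K * (1 + ln (W * mahler_measure P))) \<le> cmod (spectral P \<alpha> b) \<and>
     cmod (spectral P \<alpha> b) \<le> exp (K * (1 + ln (W * mahler_measure P)))"
    using spectral_bounds[OF k R, of g] by metis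
  obtain C1 where C1: "C1 \<ge> 1" and mahler: "\<And>P W E b. irreducible (P :: int poly) \<Longrightarrow> content P = 1 \<Longrightarrow> degree P = k \<Longrightarrow> 1 \<le> W \<Longrightarrow> 0 \<le> E \<Longrightarrow> E \<le> 1 \<Longrightarrow>
     b \<in> approximants P ?N R W E \<Longrightarrow>
     \<bar>real_of_int (Determinant.det (hankel k b))\<bar> * mahler_measure P ^ g \<le> C1 * \<bar>real_of_int (lead_coeff P)\<bar> ^ g * W * E ^ (k - 1) \<and>
     mahler_measure P ^ g \<le> C1 * W * E ^ (k - 1)"
    using mahler_measure_power_le_approximant[OF k R, of g] by metis
  obtain D where D: "D > 0" and low: "\<And>P b. irreducible (P :: int poly) \<Longrightarrow> content P = 1 \<Longrightarrow> 1 \<le> degree P \<Longrightarrow> degree P = k \<Longrightarrow>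
     recurs P b ?N \<Longrightarrow> (\<exists>l<k. b l \<noteq> 0) \<Longrightarrow>
     \<bar>real_of_int (lead_coeff P)\<bar> ^ g \<le> D * \<bar>real_of_int (Determinant.det (hankel k b))\<bar>"
    using det_hankel_lower[of k g] by blast
  define D1 where "D1 = max 1 D"
  have D1: "1 \<le> D1" "D \<le> D1" by (auto simp: D1_def)
  define C where "C = (2 * K + 5) ^ k * (22 ^ k * (2 * D1 * C1))"
  have "C > 0" using K C1 D1 by (simp add: C_def)
  moreover have "finite (approximants P ?N R W E) \<and>
     real (card (approximants P ?N R W E)) \<le> C * (1 + ln (W * mahler_measure P)) ^ k * (W * E ^ (k - 1) / mahler_measure P ^ g)"
    if irr: "irreducible P" and con: "content P = 1" and deg: "degree P = k" and W: "1 \<le> W" and E: "0 < E" "E \<le> 1" for P W E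
  proof (cases "approximants P ?N R W E = {}")
    case True
    have "1 \<le> mahler_measure P" using mahler_measure_poly_ge_1[of P] irr by auto
    then have "1 \<le> W * mahler_measure P" using W by (intro mult_ge1_I)
    then show ?thesis using True \<open>C > 0\<close> W E \<open>1 \<le> mahler_measure P\<close>
      by (auto intro!: mult_nonneg_nonneg divide_nonneg_nonneg zero_le_power)
  next
    case False
    let ?X = "approximants P ?N R W E"
    have kP: "1 \<le> degree P" using k deg by simp
    have h1: "1 \<le> mahler_measure P" using mahler_measure_poly_ge_1[of P] irr by auto
    define L where "L = 1 + ln (W * mahler_measure P)"
    have L: "1 \<le> L" unfolding L_def using mult_ge1_I[OF W h1] by simp
    \<comment> \<open>Up to a constant this is the quotient of the upper and the lower bound for the
      determinant; it is at least \<open>1\<close> as soon as one approximant exists.\<close>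
    define Y where "Y = C1 * W * E ^ (k - 1) / mahler_measure P ^ g"
    have hg: "0 < mahler_measure P ^ g" using h1 by simp
    have Y: "1 \<le> Y" using False mahler[OF irr con deg W] E hg by (auto simp: Y_def le_divide_eq)
    \<comment> \<open>Chosen so that a sequence whose spectral coefficients are at most
      \<open>\<rho>\<close> times those of an approximant has a determinant of at most half the size
      that \<open>low\<close> demands.\<close>
    define \<rho> where "\<rho> = root k (1 / (2 * D1 * Y))"
    have DY: "1 \<le> D1 * Y" using D1 Y by (intro mult_ge1_I) auto
    have \<rho>k: "\<rho> ^ k = 1 / (2 * D1 * Y)" unfolding \<rho>_def using k DY by (intro real_root_pow_pos2) auto
    have \<rho>: "0 < \<rho>" "\<rho> \<le> 1" unfolding \<rho>_def using k DY D1 Y by (auto intro!: real_root_gt_zero simp: real_root_le_1_iff)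
    define M where "M = \<lceil>K * L\<rceil> + 1"
    \<comment> \<open>Real and imaginary parts are at most \<open>3 * exp \<tau>\<close> and a cell
      has side \<open>\<rho> / 2 * exp \<tau>\<close>, so before rounding the cell index is at most
      \<open>6 / \<rho>\<close> in absolute value.\<close>
    define Z where "Z = \<lceil>6 / \<rho>\<rceil> + 1"
    have M: "0 \<le> M" "2 * real_of_int M + 1 \<le> (2 * K + 5) * L"
    proof -
      have KL: "0 \<le> K * L" using K L by simp
      then show "0 \<le> M" by (simp add: M_def)
      have "2 * real_of_int M + 1 \<le> 2 * (K * L + 1 + 1) + 1" unfolding M_def of_int_add of_int_1 using of_int_ceiling_le_add_one[of "K * L"] by argo
      also have "\<dots> \<le> (2 * K + 5) * L" using L by (simp add: algebra_simps)
      finally show "2 * real_of_int M + 1 \<le> (2 * K + 5) * L" .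
    qed
    have Z: "0 \<le> Z" "2 * real_of_int Z + 1 \<le> 22 / \<rho>"
    proof -
      have "0 \<le> 6 / \<rho>" using \<rho> by simp
      then show "0 \<le> Z" unfolding Z_def by linarith
      have "2 * real_of_int Z + 1 \<le> 2 * (6 / \<rho> + 1 + 1) + 1" unfolding Z_def of_int_add of_int_1 using of_int_ceiling_le_add_one[of "6 / \<rho>"] by argo
      also have "\<dots> \<le> 22 / \<rho>"
      proof -
        define t where "t = 1 / \<rho>"
        have t: "1 \<le> t" "6 / \<rho> = 6 * t" "22 / \<rho> = 22 * t" using \<rho> by (auto simp: t_def)
        show ?thesis unfolding t(2,3) using t(1) by (simp add: algebra_simps)
      qed
      finally show "2 * real_of_int Z + 1 \<le> 22 / \<rho>" .
    qed
    let ?f = "\<lambda>\<alpha> b. spectral P \<alpha> b"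
    define \<tau> where "\<tau> \<alpha> b = \<lfloor>ln (cmod (?f \<alpha> b))\<rfloor>" for \<alpha> b
    \<comment> \<open>The mesh is proportional to the order of magnitude \<open>exp t\<close>, so
      sharing a cell means being close relative to the coefficient itself. The sides
      \<open>\<rho> / 2\<close> for real and imaginary part add up to \<open>\<rho>\<close>.\<close>
    define cell where "cell v t = \<lfloor>v / (\<rho> / 2 * exp (real_of_int t))\<rfloor>" for v t
    define S where "S = {\<alpha> \<in> croots P. 0 \<le> Im \<alpha>}"
    define T where "T = PiE S (\<lambda>\<alpha>. {-M..M} \<times> {-Z..Z} \<times> (if Im \<alpha> = 0 then {0} else {-Z..Z}))"
    define key where "key b = restrict (\<lambda>\<alpha>. (\<tau> \<alpha> b, cell (Re (?f \<alpha> b)) (\<tau> \<alpha> b), cell (Im (?f \<alpha> b)) (\<tau> \<alpha> b))) S" for b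
    have pos: "0 < cmod (?f \<alpha> b)" if "b \<in> ?X" "\<alpha> \<in> croots P" for \<alpha> b
      using sb[OF irr deg W E(2) that] by (meson exp_gt_zero less_le_trans)
    have \<tau>: "exp (real_of_int (\<tau> \<alpha> b)) \<le> cmod (?f \<alpha> b)" "cmod (?f \<alpha> b) \<le> 3 * exp (real_of_int (\<tau> \<alpha> b))" "\<tau> \<alpha> b \<in> {-M..M}"
      if "b \<in> ?X" "\<alpha> \<in> croots P" for \<alpha> b
    proof -
      let ?l = "ln (cmod (?f \<alpha> b))"
      have el: "exp ?l = cmod (?f \<alpha> b)" using pos[OF that] by simp
      have "exp (real_of_int (\<tau> \<alpha> b)) \<le> exp ?l" unfolding \<tau>_def by simp
      then show "exp (real_of_int (\<tau> \<alpha> b)) \<le> cmod (?f \<alpha> b)" unfolding el .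
      have "exp ?l \<le> exp (1 + real_of_int (\<tau> \<alpha> b))" unfolding \<tau>_def by simp linarith
      also have "\<dots> \<le> 3 * exp (real_of_int (\<tau> \<alpha> b))" unfolding exp_add using exp_le by (intro mult_right_mono) auto
      finally show "cmod (?f \<alpha> b) \<le> 3 * exp (real_of_int (\<tau> \<alpha> b))" unfolding el .
      have s: "exp (- K * L) \<le> cmod (?f \<alpha> b)" "cmod (?f \<alpha> b) \<le> exp (K * L)"
        using sb[OF irr deg W E(2) that] unfolding L_def by blast+
      have "- K * L \<le> ?l" using s(1) pos[OF that] ln_ge_iff by blast
      moreover have "?l \<le> ln (exp (K * L))" using s(2) pos[OF that] by (subst ln_le_cancel_iff) auto
      ultimately have "- K * L \<le> ?l" "?l \<le> K * L" by simp_all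
      then show "\<tau> \<alpha> b \<in> {-M..M}" unfolding \<tau>_def M_def by simp linarith
    qed
    have cellZ: "cell v (\<tau> \<alpha> b) \<in> {-Z..Z}" if "b \<in> ?X" "\<alpha> \<in> croots P" "\<bar>v\<bar> \<le> cmod (?f \<alpha> b)" for v \<alpha> b
    proof -
      let ?e = "exp (real_of_int (\<tau> \<alpha> b))"
      have "\<bar>v\<bar> \<le> 3 * ?e" using \<tau>(2)[OF that(1,2)] that(3) by simp
      then have "\<bar>v\<bar> / (\<rho> / 2 * ?e) \<le> 3 * ?e / (\<rho> / 2 * ?e)" using \<rho> by (intro divide_right_mono) auto
      also have "\<dots> = 6 / \<rho>" using \<rho> by simp
      finally have "\<bar>v / (\<rho> / 2 * ?e)\<bar> \<le> 6 / \<rho>" using \<rho> by (simp add: abs_mult)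
      moreover have "\<lfloor>y\<rfloor> \<in> {- (\<lceil>6 / \<rho>\<rceil> + 1)..\<lceil>6 / \<rho>\<rceil> + 1}" if "\<bar>y\<bar> \<le> 6 / \<rho>" for y :: real
        unfolding atLeastAtMost_iff using that by linarith
      ultimately show ?thesis unfolding cell_def Z_def by blast
    qed
    have "key ` ?X \<subseteq> T"
    proof safe
      fix b assume b: "b \<in> ?X"
      show "key b \<in> T" unfolding key_def T_def
      proof (rule restrict_PiE_iff[THEN iffD2], rule ballI)
        fix \<alpha> assume "\<alpha> \<in> S"
        then have \<alpha>: "\<alpha> \<in> croots P" by (simp add: S_def)
        have "cell (Im (?f \<alpha> b)) (\<tau> \<alpha> b) = 0" if "Im \<alpha> = 0"
        proof -
          have "cnj \<alpha> = \<alpha>" using that by (simp add: complex_eq_iff)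
          then have "?f \<alpha> b = cnj (?f \<alpha> b)" using spectral_cnj[OF kP, of \<alpha> b] by metis
          then have "Im (?f \<alpha> b) = 0" by (simp add: complex_eq_iff)
          then show ?thesis by (simp add: cell_def)
        qed
        then show "(\<tau> \<alpha> b, cell (Re (?f \<alpha> b)) (\<tau> \<alpha> b), cell (Im (?f \<alpha> b)) (\<tau> \<alpha> b)) \<in>
            {-M..M} \<times> {-Z..Z} \<times> (if Im \<alpha> = 0 then {0} else {-Z..Z})"
          using \<tau>(3)[OF b \<alpha>] cellZ[OF b \<alpha> abs_Re_le_cmod] cellZ[OF b \<alpha> abs_Im_le_cmod] by auto
      qed
    qed
    moreover have "inj_on key ?X"
    proof (rule inj_onI, rule ccontr)
      fix b b' assume b: "b \<in> ?X" "b' \<in> ?X" and eq: "key b = key b'" and ne: "b \<noteq> b'"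
      define \<beta> where "\<beta> l = b l - b' l" for l
      have rb: "recurs P b ?N" "recurs P b' ?N" using b by (auto simp: approximants_def)
      have r\<beta>: "recurs P \<beta> ?N"
        using rb unfolding recurs_def \<beta>_def shift_act_def by (simp add: poly_pairing_diff_seq)
      have fin0: "\<beta> l = 0" if "l > ?N" for l using b that by (simp add: approximants_def \<beta>_def)
      \<comment> \<open>The first \<open>k\<close> terms determine the others inside the window
        through the recurrence, and beyond it all terms vanish; so distinct approximants differ
        among the first \<open>k\<close> terms.\<close>
      have nz: "\<exists>l<k. \<beta> l \<noteq> 0"
      proof (rule ccontr)
        assume "\<not> (\<exists>l<k. \<beta> l \<noteq> 0)"
        then have z: "\<beta> l = 0" if "l < k" for l using that by auto
        have "\<beta> l = 0" for l
        proof (induction l rule: less_induct)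
          case (less l)
          show ?case
          proof (cases "l < k \<or> l > ?N")
            case False
            then obtain j where j: "l = j + k" by (metis le_Suc_ex not_less add.commute)
            have "0 = shift_act P \<beta> j" using r\<beta> False j deg by (simp add: recurs_def)
            also have "\<dots> = (\<Sum>i<k. coeff P i * \<beta> (j + i)) + lead_coeff P * \<beta> l"
              unfolding shift_act_def poly_pairing_def deg j by (simp add: lessThan_Suc_atMost[symmetric] deg)
            also have "(\<Sum>i<k. coeff P i * \<beta> (j + i)) = 0" using less.IH j by (intro sum.neutral) auto
            finally show ?thesis using irr by auto
          qed (use z fin0 in auto)
        qed
        then show False using ne by (auto simp: \<beta>_def fun_eq_iff)
      qed
      have close: "cmod (?f \<alpha> \<beta>) \<le> \<rho> * cmod (?f \<alpha> b)" if "\<alpha> \<in> croots P" for \<alpha>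
      proof -
        have S: "cmod (?f \<alpha> \<beta>) \<le> \<rho> * cmod (?f \<alpha> b)" if "\<alpha> \<in> S" for \<alpha>
        proof -
          have \<alpha>: "\<alpha> \<in> croots P" using that by (simp add: S_def)
          let ?e = "\<rho> / 2 * exp (real_of_int (\<tau> \<alpha> b))"
          have e0: "0 < ?e" using \<rho> by simp
          have diff: "?f \<alpha> \<beta> = ?f \<alpha> b - ?f \<alpha> b'"
            by (simp add: \<beta>_def spectral_coeff_def poly_pairing_diff_seq)
          have keq: "\<tau> \<alpha> b = \<tau> \<alpha> b'" "cell (Re (?f \<alpha> b)) (\<tau> \<alpha> b) = cell (Re (?f \<alpha> b')) (\<tau> \<alpha> b')"
             "cell (Im (?f \<alpha> b)) (\<tau> \<alpha> b) = cell (Im (?f \<alpha> b')) (\<tau> \<alpha> b')"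
            using fun_cong[OF eq, of \<alpha>] that by (auto simp: key_def)
          have same: "\<bar>u - v\<bar> \<le> ?e" if "cell u (\<tau> \<alpha> b) = cell v (\<tau> \<alpha> b)" for u v
          proof -
            have "\<bar>u / ?e - v / ?e\<bar> \<le> 1" using that unfolding cell_def by linarith
            then have "\<bar>u - v\<bar> / ?e \<le> 1"
              using e0 by (simp only: diff_divide_distrib[symmetric] abs_divide abs_of_pos)
            then show ?thesis using e0 by (simp only: pos_divide_le_eq mult_1)
          qed
          have "cmod (?f \<alpha> \<beta>) \<le> \<bar>Re (?f \<alpha> \<beta>)\<bar> + \<bar>Im (?f \<alpha> \<beta>)\<bar>" by (rule cmod_le)
          also have "\<dots> \<le> ?e + ?e" unfolding diff using same keq by (intro add_mono) auto
          also have "\<dots> = \<rho> * exp (real_of_int (\<tau> \<alpha> b))" by simp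
          also have "\<dots> \<le> \<rho> * cmod (?f \<alpha> b)" using \<tau>(1)[OF b(1) \<alpha>] \<rho> by (intro mult_left_mono) auto
          finally show ?thesis .
        qed
        show ?thesis
        proof (cases "0 \<le> Im \<alpha>")
          case True
          then show ?thesis using S that by (simp add: S_def)
        next
          case False
          then have "cnj \<alpha> \<in> S" using that by (simp add: S_def cnj_mem_croots)
          from S[OF this] show ?thesis by (simp add: spectral_cnj[OF kP])
        qed
      qed
      let ?c = "\<bar>real_of_int (lead_coeff P)\<bar>"
      have c: "0 < ?c" using irr by auto
      have r2: "recurs P b (2 * degree P - 2)" "recurs P \<beta> (2 * degree P - 2)"
        using rb(1) r\<beta> deg by (auto simp: recurs_def)
      let ?d = "\<lambda>b. \<bar>real_of_int (Determinant.det (hankel k b))\<bar>"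
      have "?d b * mahler_measure P ^ g \<le> C1 * ?c ^ g * W * E ^ (k - 1)"
        using mahler[OF irr con deg W _ E(2) b(1)] E(1) by simp
      then have db: "?d b \<le> ?c ^ g * Y" using hg by (simp add: Y_def le_divide_eq mult_ac)
      have "?c ^ g \<le> D * ?d \<beta>" by (rule low[OF irr con kP deg r\<beta> nz])
      also have "\<dots> \<le> D1 * (\<rho> ^ k * ?d b)"
        using det_hankel_spectral_ratio[OF irr kP r2 close] deg D1 D by (intro mult_mono) auto
      also have "\<dots> \<le> D1 * (\<rho> ^ k * (?c ^ g * Y))" using db D1 \<rho> by (intro mult_left_mono) auto
      also have "\<dots> = ?c ^ g / 2" using DY D1 Y by (simp add: \<rho>k)
      finally have "?c ^ g \<le> ?c ^ g / 2" .
      moreover have "0 < ?c ^ g" using c by simp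
      ultimately show False by linarith
    qed
    moreover have T: "finite T" "real (card T) \<le> (2 * real_of_int M + 1) ^ k * (2 * real_of_int Z + 1) ^ k"
    proof -
      have S: "finite S" "card {\<alpha>\<in>S. Im \<alpha> = 0} + 2 * card {\<alpha>\<in>S. Im \<alpha> \<noteq> 0} \<le> k"
        using card_root_representatives[OF irr kP] deg unfolding S_def by auto
      show "finite T" "real (card T) \<le> (2 * real_of_int M + 1) ^ k * (2 * real_of_int Z + 1) ^ k"
        using card_cells[OF S(1) M(1) Z(1) S(2)] unfolding T_def by auto
    qed
    ultimately have fin: "finite ?X" and "card ?X \<le> card T"
      using inj_on_finite card_inj_on_le by blast+
    then have "real (card ?X) \<le> (2 * real_of_int M + 1) ^ k * (2 * real_of_int Z + 1) ^ k" using T(2) by linarith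
    also have "\<dots> \<le> ((2 * K + 5) * L) ^ k * (22 / \<rho>) ^ k"
      using M Z by (intro mult_mono power_mono) auto
    also have "\<dots> = C * L ^ k * (W * E ^ (k - 1) / mahler_measure P ^ g)"
      by (simp add: power_mult_distrib power_divide \<rho>k C_def Y_def mult_ac)
    finally show ?thesis using fin unfolding L_def by blast
  qed
  ultimately show ?thesis by blast
qed

subsection \<open>Covers by neighbourhoods of roots and of approximants\<close>

abbreviation pval :: "int poly \<Rightarrow> real \<Rightarrow> real" where
  "pval P x \<equiv> cmod (poly (of_int_poly P) (complex_of_real x))"

lemma mahler_polys_subset:
  assumes "0 \<le> X"
  shows "{P. degree P = k \<and> mahler_measure P \<le> X} \<subseteq> bounded_polys (Suc k) (- \<lfloor>2 ^ k * X\<rfloor>) \<lfloor>2 ^ k * X\<rfloor>"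
proof safe
  fix P :: "int poly" assume P: "mahler_measure P \<le> X" "k = degree P"
  have "\<bar>coeff P i\<bar> \<le> \<lfloor>2 ^ degree P * X\<rfloor>" for i
  proof -
    have "real_of_int \<bar>coeff P i\<bar> \<le> 2 ^ degree P * X"
      using order_trans[OF abs_coeff_le_mahler[of P i] mult_left_mono[OF P(1)]] by simp
    then show ?thesis by (simp only: le_floor_iff)
  qed
  then have "- \<lfloor>2 ^ degree P * X\<rfloor> \<le> coeff P i \<and> coeff P i \<le> \<lfloor>2 ^ degree P * X\<rfloor>" for i
    by (metis abs_le_iff minus_le_iff)
  then show "P \<in> bounded_polys (Suc (degree P)) (- \<lfloor>2 ^ degree P * X\<rfloor>) \<lfloor>2 ^ degree P * X\<rfloor>"
    by (simp add: bounded_polys_def coeff_eq_0)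
qed

lemma card_mahler_polys:
  assumes "1 \<le> X"
  shows "finite {P. degree P = k \<and> mahler_measure P \<le> X}"
    "real (card {P. degree P = k \<and> mahler_measure P \<le> X}) \<le> (2 ^ (k + 2) * X) ^ (k + 1)"
proof -
  let ?B = "\<lfloor>2 ^ k * X\<rfloor>"
  let ?S = "{P. degree P = k \<and> mahler_measure P \<le> X}"
  have X: "1 \<le> 2 ^ k * X" using assms by (intro mult_ge1_I one_le_power) auto
  then have B: "0 \<le> ?B" by linarith
  have bp: "finite (bounded_polys (Suc k) (- ?B) ?B)" "card (bounded_polys (Suc k) (- ?B) ?B) = nat (?B - - ?B + 1) ^ Suc k"
    using card_bounded_polys[of "- ?B" ?B "Suc k"] B by auto
  have sub: "?S \<subseteq> bounded_polys (Suc k) (- ?B) ?B" using mahler_polys_subset assms by simp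
  then show "finite ?S" using bp(1) finite_subset by blast
  have "card ?S \<le> nat (?B - - ?B + 1) ^ Suc k" using card_mono[OF bp(1) sub] bp(2) by simp
  then have "real (card ?S) \<le> real (nat (?B - - ?B + 1) ^ Suc k)" by (simp only: of_nat_le_iff)
  also have "\<dots> = (2 * real_of_int ?B + 1) ^ Suc k" using B by simp
  also have "\<dots> \<le> (2 ^ (k + 2) * X) ^ Suc k"
  proof (rule power_mono)
    have "2 * real_of_int ?B + 1 \<le> 2 * (2 ^ k * X) + 1" using of_int_floor_le[of "2 ^ k * X"] by argo
    also have "\<dots> \<le> 4 * (2 ^ k * X)" using X by argo
    finally show "2 * real_of_int ?B + 1 \<le> 2 ^ (k + 2) * X" by (simp add: power_add)
  qed (use B in simp)
  finally show "real (card ?S) \<le> (2 ^ (k + 2) * X) ^ (k + 1)" by simp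
qed

text \<open>Each of the \<open>k + 1\<close> coefficients is \<open>O(U)\<close>, which gives
  \<open>O(U ^ (k + 1))\<close> polynomials with \<open>k\<close> roots each. Since \<open>x\<close>
  is real, the real part of a root is at least as close to \<open>x\<close> as the root.\<close>

lemma coverable_near_roots:
  assumes "1 \<le> U" "0 \<le> r"
  shows "finitely_coverable s {x. \<exists>P \<alpha>. irreducible P \<and> 1 \<le> degree P \<and> degree P = k \<and> mahler_measure P \<le> 2 * U \<and> \<alpha> \<in> croots P \<and>
      cmod (complex_of_real x - \<alpha>) \<le> r} (real k * (2 ^ (k + 3) * U) ^ (k + 1) * (2 * r) powr s)"
proof (rule finitely_coverable_balls)
  let ?S = "{P. degree P = k \<and> mahler_measure P \<le> 2 * U}"
  let ?T = "{P \<in> ?S. irreducible P \<and> 1 \<le> degree P}"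
  have S: "finite ?S" "real (card ?S) \<le> (2 ^ (k + 2) * (2 * U)) ^ (k + 1)"
    using card_mahler_polys[of "2 * U" k] assms(1) by auto
  have "?T \<subseteq> ?S" by blast
  then have T: "finite ?T" "card ?T \<le> card ?S" using S(1) finite_subset card_mono by blast+
  let ?K = "Re ` (\<Union>P\<in>?T. croots P)"
  show "finite ?K" using T(1) irreducible_factorization(1) by blast
  have "card ?K \<le> card (\<Union>P\<in>?T. croots P)"
    using T(1) irreducible_factorization(1) by (intro card_image_le) blast
  also have "\<dots> \<le> (\<Sum>P\<in>?T. card (croots P))" by (rule card_UN_le[OF T(1)])
  also have "\<dots> = (\<Sum>P\<in>?T. k)" by (intro sum.cong) (auto simp: irreducible_factorization(2))
  also have "\<dots> = k * card ?T" by simp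
  also have "\<dots> \<le> k * card ?S" using T(2) by simp
  finally have "real (card ?K) \<le> real k * real (card ?S)" by (simp only: of_nat_mult[symmetric] of_nat_le_iff)
  also have "\<dots> \<le> real k * (2 ^ (k + 2) * (2 * U)) ^ (k + 1)" using S(2) by (intro mult_left_mono) auto
  also have "2 ^ (k + 2) * (2 * U) = 2 ^ (k + 3) * U" by (simp add: power_add)
  finally show "real (card ?K) \<le> real k * (2 ^ (k + 3) * U) ^ (k + 1)" .
  show "0 \<le> r" by fact
  show "{x. \<exists>P \<alpha>. irreducible P \<and> 1 \<le> degree P \<and> degree P = k \<and> mahler_measure P \<le> 2 * U \<and> \<alpha> \<in> croots P \<and>
      cmod (complex_of_real x - \<alpha>) \<le> r} \<subseteq> (\<Union>c\<in>?K. cball c r)"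
  proof safe
    fix x P \<alpha> assume P: "irreducible P" "1 \<le> degree P" "k = degree P" "mahler_measure P \<le> 2 * U" "\<alpha> \<in> croots P"
      "cmod (complex_of_real x - \<alpha>) \<le> r"
    have "\<bar>x - Re \<alpha>\<bar> \<le> r" using abs_Re_le_cmod[of "complex_of_real x - \<alpha>"] P(6) by simp
    then have "x \<in> cball (Re \<alpha>) r" by (simp add: dist_real_def abs_minus_commute)
    then show "x \<in> (\<Union>c\<in>Re ` (\<Union>P'\<in>{Pa \<in> {Pa. degree Pa = degree P \<and> mahler_measure Pa \<le> 2 * U}. irreducible Pa \<and> 1 \<le> degree Pa}. croots P'). cball c r)"
      using P by blast
  qed
qed

text \<open>The logarithmic derivative of \<open>P\<close> is the sum of
  \<open>1 / (z - \<alpha>)\<close> over the roots, hence at most \<open>degree P / \<delta>\<close>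
  in absolute value; in the multiplied form roots of \<open>P\<close> need no exception.\<close>

lemma log_derivative_bound:
  assumes irr: "irreducible (P :: int poly)" and k: "1 \<le> degree P"
    and \<delta>: "\<And>\<alpha>. \<alpha> \<in> croots P \<Longrightarrow> \<delta> \<le> cmod (z - \<alpha>)" "0 \<le> \<delta>"
  shows "cmod (poly (pderiv (of_int_poly P)) z) * \<delta> \<le> real (degree P) * cmod (poly (of_int_poly P) z)"
proof -
  let ?R = "croots P" and ?c = "of_int (lead_coeff P) :: complex"
  have fin: "finite ?R" by (rule irreducible_factorization(1)[OF irr k])
  have fac: "(of_int_poly P :: complex poly) = Polynomial.smult ?c (\<Prod>\<alpha>\<in>?R. [:- \<alpha>, 1:])"
    by (rule irreducible_factorization(3)[OF irr k])
  have 1: "poly (of_int_poly P) z = ?c * (\<Prod>\<alpha>\<in>?R. z - \<alpha>)"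
    using arg_cong[OF fac, of "\<lambda>q. poly q z"] by (simp add: poly_prod)
  have "pderiv (of_int_poly P) = Polynomial.smult ?c (\<Sum>\<alpha>\<in>?R. \<Prod>\<beta>\<in>?R - {\<alpha>}. [:- \<beta>, 1:])"
    using arg_cong[OF fac, of pderiv] by (simp add: pderiv_smult pderiv_prod pderiv_pCons)
  from arg_cong[OF this, of "\<lambda>q. poly q z"]
  have 2: "poly (pderiv (of_int_poly P)) z = ?c * (\<Sum>\<alpha>\<in>?R. \<Prod>\<beta>\<in>?R - {\<alpha>}. z - \<beta>)"
    by (simp add: poly_prod poly_sum)
  have "cmod (poly (pderiv (of_int_poly P)) z) * \<delta> \<le> (cmod ?c * (\<Sum>\<alpha>\<in>?R. \<Prod>\<beta>\<in>?R - {\<alpha>}. cmod (z - \<beta>))) * \<delta>"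
    unfolding 2 norm_mult using \<delta>(2)
    by (intro mult_right_mono mult_left_mono) (auto simp: prod_norm intro!: order_trans[OF norm_sum] sum_mono)
  also have "\<dots> = cmod ?c * (\<Sum>\<alpha>\<in>?R. (\<Prod>\<beta>\<in>?R - {\<alpha>}. cmod (z - \<beta>)) * \<delta>)"
    by (simp add: sum_distrib_right mult.assoc)
  also have "\<dots> \<le> cmod ?c * (\<Sum>\<alpha>\<in>?R. \<Prod>\<beta>\<in>?R. cmod (z - \<beta>))"
  proof (intro mult_left_mono sum_mono)
    fix \<alpha> assume \<alpha>: "\<alpha> \<in> ?R"
    have "(\<Prod>\<beta>\<in>?R - {\<alpha>}. cmod (z - \<beta>)) * \<delta> \<le> (\<Prod>\<beta>\<in>?R - {\<alpha>}. cmod (z - \<beta>)) * cmod (z - \<alpha>)"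
      using \<delta>(1)[OF \<alpha>] by (intro mult_left_mono prod_nonneg) auto
    also have "\<dots> = (\<Prod>\<beta>\<in>?R. cmod (z - \<beta>))" using prod.remove[OF fin \<alpha>, of "\<lambda>\<beta>. cmod (z - \<beta>)"] by simp
    finally show "(\<Prod>\<beta>\<in>?R - {\<alpha>}. cmod (z - \<beta>)) * \<delta> \<le> (\<Prod>\<beta>\<in>?R. cmod (z - \<beta>))" .
  qed auto
  also have "\<dots> = real (degree P) * cmod (poly (of_int_poly P) z)"
    unfolding 1 by (simp add: irreducible_factorization(2)[OF irr k] norm_mult prod_norm)
  finally show ?thesis .
qed

text \<open>Separating \<open>P\<close> from its derivative shows that the derivative cannot be
  small where \<open>P\<close> is very small. The logarithmic derivative is then large, which forces
  a root nearby. The exponent \<open>2 * k - 1\<close> is that of the separation bound.\<close>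

lemma near_root_of_small_value:
  assumes k: "1 \<le> k" and R: "0 \<le> R"
  shows "\<exists>c>0. \<exists>C>0. \<forall>P x. irreducible (P :: int poly) \<longrightarrow> degree P = k \<longrightarrow> \<bar>x\<bar> \<le> R \<longrightarrow>
     pval P x * mahler_measure P ^ (2 * k - 1) < c \<longrightarrow>
     (\<exists>\<alpha>\<in>croots P. cmod (complex_of_real x - \<alpha>) \<le> C * pval P x * mahler_measure P ^ (2 * k - 1))"
proof -
  obtain c0 where c0: "c0 > 0" and sep: "\<And>(P :: int poly) N H z. irreducible P \<Longrightarrow> degree P = k \<Longrightarrow> N \<noteq> 0 \<Longrightarrow> degree N < k \<Longrightarrow> 1 \<le> H \<Longrightarrow>
     (\<forall>i. \<bar>coeff P i\<bar> \<le> H) \<Longrightarrow> (\<forall>i. \<bar>coeff N i\<bar> \<le> H) \<Longrightarrow>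
     c0 / ((1 + cmod z) ^ k * real_of_int H ^ (2 * k - 1))
       \<le> cmod (poly (of_int_poly P) z) + cmod (poly (of_int_poly N) z)"
    using irreducible_poly_separation[OF k] by metis
  define A where "A = real k * 2 ^ k"
  have A: "1 \<le> A" unfolding A_def using k by (intro mult_ge1_I one_le_power) auto
  define c where "c = c0 / ((1 + R) ^ k * (2 * A) ^ (2 * k - 1)) / 2"
  have c: "c > 0" using c0 R A by (simp add: c_def)
  have "\<exists>\<alpha>\<in>croots P. cmod (complex_of_real x - \<alpha>) \<le> (real k / c) * pval P x * mahler_measure P ^ (2 * k - 1)"
    if irr: "irreducible P" and deg: "degree P = k" and x: "\<bar>x\<bar> \<le> R" and small: "pval P x * mahler_measure P ^ (2 * k - 1) < c" for P x
  proof -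
    let ?h = "mahler_measure P" and ?z = "complex_of_real x"
    have kP: "1 \<le> degree P" using k deg by simp
    have h1: "1 \<le> ?h" using mahler_measure_poly_ge_1[of P] irr by auto
    define H where "H = \<lceil>A * ?h\<rceil>"
    have Ah: "1 \<le> A * ?h" using A h1 by (rule mult_ge1_I)
    have H: "1 \<le> H" "A * ?h \<le> real_of_int H" "real_of_int H \<le> 2 * A * ?h" using Ah unfolding H_def by linarith+
    have cP: "\<bar>real_of_int (coeff P i)\<bar> \<le> 2 ^ k * ?h" for i using abs_coeff_le_mahler[of P i] deg by simp
    have kc: "real k * (2 ^ k * ?h) \<le> real_of_int H" using H(2) by (simp add: A_def mult.assoc)
    have "2 ^ k * ?h \<le> real k * (2 ^ k * ?h)" using k h1 by simp
    then have "real_of_int \<bar>coeff P i\<bar> \<le> real_of_int H" for i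
      unfolding of_int_abs using cP[of i] kc by linarith
    then have HP: "\<bar>coeff P i\<bar> \<le> H" for i by (simp only: of_int_le_iff)
    have "real_of_int \<bar>coeff (pderiv P) i\<bar> \<le> real_of_int H" for i
    proof (cases "i < k")
      case True
      have "real_of_int \<bar>coeff (pderiv P) i\<bar> = real (Suc i) * \<bar>real_of_int (coeff P (Suc i))\<bar>"
        by (simp add: coeff_pderiv abs_mult)
      also have "\<dots> \<le> real k * (2 ^ k * ?h)" using True cP by (intro mult_mono) auto
      finally show ?thesis using kc by simp
    next
      case False
      then have "coeff (pderiv P) i = 0" using deg by (simp add: coeff_pderiv coeff_eq_0)
      then show ?thesis using H(1) by simp
    qed
    then have HN: "\<bar>coeff (pderiv P) i\<bar> \<le> H" for i by (simp only: of_int_le_iff)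
    have N: "pderiv P \<noteq> 0" "degree (pderiv P) < k" using kP deg by (auto simp: pderiv_eq_0_iff degree_pderiv)
    have "2 * c / ?h ^ (2 * k - 1) = c0 / ((1 + R) ^ k * (2 * A * ?h) ^ (2 * k - 1))"
      by (simp add: c_def power_mult_distrib)
    also have "\<dots> \<le> c0 / ((1 + cmod ?z) ^ k * real_of_int H ^ (2 * k - 1))"
      using c0 x H A h1 R by (intro divide_left_mono mult_mono power_mono mult_pos_pos zero_less_power) auto
    also have "\<dots> \<le> pval P x + cmod (poly (of_int_poly (pderiv P)) ?z)"
      using sep[OF irr deg N H(1)] HP HN by blast
    also have "poly (of_int_poly (pderiv P)) ?z = poly (pderiv (of_int_poly P)) ?z" by (simp add: of_int_hom.map_poly_pderiv)
    finally have "2 * c / ?h ^ (2 * k - 1) \<le> pval P x + cmod (poly (pderiv (of_int_poly P)) ?z)" .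
    moreover have "pval P x < c / ?h ^ (2 * k - 1)" using small h1 by (simp add: pos_less_divide_eq)
    ultimately have P': "c / ?h ^ (2 * k - 1) \<le> cmod (poly (pderiv (of_int_poly P)) ?z)" by simp
    define \<delta> where "\<delta> = Min ((\<lambda>\<alpha>. cmod (?z - \<alpha>)) ` croots P)"
    have fin: "finite (croots P)" and ne: "croots P \<noteq> {}"
      using irreducible_factorization(1,2)[OF irr kP] kP by auto
    have "\<delta> \<in> (\<lambda>\<alpha>. cmod (?z - \<alpha>)) ` croots P" unfolding \<delta>_def using fin ne by (intro Min_in) auto
    then obtain \<alpha> where \<alpha>: "\<alpha> \<in> croots P" "\<delta> = cmod (?z - \<alpha>)" by auto
    have \<delta>: "\<delta> \<le> cmod (?z - \<beta>)" if "\<beta> \<in> croots P" for \<beta> unfolding \<delta>_def using fin that by (intro Min_le) auto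
    have "c / ?h ^ (2 * k - 1) * \<delta> \<le> cmod (poly (pderiv (of_int_poly P)) ?z) * \<delta>"
      using P' \<alpha> by (intro mult_right_mono) auto
    also have "\<dots> \<le> real k * pval P x" using log_derivative_bound[OF irr kP \<delta>] \<alpha>(2) deg by simp
    finally have "\<delta> \<le> (real k / c) * pval P x * ?h ^ (2 * k - 1)" using c h1 by (simp add: field_simps)
    then show ?thesis using \<alpha> by auto
  qed
  moreover have "real k / c > 0" using k c by simp
  ultimately show ?thesis using c by blast
qed

lemma recurs_truncate: "recurs P b N \<Longrightarrow> recurs P (\<lambda>l. if l \<le> N then b l else 0) N"
  unfolding recurs_def shift_act_def
proof (intro allI impI)
  fix l assume *: "\<forall>l. l + degree P \<le> N \<longrightarrow> poly_pairing P (\<lambda>i. b (l + i)) = 0" "l + degree P \<le> N"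
  have "poly_pairing P (\<lambda>i. if l + i \<le> N then b (l + i) else 0) = poly_pairing P (\<lambda>i. b (l + i))"
    by (rule poly_pairing_cong) (use *(2) in auto)
  then show "poly_pairing P (\<lambda>i. if l + i \<le> N then b (l + i) else 0) = 0" using * by simp
qed

text \<open>The balls are counted by \<open>O(U ^ (k + 1))\<close> polynomials times the bound of
  \<open>card_approximants\<close> for each; dividing the approximation at index \<open>0\<close> by
  \<open>b 0\<close> gives the radius \<open>E / W\<close>. With \<open>1 \<le> g\<close> this index
  lies in the window also for \<open>k = 1\<close>.\<close>

lemma coverable_near_approximants:
  assumes k: "1 \<le> k" and g: "1 \<le> g" and R: "0 \<le> R"
  shows "\<exists>C>0. \<forall>U W E. 1 \<le> U \<longrightarrow> 1 \<le> W \<longrightarrow> 0 < E \<longrightarrow> E \<le> 1 \<longrightarrow>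
    finitely_coverable s {x. \<bar>x\<bar> \<le> R \<and> (\<exists>P b. irreducible (P :: int poly) \<and> content P = 1 \<and> degree P = k \<and>
        U \<le> mahler_measure P \<and> mahler_measure P \<le> 2 * U \<and> recurs P b (2 * k - 2 + g) \<and> b 0 \<noteq> 0 \<and>
        W \<le> \<bar>real_of_int (b 0)\<bar> \<and> \<bar>real_of_int (b 0)\<bar> \<le> 2 * W \<and>
        (\<forall>l < 2 * k - 2 + g. \<bar>real_of_int (b (Suc l)) - x * real_of_int (b l)\<bar> \<le> E))}
      (C * (1 + ln (U * W)) ^ k * (U ^ (k + 1) * (W * E ^ (k - 1) / U ^ g)) * (E / W) powr s)"
proof -
  let ?N = "2 * k - 2 + g"
  obtain C0 where C0: "C0 > 0" and card0: "\<And>P W E. irreducible (P :: int poly) \<Longrightarrow> content P = 1 \<Longrightarrow> degree P = k \<Longrightarrow> 1 \<le> W \<Longrightarrow> 0 < E \<Longrightarrow> E \<le> 1 \<Longrightarrow>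
     finite (approximants P ?N R W E) \<and>
     real (card (approximants P ?N R W E)) \<le> C0 * (1 + ln (W * mahler_measure P)) ^ k * (W * E ^ (k - 1) / mahler_measure P ^ g)"
    using card_approximants[OF k R, of g] by metis
  define C where "C = (2 ^ (k + 3)) ^ (k + 1) * (C0 * 3 ^ k * 2) * 2 powr s"
  have "C > 0" using C0 by (simp add: C_def)
  moreover have "finitely_coverable s {x. \<bar>x\<bar> \<le> R \<and> (\<exists>P b. irreducible (P :: int poly) \<and> content P = 1 \<and> degree P = k \<and>
        U \<le> mahler_measure P \<and> mahler_measure P \<le> 2 * U \<and> recurs P b ?N \<and> b 0 \<noteq> 0 \<and>
        W \<le> \<bar>real_of_int (b 0)\<bar> \<and> \<bar>real_of_int (b 0)\<bar> \<le> 2 * W \<and>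
        (\<forall>l < ?N. \<bar>real_of_int (b (Suc l)) - x * real_of_int (b l)\<bar> \<le> E))}
      (C * (1 + ln (U * W)) ^ k * (U ^ (k + 1) * (W * E ^ (k - 1) / U ^ g)) * (E / W) powr s)" (is "finitely_coverable s ?X _")
    if U: "1 \<le> U" and W: "1 \<le> W" and E: "0 < E" "E \<le> 1" for U W E
  proof -
    let ?S = "{P. degree P = k \<and> mahler_measure P \<le> 2 * U}"
    let ?T = "{P \<in> ?S. irreducible P \<and> content P = 1 \<and> U \<le> mahler_measure P}"
    let ?A = "\<lambda>P. approximants P ?N R (2 * W) E"
    let ?q = "\<lambda>b :: nat \<Rightarrow> int. real_of_int (b 1) / real_of_int (b 0)"
    let ?K = "\<Union>P\<in>?T. ?q ` ?A P"
    define Y where "Y = C0 * (3 * (1 + ln (U * W))) ^ k * (2 * W * E ^ (k - 1) / U ^ g)"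
    have S: "finite ?S" "real (card ?S) \<le> (2 ^ (k + 2) * (2 * U)) ^ (k + 1)"
      using card_mahler_polys[of "2 * U" k] U by auto
    have "?T \<subseteq> ?S" by blast
    then have T: "finite ?T" "card ?T \<le> card ?S" using S(1) finite_subset card_mono by blast+
    have UW: "1 \<le> U * W" using U W by (rule mult_ge1_I)
    have A: "finite (?A P)" "real (card (?A P)) \<le> Y" if "P \<in> ?T" for P
    proof -
      have P: "irreducible P" "content P = 1" "degree P = k" "U \<le> mahler_measure P" "mahler_measure P \<le> 2 * U"
        using that by auto
      have *: "finite (?A P) \<and> real (card (?A P)) \<le> C0 * (1 + ln (2 * W * mahler_measure P)) ^ k * (2 * W * E ^ (k - 1) / mahler_measure P ^ g)"
        using P W E by (intro card0) auto
      then show "finite (?A P)" by blast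
      have "W * mahler_measure P \<le> W * (2 * U)" using P(5) W by (intro mult_left_mono) auto
      then have "ln (2 * W * mahler_measure P) \<le> ln (4 * (U * W))"
        using P(4) U W by (subst ln_le_cancel_iff) (auto simp: mult_ac)
      also have "\<dots> = 2 * ln 2 + ln (U * W)" using UW ln_mult_pos[of 4 "U * W"] ln_realpow[of 2 2] by simp
      also have "\<dots> \<le> 2 + ln (U * W)" using ln_le_minus_one[of 2] by simp
      finally have ln1: "1 + ln (2 * W * mahler_measure P) \<le> 3 * (1 + ln (U * W))"
        using ln_ge_zero[OF UW] by argo
      have "0 \<le> ln (2 * W * mahler_measure P)" using W U P(4) mult_ge1_I[of W "mahler_measure P"] by (intro ln_ge_zero) auto
      then have "real (card (?A P)) \<le> C0 * (3 * (1 + ln (U * W))) ^ k * (2 * W * E ^ (k - 1) / U ^ g)"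
      proof (intro order_trans[OF conjunct2[OF *]] mult_mono)
        show "(1 + ln (2 * W * mahler_measure P)) ^ k \<le> (3 * (1 + ln (U * W))) ^ k"
          using ln1 \<open>0 \<le> ln (2 * W * mahler_measure P)\<close> by (intro power_mono) auto
        show "2 * W * E ^ (k - 1) / mahler_measure P ^ g \<le> 2 * W * E ^ (k - 1) / U ^ g"
          using W E U P(4) by (intro divide_left_mono power_mono mult_pos_pos zero_less_power) auto
        show "0 \<le> C0 * (3 * (1 + ln (U * W))) ^ k" using C0 ln_ge_zero[OF UW] by simp
        show "0 \<le> 2 * W * E ^ (k - 1) / mahler_measure P ^ g" using W E mahler_measure_ge_0[of P] by simp
      qed (use C0 \<open>0 \<le> ln (2 * W * mahler_measure P)\<close> in auto)
      then show "real (card (?A P)) \<le> Y" by (simp add: Y_def)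
    qed
    have Y0: "0 \<le> Y" unfolding Y_def using C0 ln_ge_zero[OF UW] W E U by (intro mult_nonneg_nonneg divide_nonneg_nonneg zero_le_power) auto
    have cov: "finitely_coverable s ?X (((2 ^ (k + 2) * (2 * U)) ^ (k + 1) * Y) * (2 * (E / W)) powr s)"
    proof (rule finitely_coverable_balls)
      show "finite ?K" using T(1) A(1) by (intro finite_UN_I finite_imageI) auto
      have "card ?K \<le> (\<Sum>P\<in>?T. card (?q ` ?A P))" by (rule card_UN_le[OF T(1)])
      also have "\<dots> \<le> (\<Sum>P\<in>?T. card (?A P))" using A(1) by (intro sum_mono card_image_le)
      finally have "real (card ?K) \<le> (\<Sum>P\<in>?T. real (card (?A P)))" by (simp only: of_nat_sum[symmetric] of_nat_le_iff)
      also have "\<dots> \<le> (\<Sum>P\<in>?T. Y)" using A(2) by (intro sum_mono)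
      also have "\<dots> = real (card ?T) * Y" by simp
      also have "\<dots> \<le> (2 ^ (k + 2) * (2 * U)) ^ (k + 1) * Y" using S(2) T(2) Y0 by (intro mult_right_mono) auto
      finally show "real (card ?K) \<le> (2 ^ (k + 2) * (2 * U)) ^ (k + 1) * Y" .
      show "0 \<le> E / W" using E W by simp
      show "?X \<subseteq> (\<Union>c\<in>?K. cball c (E / W))"
      proof (rule subsetI)
        fix x assume "x \<in> ?X"
        then obtain P b where x: "\<bar>x\<bar> \<le> R" and P: "irreducible P" "content P = 1" "degree P = k" "U \<le> mahler_measure P" "mahler_measure P \<le> 2 * U"
          and b: "recurs P b ?N" "b 0 \<noteq> 0" "W \<le> \<bar>real_of_int (b 0)\<bar>" "\<bar>real_of_int (b 0)\<bar> \<le> 2 * W"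
          "\<forall>l < ?N. \<bar>real_of_int (b (Suc l)) - x * real_of_int (b l)\<bar> \<le> E"
          by blast
        let ?b = "\<lambda>l. if l \<le> ?N then b l else 0"
        have b1: "?b 1 = b 1" "?b 0 = b 0" using k g by auto
        have "?b \<in> ?A P" unfolding approximants_def
        proof (intro CollectI conjI exI[of _ x] allI impI)
          show "recurs P ?b ?N" using b(1) by (rule recurs_truncate)
        qed (use x b in auto)
        moreover have "P \<in> ?T" using P by simp
        ultimately have q: "?q ?b \<in> ?K" by (intro UN_I imageI)
        have N0: "0 < ?N" using g by simp
        have "\<bar>x - ?q ?b\<bar> = \<bar>real_of_int (b (Suc 0)) - x * real_of_int (b 0)\<bar> / \<bar>real_of_int (b 0)\<bar>"
          unfolding b1 abs_divide[symmetric] using b(2) by (simp add: diff_divide_distrib abs_minus_commute)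
        also have "\<dots> \<le> E / W" using b(3) b(5)[rule_format, OF N0] W E by (intro frac_le) auto
        finally have "x \<in> cball (?q ?b) (E / W)" unfolding mem_cball dist_real_def abs_minus_commute[of x] .
        then show "x \<in> (\<Union>c\<in>?K. cball c (E / W))" by (rule UN_I[OF q])
      qed
    qed
    have "((2 ^ (k + 2) * (2 * U)) ^ (k + 1) * Y) * (2 * (E / W)) powr s =
       C * (1 + ln (U * W)) ^ k * (U ^ (k + 1) * (W * E ^ (k - 1) / U ^ g)) * (E / W) powr s"
    proof -
      define A :: real where "A = 2 ^ (k + 3)"
      have 1: "2 ^ (k + 2) * (2 * U) = A * U" by (simp add: power_add A_def)
      have 2: "(2 * (E / W)) powr s = 2 powr s * (E / W) powr s" by (rule powr_mult)
      show ?thesis unfolding Y_def C_def 1 2 A_def[symmetric] power_mult_distrib by (simp add: mult_ac)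
    qed
    then show ?thesis using cov by simp
  qed
  ultimately show ?thesis by blast
qed

subsection \<open>Relations of minimal degree\<close>

lemma abs_poly_pairing_le:
  fixes v :: "nat \<Rightarrow> real"
  assumes "\<And>i. i \<le> degree P \<Longrightarrow> \<bar>v i\<bar> \<le> e" "0 \<le> e" "\<And>i. \<bar>real_of_int (coeff P i)\<bar> \<le> A"
  shows "\<bar>\<Sum>i\<le>degree P. real_of_int (coeff P i) * v i\<bar> \<le> real (degree P + 1) * A * e"
proof -
  have A: "0 \<le> A" using assms(3)[of 0] by linarith
  have "\<bar>\<Sum>i\<le>degree P. real_of_int (coeff P i) * v i\<bar> \<le> (\<Sum>i\<le>degree P. A * e)"
    using assms A by (intro order_trans[OF sum_abs] sum_mono) (auto simp: abs_mult intro!: mult_mono)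
  then show ?thesis by (simp add: mult.assoc)
qed

lemma recurs_of_small:
  fixes a :: "nat \<Rightarrow> int" and x :: real
  assumes "poly_pairing G a = 0"
    and "\<And>l i. l + i \<le> n \<Longrightarrow> \<bar>real_of_int (a (l + i)) - x ^ l * real_of_int (a i)\<bar> \<le> e" "0 \<le> e"
    and "\<And>i. \<bar>real_of_int (coeff G i)\<bar> \<le> A" "real (degree G + 1) * A * e < 1"
  shows "recurs G a n"
  unfolding recurs_def
proof (intro allI impI)
  fix l assume l: "l + degree G \<le> n"
  have "real_of_int (shift_act G a l) = (\<Sum>i\<le>degree G. real_of_int (coeff G i) * real_of_int (a (l + i))) -
     x ^ l * real_of_int (poly_pairing G a)"
    using assms(1) by (simp add: shift_act_def poly_pairing_def)
  also have "\<dots> = (\<Sum>i\<le>degree G. real_of_int (coeff G i) * (real_of_int (a (l + i)) - x ^ l * real_of_int (a i)))"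
    by (simp add: poly_pairing_def algebra_simps sum_subtractf sum_distrib_left)
  also have "\<bar>\<dots>\<bar> \<le> real (degree G + 1) * A * e"
    by (rule abs_poly_pairing_le) (use assms l in auto)
  finally have "\<bar>real_of_int (shift_act G a l)\<bar> < 1" using assms(5) by linarith
  then show "shift_act G a l = 0" by linarith
qed

text \<open>Siegel's lemma for one equation: the \<open>(X + 1) ^ (d + 1)\<close> polynomials with
  coefficients in \<open>0, ..., X\<close> have pairings of size \<open>O(X * B)\<close>, so an
  \<open>X\<close> of order \<open>B powr (1 / d)\<close> forces a collision.\<close>

lemma pigeonhole_relation:
  fixes a :: "nat \<Rightarrow> int"
  assumes "1 \<le> d" "1 \<le> B" "\<And>l. l \<le> d \<Longrightarrow> \<bar>real_of_int (a l)\<bar> \<le> B"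
  shows "\<exists>G. G \<noteq> 0 \<and> degree G \<le> d \<and> poly_pairing G a = 0 \<and>
     (\<forall>i. \<bar>real_of_int (coeff G i)\<bar> \<le> 2 * (4 * real (d + 1) * B) powr (1 / real d))"
proof -
  let ?K = "4 * real (d + 1) * B"
  have K: "1 \<le> ?K" using assms(2) mult_mono[of 1 "4 * real (d + 1)" 1 B] by simp
  define y where "y = ?K powr (1 / real d)"
  have y: "1 \<le> y" "y ^ d = ?K"
  proof -
    show y1: "1 \<le> y" unfolding y_def using K by (intro ge_one_powr_ge_zero) auto
    then have "y ^ d = y powr real d" by (subst powr_realpow) auto
    also have "\<dots> = ?K" unfolding y_def powr_powr using K assms(1) by simp
    finally show "y ^ d = ?K" .
  qed
  define X where "X = nat \<lceil>y\<rceil>"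
  have X: "y \<le> real X" "real X \<le> 2 * y" "1 \<le> X" using y(1) unfolding X_def by linarith+
  let ?D = "bounded_polys (d + 1) 0 (int X)"
  have D: "finite ?D" "card ?D = (X + 1) ^ (d + 1)" using card_bounded_polys[of 0 "int X" "d + 1"] by (auto simp: nat_add_distrib)
  have bd: "\<bar>coeff p i\<bar> \<le> int X" "0 \<le> coeff p i" if "p \<in> ?D" for p i
    using that by (cases "i < d + 1"; force simp: bounded_polys_def)+
  have deg: "degree p \<le> d" if "p \<in> ?D" for p using degree_bounded_polys[OF that] by auto
  define M where "M = \<lfloor>real (d + 1) * real X * B\<rfloor>"
  have M0: "0 \<le> M" using assms(2) by (simp add: M_def)
  have "(\<lambda>p. poly_pairing p a) ` ?D \<subseteq> {-M..M}"
  proof safe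
    fix p assume p: "p \<in> ?D"
    have "real_of_int \<bar>poly_pairing p a\<bar> = \<bar>\<Sum>i\<le>degree p. real_of_int (coeff p i) * real_of_int (a i)\<bar>"
      by (simp add: poly_pairing_def)
    also have "\<dots> \<le> real (degree p + 1) * real X * B"
    proof (rule abs_poly_pairing_le)
      show "\<bar>real_of_int (coeff p i)\<bar> \<le> real X" for i
        using bd(1)[OF p, of i] by (metis of_int_abs of_int_le_iff of_int_of_nat_eq)
    qed (use assms deg[OF p] in auto)
    also have "\<dots> \<le> real (d + 1) * real X * B" using deg[OF p] assms(2) by (intro mult_right_mono) auto
    finally have "\<bar>poly_pairing p a\<bar> \<le> M" unfolding M_def by (simp only: le_floor_iff)
    then show "poly_pairing p a \<in> {-M..M}" by auto
  qed
  moreover have "card {-M..M} < card ?D"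
  proof -
    have "real (card {-M..M}) = 2 * real_of_int M + 1" using M0 by simp
    also have "\<dots> \<le> 2 * (real (d + 1) * real X * B) + 1" using of_int_floor_le[of "real (d + 1) * real X * B"] unfolding M_def by argo
    also have "\<dots> \<le> real X * ?K"
    proof -
      have "1 * 1 * 1 \<le> real (d + 1) * real X * B" using assms X by (intro mult_mono) auto
      then show ?thesis by (simp add: algebra_simps)
    qed
    also have "\<dots> \<le> real X * real X ^ d" unfolding y(2)[symmetric] using X y by (intro mult_left_mono power_mono) auto
    also have "\<dots> < real ((X + 1) ^ (d + 1))"
    proof -
      have "real X * real X ^ d = real X ^ (d + 1)" by simp
      also have "\<dots> < real (X + 1) ^ (d + 1)" by (rule power_strict_mono) auto
      also have "\<dots> = real ((X + 1) ^ (d + 1))" by (simp add: algebra_simps)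
      finally show ?thesis .
    qed
    finally show ?thesis unfolding D(2) by (simp only: of_nat_less_iff)
  qed
  ultimately have "\<not> inj_on (\<lambda>p. poly_pairing p a) ?D"
    using card_inj_on_le[of "\<lambda>p. poly_pairing p a" ?D "{-M..M}"] by auto
  then obtain p q where pq: "p \<in> ?D" "q \<in> ?D" "p \<noteq> q" "poly_pairing p a = poly_pairing q a" by (auto simp: inj_on_def)
  let ?G = "p - q"
  have "poly_pairing ?G a = 0"
    using poly_pairing_add[of ?G q a] pq(4) by simp
  moreover have "\<bar>real_of_int (coeff ?G i)\<bar> \<le> 2 * y" for i
  proof -
    have "\<bar>coeff ?G i\<bar> \<le> int X" using bd[OF pq(1), of i] bd[OF pq(2), of i] by simp
    then have "\<bar>real_of_int (coeff ?G i)\<bar> \<le> real X" by (metis of_int_abs of_int_le_iff of_int_of_nat_eq)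
    then show ?thesis using X by linarith
  qed
  moreover have "degree ?G \<le> d" using deg pq degree_diff_le by blast
  ultimately show ?thesis using pq(3) unfolding y_def by (intro exI[of _ ?G]) auto
qed

lemma mahler_measure_mult: "mahler_measure (P * Q) = mahler_measure P * mahler_measure Q"
  by (simp add: mahler_measure_def hom_distribs measure_eq_prod)

lemma mahler_measure_ge_1: "P \<noteq> 0 \<Longrightarrow> 1 \<le> mahler_measure P"
  by (rule mahler_measure_poly_ge_1)

lemma recurs_primitive_part:
  assumes "recurs G a n" "G \<noteq> 0"
  shows "recurs (primitive_part G) a n" "mahler_measure (primitive_part G) \<le> mahler_measure G"
proof -
  have G: "G = Polynomial.smult (content G) (primitive_part G)" by simp
  have "shift_act G a l = content G * shift_act (primitive_part G) a l" for l
    unfolding shift_act_def by (subst G, subst poly_pairing_smult) simp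
  then show "recurs (primitive_part G) a n" using assms by (simp add: recurs_def)
  have "mahler_measure G = mahler_measure [:content G:] * mahler_measure (primitive_part G)"
    using mahler_measure_mult[of "[:content G:]" "primitive_part G"] by simp
  moreover have "1 \<le> mahler_measure [:content G:]" using assms by (intro mahler_measure_ge_1) simp
  ultimately show "mahler_measure (primitive_part G) \<le> mahler_measure G"
    using mult_right_mono[of 1 "mahler_measure [:content G:]" "mahler_measure (primitive_part G)"] mahler_measure_ge_0 by simp
qed

text \<open>Minimality of the degree is what makes the cofactors of \<open>P\<close> act nontrivially on \<open>a\<close>.\<close>
lemma minimal_relation:
  assumes "G \<noteq> 0" "degree G \<le> d" "mahler_measure G \<le> X" "recurs G a n" "a 0 \<noteq> 0" "d \<le> n"
  shows "\<exists>P. content P = 1 \<and> 1 \<le> degree P \<and> degree P \<le> d \<and> mahler_measure P \<le> X \<and> recurs P a n \<and>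
    (\<forall>T. content T = 1 \<longrightarrow> degree T < degree P \<longrightarrow> mahler_measure T \<le> X \<longrightarrow> \<not> recurs T a n)"
proof -
  let ?Q = "\<lambda>P. content P = 1 \<and> degree P \<le> d \<and> mahler_measure P \<le> X \<and> recurs P a n"
  have "?Q (primitive_part G)" using recurs_primitive_part[OF assms(4,1)] assms by simp
  then obtain P where P: "?Q P" and min: "\<And>T. ?Q T \<Longrightarrow> degree P \<le> degree T"
    using ex_has_least_nat[of ?Q "primitive_part G" degree] by blast
  have "1 \<le> degree P"
  proof (rule ccontr)
    assume "\<not> 1 \<le> degree P"
    then obtain c where c: "P = [:c:]" by (metis degree_eq_zeroE less_one not_le)
    have "shift_act P a 0 = 0" using P unfolding recurs_def c by simp
    then have "c * a 0 = 0" unfolding c shift_act_def by (simp add: poly_pairing_def)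
    then show False using P assms(5) c by auto
  qed
  then show ?thesis using P min by (intro exI[of _ P]) (meson le_trans less_imp_le not_less)
qed

text \<open>Content \<open>1\<close> passes to both factors of a nontrivial splitting, so neither is
  constant and the degrees drop.\<close>

lemma primitive_factorization:
  fixes P :: "int poly"
  assumes "content P = 1" "1 \<le> degree P"
  shows "\<exists>ps. P = prod_list ps \<and> (\<forall>p\<in>set ps. irreducible p \<and> content p = 1 \<and> 1 \<le> degree p)"
  using assms
proof (induction "degree P" arbitrary: P rule: less_induct)
  case less
  show ?case
  proof (cases "irreducible P")
    case True
    then show ?thesis using less.prems by (intro exI[of _ "[P]"]) auto
  next
    case False
    have "P \<noteq> 0" "\<not> is_unit P" using less.prems by (auto simp: is_unit_poly_iff)
    then obtain A B where AB: "P = A * B" "\<not> is_unit A" "\<not> is_unit B" using False by (auto simp: irreducible_def)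
    have nz: "A \<noteq> 0" "B \<noteq> 0" using AB \<open>P \<noteq> 0\<close> by auto
    have "content A * content B = 1" using less.prems AB content_mult[of A B] by simp
    then have "is_unit (content A)" "is_unit (content B)" by (metis dvd_triv_left, metis dvd_triv_right)
    then have "normalize (content A) = 1" "normalize (content B) = 1" by (auto simp: is_unit_normalize)
    then have con: "content A = 1" "content B = 1" by simp_all
    have pos: "1 \<le> degree F" if "\<not> is_unit F" "content F = 1" for F :: "int poly"
    proof (rule ccontr)
      assume "\<not> 1 \<le> degree F"
      then obtain c where c: "F = [:c:]" by (metis degree_eq_zeroE less_one not_le)
      then have "normalize c = 1" using that(2) by simp
      then show False using that(1) c by (metis is_unit_const_poly_iff normalize_1_iff)
    qed
    have deg: "degree P = degree A + degree B" using AB nz by (simp add: degree_mult_eq)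
    have dA: "1 \<le> degree A" and dB: "1 \<le> degree B" using pos AB con by auto
    obtain ps where "A = prod_list ps" "\<forall>p\<in>set ps. irreducible p \<and> content p = 1 \<and> 1 \<le> degree p"
      using less.hyps[of A] con(1) dA dB deg by auto
    moreover obtain qs where "B = prod_list qs" "\<forall>p\<in>set qs. irreducible p \<and> content p = 1 \<and> 1 \<le> degree p"
      using less.hyps[of B] con(2) dA dB deg by auto
    ultimately show ?thesis using AB by (intro exI[of _ "ps @ qs"]) auto
  qed
qed

subsection \<open>Selecting a factor\<close>

lemma exists_le_average:
  fixes c :: "nat \<Rightarrow> real"
  assumes "1 \<le> r" "(\<Sum>i<r. c i) \<le> X"
  shows "\<exists>i<r. c i \<le> X / real r"
proof (rule ccontr)
  assume "\<not> ?thesis"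
  then have "(\<Sum>i<r. X / real r) < (\<Sum>i<r. c i)" using assms(1) by (intro sum_strict_mono) (auto simp: not_le lessThan_empty_iff)
  then show False using assms by simp
qed

text \<open>Averaging over \<open>r\<close> terms reduces the decay to \<open>\<eta> / r\<close>;
  \<open>r \<le> d\<close> makes the loss independent of the number of factors.\<close>

lemma exists_le_average_decay:
  fixes c :: "nat \<Rightarrow> real"
  assumes r: "1 \<le> r" "r \<le> d" and c: "(\<Sum>i<r. c i) \<le> - \<eta> * L + A" and nn: "0 \<le> \<eta>" "0 \<le> L" "0 \<le> A"
  shows "\<exists>i<r. c i \<le> - (\<eta> / real d) * L + A"
proof -
  obtain i where i: "i < r" "c i \<le> (- \<eta> * L + A) / real r" using exists_le_average[OF r(1) c] by blast
  have "\<eta> * L / real d \<le> \<eta> * L / real r" using r nn by (intro divide_left_mono mult_nonneg_nonneg mult_pos_pos) auto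
  moreover have "A / real r \<le> A" using r nn by (simp add: divide_le_eq mult_le_cancel_left1)
  ultimately have "c i \<le> - (\<eta> / real d) * L + A" using i(2) by (simp add: add_divide_distrib diff_divide_distrib)
  then show ?thesis using i(1) by blast
qed

text \<open>With \<open>q = exp (n L)\<close>, the variables are the logarithms of the following data of the factors \<open>p i\<close> of \<open>P\<close>:
  \<open>m i\<close> of the Mahler measure, \<open>u i\<close> of the value at \<open>x\<close>, \<open>w i\<close> of the first term of the approximant
  obtained from \<open>a\<close> by applying the cofactor of \<open>p i\<close>, and \<open>e i\<close> of its quality of approximation.\<close>
locale factor_logs =
  fixes n d k r :: nat and s K L \<mu> p :: real and m u w e :: "nat \<Rightarrow> real" and kk :: "nat \<Rightarrow> nat"
  assumes r: "1 \<le> r" and kk: "\<And>i. i < r \<Longrightarrow> 1 \<le> kk i" and k: "k = (\<Sum>i<r. kk i)" "k \<le> d" and n: "2 * d \<le> n + 1"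
    and \<mu>: "\<mu> = (\<Sum>i<r. m i)" and p: "p = (\<Sum>i<r. u i)" and m: "\<And>i. i < r \<Longrightarrow> 0 \<le> m i"
    and K: "0 \<le> K" and L: "0 \<le> L" and s: "1 / 2 \<le> s" "s \<le> 1"
    and w: "\<And>i. i < r \<Longrightarrow> w i \<le> K + real n * L + (p - u i)"
    and e: "\<And>i. i < r \<Longrightarrow> e i \<le> K + \<mu> - m i - 2 * L"
    and P: "p \<le> K + \<mu> - (real n + 2) * L"
    and mahler: "\<And>i. i < r \<Longrightarrow> (real n + 2 - real k - real (kk i)) * m i \<le> K + w i + (real (kk i) - 1) * e i"
begin

lemma r_le_k: "r \<le> k"
proof -
  have "(\<Sum>i<r. 1) \<le> (\<Sum>i<r. kk i)" using kk by (intro sum_mono) auto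
  then show ?thesis using k by simp
qed

lemma kk_le: "i < r \<Longrightarrow> kk i \<le> k"
  unfolding k by (rule member_le_sum) auto

lemma real_k: "(\<Sum>i<r. real (kk i)) = real k"
  by (simp add: k)

lemma \<mu>_nonneg: "0 \<le> \<mu>"
  unfolding \<mu> using m by (intro sum_nonneg) auto

text \<open>Adding \<open>mahler\<close> over the factors, with \<open>w\<close> and
  \<open>e\<close> inserted, leaves \<open>p\<close> with the nonnegative factor
  \<open>r - 1\<close>, so \<open>P\<close> applies and gives
  \<open>(n + 2 - 2 * k) * (\<mu> - L) \<le> 3 * d * K\<close>. The first factor is at least
  \<open>1\<close> since \<open>2 * k \<le> 2 * d \<le> n + 1\<close>. As \<open>exp L\<close> is
  the \<open>n\<close>-th root of \<open>q\<close>, this is the improvement over the pigeonhole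
  bound.\<close>

lemma \<mu>_le: "\<mu> \<le> L + 3 * real d * K"
proof -
  have "(real n + 1 - real k) * m i \<le> 2 * K + real n * L + p - u i + (real (kk i) - 1) * (K + \<mu> - 2 * L)" if "i < r" for i
  proof -
    have "(real (kk i) - 1) * e i \<le> (real (kk i) - 1) * (K + \<mu> - m i - 2 * L)"
      using kk[OF that] e[OF that] by (intro mult_left_mono) auto
    then have "(real n + 2 - real k - real (kk i)) * m i \<le> K + (K + real n * L + (p - u i)) + (real (kk i) - 1) * (K + \<mu> - m i - 2 * L)"
      using mahler[OF that] w[OF that] by argo
    then show ?thesis by (simp add: algebra_simps)
  qed
  then have "(\<Sum>i<r. (real n + 1 - real k) * m i) \<le>
    (\<Sum>i<r. 2 * K + real n * L + p - u i + (real (kk i) - 1) * (K + \<mu> - 2 * L))" by (intro sum_mono) auto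
  also have "\<dots> = real r * (2 * K + real n * L + p) - p + (real k - real r) * (K + \<mu> - 2 * L)"
    unfolding p by (simp add: sum.distrib sum_subtractf sum_distrib_right[symmetric] real_k)
  also have "\<dots> = real r * (2 * K + real n * L) + (real r - 1) * p + (real k - real r) * (K + \<mu> - 2 * L)"
    by (simp add: algebra_simps)
  also have "\<dots> \<le> real r * (2 * K + real n * L) + (real r - 1) * (K + \<mu> - (real n + 2) * L) + (real k - real r) * (K + \<mu> - 2 * L)"
    using mult_left_mono[OF P, of "real r - 1"] r by simp
  also have "\<dots> = K * (2 * real r + real k - 1) + (real n + 2 - 2 * real k) * L + (real k - 1) * \<mu>"
    by (simp add: algebra_simps)
  also have "\<dots> \<le> K * (3 * real d) + (real n + 2 - 2 * real k) * L + (real k - 1) * \<mu>"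
    using mult_left_mono[of "2 * real r + real k - 1" "3 * real d" K] K r_le_k k(2) by simp
  finally have "(real n + 1 - real k) * \<mu> \<le> K * (3 * real d) + (real n + 2 - 2 * real k) * L + (real k - 1) * \<mu>"
    by (simp add: \<mu> sum_distrib_left)
  then have *: "(real n + 2 - 2 * real k) * (\<mu> - L) \<le> 3 * real d * K" by (simp add: algebra_simps)
  have G: "1 \<le> real n + 2 - 2 * real k" using n k(2) by linarith
  show ?thesis
  proof (cases "\<mu> - L \<le> 0")
    case True
    have "0 \<le> 3 * real d * K" using K by simp
    then show ?thesis using True by argo
  next
    case False
    then have "1 * (\<mu> - L) \<le> (real n + 2 - 2 * real k) * (\<mu> - L)" using G by (intro mult_right_mono) auto
    then show ?thesis using * by argo
  qed
qed

lemma sum_kk_m_le: "(\<Sum>i<r. real (kk i) * m i) \<le> real k * \<mu>"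
  unfolding \<mu> sum_distrib_left using kk_le m by (intro sum_mono mult_right_mono) auto

text \<open>The left-hand side is the logarithm of the cost in
  \<open>coverable_near_approximants\<close> for \<open>g = n + 2 - k - kk i\<close>, without its
  constant and its power of a logarithm. Only the sum over \<open>i\<close> can be controlled, and
  averaging selects one factor.\<close>

lemma approximant_factor:
  assumes "d \<le> 2 * k" and \<eta>: "0 \<le> \<eta>" "(1 - s) * (real n + 2) \<le> real d - \<eta>"
  shows "\<exists>i<r. (real (kk i) + 1 - (real n + 2 - real k - real (kk i))) * m i + (1 - s) * w i + (real (kk i) - 1 + s) * e i
     \<le> - (\<eta> / real d) * L + 12 * (real d)\<^sup>2 * K"
proof (rule exists_le_average_decay[OF r _ _ \<eta>(1) L])
  show "r \<le> d" using r_le_k k(2) by simp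
  show "0 \<le> 12 * (real d)\<^sup>2 * K" using K by simp
  let ?c = "\<lambda>i. (real (kk i) + 1 - (real n + 2 - real k - real (kk i))) * m i + (1 - s) * w i + (real (kk i) - 1 + s) * e i"
  have "?c i \<le> real (kk i) * m i + (real k - real n - s) * m i + (1 - s) * (K + real n * L + p - u i) + (real (kk i) - 1 + s) * (K + \<mu> - 2 * L)"
    if "i < r" for i
  proof -
    have "(1 - s) * w i \<le> (1 - s) * (K + real n * L + (p - u i))" using w[OF that] s by (intro mult_left_mono) auto
    moreover have "(real (kk i) - 1 + s) * e i \<le> (real (kk i) - 1 + s) * (K + \<mu> - m i - 2 * L)"
      using e[OF that] kk[OF that] s by (intro mult_left_mono) auto
    ultimately show ?thesis by (simp add: algebra_simps)
  qed
  then have "(\<Sum>i<r. ?c i) \<le> (\<Sum>i<r. real (kk i) * m i + (real k - real n - s) * m i + (1 - s) * (K + real n * L + p - u i) + (real (kk i) - 1 + s) * (K + \<mu> - 2 * L))"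
    by (intro sum_mono) auto
  also have "\<dots> = (\<Sum>i<r. real (kk i) * m i) + (real k - real n - s) * \<mu> + (1 - s) * (real r * (K + real n * L + p) - p) +
      (real k - real r + real r * s) * (K + \<mu> - 2 * L)"
    unfolding p \<mu> by (simp add: sum.distrib sum_subtractf sum_distrib_left[symmetric] sum_distrib_right[symmetric] real_k)
  also have "\<dots> \<le> real k * \<mu> + (real k - real n - s) * \<mu> + (1 - s) * (real r * (K + real n * L + p) - p) +
      (real k - real r + real r * s) * (K + \<mu> - 2 * L)"
    using sum_kk_m_le by simp
  \<comment> \<open>The \<open>u i\<close> add up to \<open>p\<close>, which is left with the factor
    \<open>(1 - s) * (r - 1)\<close>. This is nonnegative, so the upper bound \<open>P\<close> may
    be inserted.\<close>
  also have "(1 - s) * (real r * (K + real n * L + p) - p) = (1 - s) * (real r * (K + real n * L)) + ((1 - s) * (real r - 1)) * p"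
    by (simp add: algebra_simps)
  also have "real k * \<mu> + (real k - real n - s) * \<mu> + ((1 - s) * (real r * (K + real n * L)) + ((1 - s) * (real r - 1)) * p) +
      (real k - real r + real r * s) * (K + \<mu> - 2 * L) \<le>
     real k * \<mu> + (real k - real n - s) * \<mu> + ((1 - s) * (real r * (K + real n * L)) + ((1 - s) * (real r - 1)) * (K + \<mu> - (real n + 2) * L)) +
      (real k - real r + real r * s) * (K + \<mu> - 2 * L)"
    using mult_left_mono[OF P, of "(1 - s) * (real r - 1)"] s r by simp
  also have "\<dots> = (3 * real k - real n - 1) * \<mu> + ((1 - s) * (real n + 2) - 2 * real k) * L + K * ((1 - s) * (2 * real r - 1) + real k - real r + real r * s)"
    by (simp add: algebra_simps)
  finally have sum_le: "(\<Sum>i<r. ?c i) \<le> (3 * real k - real n - 1) * \<mu> + ((1 - s) * (real n + 2) - 2 * real k) * L +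
      K * ((1 - s) * (2 * real r - 1) + real k - real r + real r * s)" by simp
  have "(1 - s) * (real n + 2) - 2 * real k \<le> real d - \<eta> - 2 * real k" using \<eta> by simp
  then have L_le: "((1 - s) * (real n + 2) - 2 * real k) * L \<le> (real d - \<eta> - 2 * real k) * L"
    using L by (rule mult_right_mono)
  have K_le: "K * ((1 - s) * (2 * real r - 1) + real k - real r + real r * s) \<le> K * (3 * real d)"
  proof (rule mult_left_mono[OF _ K])
    have "(1 - s) * (2 * real r - 1) \<le> 1 * (2 * real r - 1)" using s r by (intro mult_right_mono) auto
    moreover have "real r * s \<le> real r * 1" using s by (intro mult_left_mono) auto
    moreover have "real r \<le> real d" "real k \<le> real d" using r_le_k k(2) by auto
    ultimately show "(1 - s) * (2 * real r - 1) + real k - real r + real r * s \<le> 3 * real d" by argo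
  qed
  \<comment> \<open>The expression is linear in \<open>\<mu>\<close>. For a nonnegative slope the
    end \<open>\<mu> = L\<close> leaves \<open>(k + d - n - 1) * L \<le> 0\<close>; for a negative
    slope the end \<open>\<mu> = 0\<close> leaves \<open>(d - 2 * k) * L \<le> 0\<close>.\<close>
  have main: "(3 * real k - real n - 1) * \<mu> + (real d - \<eta> - 2 * real k) * L \<le> - \<eta> * L + 9 * (real d)\<^sup>2 * K"
  proof (cases "0 \<le> 3 * real k - real n - 1")
    case True
    have "(3 * real k - real n - 1) * \<mu> \<le> (3 * real k - real n - 1) * (L + 3 * real d * K)"
      using \<mu>_le True by (rule mult_left_mono)
    also have "\<dots> \<le> (3 * real k - real n - 1) * L + 3 * real d * (3 * real d * K)"
    proof -
      have "(3 * real k - real n - 1) * (3 * real d * K) \<le> (3 * real d) * (3 * real d * K)"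
        using k(2) K by (intro mult_right_mono) auto
      then show ?thesis by (simp add: algebra_simps)
    qed
    finally have "(3 * real k - real n - 1) * \<mu> + (real d - \<eta> - 2 * real k) * L \<le>
       (real k + real d - real n - 1) * L - \<eta> * L + 9 * (real d)\<^sup>2 * K" by (simp add: algebra_simps power2_eq_square)
    moreover have "(real k + real d - real n - 1) * L \<le> 0" using n k(2) L by (intro mult_nonpos_nonneg) auto
    ultimately show ?thesis by argo
  next
    case False
    then have "(3 * real k - real n - 1) * \<mu> \<le> 0" using \<mu>_nonneg by (intro mult_nonpos_nonneg) auto
    moreover have "(real d - 2 * real k) * L \<le> 0" using assms(1) L by (intro mult_nonpos_nonneg) auto
    moreover have "0 \<le> 9 * (real d)\<^sup>2 * K" using K by simp
    ultimately show ?thesis by (simp add: algebra_simps)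
  qed
  have "1 \<le> real d" using r r_le_k k(2) by simp
  then have "1 * (real d * K) \<le> real d * (real d * K)" using K by (intro mult_right_mono) auto
  then have "K * (3 * real d) \<le> 3 * (real d)\<^sup>2 * K" by (simp add: algebra_simps power2_eq_square)
  then show "(\<Sum>i<r. ?c i) \<le> - \<eta> * L + 12 * (real d)\<^sup>2 * K" using sum_le L_le K_le main by argo
qed

text \<open>The left-hand side is the logarithm of the cost in \<open>coverable_near_roots\<close>
  with the radius of \<open>near_root_of_small_value\<close>. After summation and
  \<open>\<mu>_le\<close> the coefficient of \<open>L\<close> is
  \<open>k + 1 - s * (n + 2 - 2 * k)\<close>, at most \<open>- 1 / 2\<close> because
  \<open>1 / 2 \<le> s\<close>, \<open>2 * k + 1 \<le> d\<close> and
  \<open>2 * d \<le> n + 1\<close>.\<close>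

lemma small_value_factor:
  assumes "2 * k < d"
  shows "\<exists>i<r. (real (kk i) + 1) * m i + s * (u i + (2 * real (kk i) - 1) * m i) \<le> - (1 / 2 / real d) * L + 13 * (real d)\<^sup>2 * K"
proof (rule exists_le_average_decay[OF r])
  show "r \<le> d" using r_le_k k(2) by simp
  show "0 \<le> 13 * (real d)\<^sup>2 * K" using K by simp
  let ?c = "\<lambda>i. (real (kk i) + 1) * m i + s * (u i + (2 * real (kk i) - 1) * m i)"
  have "?c i \<le> (real k + 1 + s * (2 * real k - 1)) * m i + s * u i" if "i < r" for i
  proof -
    have "real (kk i) + 1 + s * (2 * real (kk i) - 1) \<le> real k + 1 + s * (2 * real k - 1)"
      using kk_le[OF that] s by (intro add_mono mult_left_mono) auto
    then have "(real (kk i) + 1 + s * (2 * real (kk i) - 1)) * m i \<le> (real k + 1 + s * (2 * real k - 1)) * m i"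
      using m[OF that] by (intro mult_right_mono)
    then show ?thesis by (simp add: algebra_simps)
  qed
  then have "(\<Sum>i<r. ?c i) \<le> (\<Sum>i<r. (real k + 1 + s * (2 * real k - 1)) * m i + s * u i)" by (intro sum_mono) auto
  also have "\<dots> = (real k + 1 + s * (2 * real k - 1)) * \<mu> + s * p"
    unfolding p \<mu> by (simp add: sum.distrib sum_distrib_left)
  also have "\<dots> \<le> (real k + 1 + s * (2 * real k - 1)) * \<mu> + s * (K + \<mu> - (real n + 2) * L)"
    using mult_left_mono[OF P, of s] s by simp
  also have "\<dots> = (real k + 1 + s * 2 * real k) * \<mu> + s * K - s * (real n + 2) * L" by (simp add: algebra_simps)
  also have "\<dots> \<le> (real k + 1 + s * 2 * real k) * (L + 3 * real d * K) + K - s * (real n + 2) * L"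
  proof -
    have "(real k + 1 + s * 2 * real k) * \<mu> \<le> (real k + 1 + s * 2 * real k) * (L + 3 * real d * K)"
      using \<mu>_le s by (intro mult_left_mono) auto
    moreover have "s * K \<le> 1 * K" using s K by (intro mult_right_mono) auto
    ultimately show ?thesis by simp
  qed
  also have "\<dots> = (real k + 1 - s * (real n + 2 - 2 * real k)) * L + ((real k + 1 + s * 2 * real k) * (3 * real d) + 1) * K"
    by (simp add: algebra_simps)
  also have "\<dots> \<le> (- (1 / 2)) * L + (13 * (real d)\<^sup>2) * K"
  proof (intro add_mono mult_right_mono)
    have "1 / 2 * (real n + 2 - 2 * real k) \<le> s * (real n + 2 - 2 * real k)" using s n k(2) by (intro mult_right_mono) auto
    moreover have "2 * real d \<le> real n + 1" "2 * real k + 1 \<le> real d" using n assms by linarith+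
    ultimately show "real k + 1 - s * (real n + 2 - 2 * real k) \<le> - (1 / 2)" by argo
    have "s * (2 * real k) \<le> 1 * (2 * real k)" using s by (intro mult_right_mono) auto
    then have "(real k + 1 + s * 2 * real k) * (3 * real d) \<le> (3 * real d + 1) * (3 * real d)"
      using k(2) by (intro mult_right_mono) (auto simp: mult.assoc)
    from add_right_mono[OF this, of 1] show "(real k + 1 + s * 2 * real k) * (3 * real d) + 1 \<le> 13 * (real d)\<^sup>2"
    proof (rule order_trans)
      have d1: "1 \<le> real d" using r r_le_k k(2) by simp
      then have "real d * 1 \<le> real d * real d" by (intro mult_left_mono) auto
      then show "(3 * real d + 1) * (3 * real d) + 1 \<le> 13 * (real d)\<^sup>2"
        using d1 unfolding power2_eq_square distrib_right mult_1_left mult_1_right by argo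
    qed
  qed (use K L in auto)
  finally show "(\<Sum>i<r. ?c i) \<le> - (1 / 2) * L + 13 * (real d)\<^sup>2 * K" .
qed (use L in auto)

end

subsection \<open>From good denominators to irreducible factors\<close>

lemma poly_of_int_real: "poly (of_int_poly P) (complex_of_real x) = complex_of_real (\<Sum>i\<le>degree P. real_of_int (coeff P i) * x ^ i)"
  by (simp add: poly_altdef)

lemma pval_altdef: "pval P x = \<bar>\<Sum>i\<le>degree P. real_of_int (coeff P i) * x ^ i\<bar>"
  unfolding poly_of_int_real norm_of_real ..

lemma pval_mult: "pval (P * Q) x = pval P x * pval Q x"
  by (simp add: hom_distribs norm_mult)

lemma pval_prod_list: "pval (prod_list ps) x = (\<Prod>p\<leftarrow>ps. pval p x)"
  by (induction ps) (simp_all add: pval_mult)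

lemma mahler_measure_1: "mahler_measure 1 = 1"
proof -
  have "mahler_measure_poly [:1:] = 1" by (subst mahler_measure_constant) simp
  then show ?thesis by (simp add: mahler_measure_def flip: one_pCons)
qed

lemma mahler_prod_list: "mahler_measure (prod_list ps) = (\<Prod>p\<leftarrow>ps. mahler_measure p)"
  by (induction ps) (simp_all add: mahler_measure_mult mahler_measure_1)

lemma ln_prod_list_nth:
  assumes "\<And>i. i < length xs \<Longrightarrow> 0 < f (xs ! i)"
  shows "ln (\<Prod>x\<leftarrow>xs. f x) = (\<Sum>i<length xs. ln (f (xs ! i) :: real))"
proof -
  have "(\<Prod>x\<leftarrow>xs. f x) = (\<Prod>i<length xs. f (xs ! i))"
    by (simp add: prod.list_conv_set_nth atLeast0LessThan)
  also have "ln \<dots> = (\<Sum>i<length xs. ln (f (xs ! i)))" by (rule ln_prod) (use assms in force)+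
  finally show ?thesis .
qed

lemma degree_prod_list_nth:
  assumes "\<And>p. p \<in> set ps \<Longrightarrow> p \<noteq> (0 :: int poly)"
  shows "degree (prod_list ps) = (\<Sum>i<length ps. degree (ps ! i))"
proof -
  have "degree (prod_list ps) = (\<Sum>p\<leftarrow>ps. degree p)"
    using assms
  proof (induction ps)
    case (Cons a ps)
    then have "a \<noteq> 0" "prod_list ps \<noteq> 0" by (auto simp: prod_list_zero_iff)
    then show ?case using Cons by (simp add: degree_mult_eq)
  qed simp
  then show ?thesis by (simp add: sum_list_sum_nth atLeast0LessThan)
qed

text \<open>Started at \<open>0\<close>, such a sequence only accumulates errors and stays below
  \<open>(R + 1) ^ N * e < 1\<close> on the window, so all its integer terms there would
  vanish.\<close>

lemma nonzero_approximant_start: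
  fixes b :: "nat \<Rightarrow> int"
  assumes "\<And>l. l < N \<Longrightarrow> \<bar>real_of_int (b (Suc l)) - x * real_of_int (b l)\<bar> \<le> e"
    and "\<bar>x\<bar> \<le> R" "0 \<le> e" "(R + 1) ^ N * e < 1" "l \<le> N" "b l \<noteq> 0"
  shows "b 0 \<noteq> 0"
proof
  assume b0: "b 0 = 0"
  have R: "0 \<le> R" using assms(2) by linarith
  have "\<bar>real_of_int (b j)\<bar> \<le> ((R + 1) ^ j - 1) * e + (if j = 0 then 0 else e)" if "j \<le> N" for j
    using that
  proof (induction j)
    case (Suc j)
    have "\<bar>real_of_int (b (Suc j))\<bar> \<le> \<bar>x\<bar> * \<bar>real_of_int (b j)\<bar> + e"
      using assms(1)[of j] Suc.prems by (auto simp: abs_mult[symmetric])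
    also have "\<dots> \<le> R * ((R + 1) ^ j * e) + e"
    proof (intro add_mono mult_mono assms(2))
      show "\<bar>real_of_int (b j)\<bar> \<le> (R + 1) ^ j * e"
        using Suc assms(3) by (cases "j = 0") (auto simp: algebra_simps b0)
    qed (use R in auto)
    also have "\<dots> \<le> (R + 1) ^ Suc j * e"
      using mult_right_mono[of 1 "(R + 1) ^ j" e] R assms(3) by (simp add: algebra_simps)
    finally show ?case by (simp add: algebra_simps)
  qed (simp add: b0)
  from this[OF assms(5)] have "\<bar>real_of_int (b l)\<bar> \<le> (R + 1) ^ l * e"
    using assms(3) R by (auto simp: algebra_simps split: if_splits intro: order_trans)
  also have "\<dots> \<le> (R + 1) ^ N * e" using R assms by (intro mult_right_mono power_increasing) auto
  finally show False using assms(4,6) by linarith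
qed

text \<open>The final inequalities below say that covering all points of the same dyadic type by balls around
  the roots of \<open>p\<close>, respectively around the quotients \<open>b 1 / b 0\<close>, costs at most \<open>q powr (- \<eta>)\<close> up to logarithms.\<close>
definition near_root_data :: "nat \<Rightarrow> real \<Rightarrow> real \<Rightarrow> real \<Rightarrow> real \<Rightarrow> real \<Rightarrow> bool" where
  "near_root_data d s C \<eta> x q \<longleftrightarrow> (\<exists>p. irreducible p \<and> 1 \<le> degree p \<and> degree p \<le> d \<and> mahler_measure p \<le> C * q \<and>
     (pval p x = 0 \<or> (real (degree p) + 1) * ln (mahler_measure p) + s * (ln (pval p x) + (2 * real (degree p) - 1) * ln (mahler_measure p))
        \<le> C - \<eta> * ln q))"

definition near_approximant_data :: "nat \<Rightarrow> nat \<Rightarrow> real \<Rightarrow> real \<Rightarrow> real \<Rightarrow> real \<Rightarrow> real \<Rightarrow> bool" where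
  "near_approximant_data n d s C \<eta> x q \<longleftrightarrow> (\<exists>p b g e. irreducible p \<and> content p = 1 \<and> 1 \<le> degree p \<and> degree p \<le> d \<and>
     mahler_measure p \<le> C * q \<and> 1 \<le> g \<and> g \<le> n + 1 \<and> recurs p b (2 * degree p - 2 + g) \<and> b 0 \<noteq> 0 \<and>
     \<bar>real_of_int (b 0)\<bar> \<le> C * q ^ 2 \<and> 0 < e \<and> e \<le> 1 \<and> 1 / (C * q ^ 2) \<le> e \<and>
     (\<forall>l < 2 * degree p - 2 + g. \<bar>real_of_int (b (Suc l)) - x * real_of_int (b l)\<bar> \<le> e) \<and>
     (real (degree p) + 1 - real g) * ln (mahler_measure p) + (1 - s) * ln \<bar>real_of_int (b 0)\<bar> + (real (degree p) - 1 + s) * ln e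
        \<le> C - \<eta> * ln q)"

text \<open>Applying the cofactor of an irreducible factor of the minimal relation gives
  an integer sequence that is annihilated by this factor.\<close>
lemma cofactor_approximant:
  fixes a :: "nat \<Rightarrow> int" and x q e0 :: real
  assumes P: "p * T = P" "recurs P a n" "degree P \<le> d" "p \<noteq> 0" "T \<noteq> 0" "1 \<le> degree p" and T: "\<not> recurs T a n"
    and n: "2 * d \<le> n + 1" and x: "\<bar>x\<bar> \<le> R"
    and a: "\<And>l. l \<le> n \<Longrightarrow> \<bar>real_of_int (a l) - x ^ l * q\<bar> \<le> e0"
      "\<And>l. l < n \<Longrightarrow> \<bar>real_of_int (a (Suc l)) - x * real_of_int (a l)\<bar> \<le> e0" "0 \<le> e0"
    and small: "(R + 1) ^ n * (real (d + 1) * 2 ^ d * mahler_measure T * e0) \<le> 1 / 2"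
  defines "b \<equiv> shift_act T a" and "e \<equiv> real (d + 1) * 2 ^ d * mahler_measure T * e0"
  shows "\<exists>g. g = n + 2 - degree P - degree p \<and> 1 \<le> g \<and> degree P + degree p \<le> n + 1 \<and> recurs p b (2 * degree p - 2 + g) \<and> b 0 \<noteq> 0 \<and>
     (\<forall>l < 2 * degree p - 2 + g. \<bar>real_of_int (b (Suc l)) - x * real_of_int (b l)\<bar> \<le> e) \<and>
     \<bar>real_of_int (b 0)\<bar> \<le> 2 * \<bar>q\<bar> * pval T x"
proof -
  have degP: "degree P = degree p + degree T" using P by (metis degree_mult_eq)
  define g where "g = n + 2 - degree P - degree p"
  have le: "degree P + degree p \<le> n + 1" using degP P(3) n by linarith
  have degT: "degree T \<le> n" using le degP P(6) by linarith
  \<comment> \<open>The cofactor uses up \<open>degree T\<close> terms of \<open>a\<close>, so the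
    window of \<open>b\<close> is \<open>n - degree T\<close>; \<open>g\<close> is what remains of
    it beyond the \<open>2 * degree p - 2\<close> of the Hankel determinant.\<close>
  have g: "1 \<le> g" "2 * degree p - 2 + g = n - degree T" using le degP P(6) by (auto simp: g_def)
  have R: "0 \<le> R" using x by linarith
  have mT: "0 \<le> mahler_measure T" by (rule mahler_measure_ge_0)
  have cT: "\<bar>real_of_int (coeff T i)\<bar> \<le> 2 ^ d * mahler_measure T" for i
  proof -
    have "\<bar>real_of_int (coeff T i)\<bar> \<le> 2 ^ degree T * mahler_measure T" by (rule abs_coeff_le_mahler)
    also have "\<dots> \<le> 2 ^ d * mahler_measure T" using degP P(3) mT by (intro mult_right_mono power_increasing) auto
    finally show ?thesis .
  qed
  have sum_e: "\<bar>\<Sum>i\<le>degree T. real_of_int (coeff T i) * v i\<bar> \<le> e" if "\<And>i. i \<le> degree T \<Longrightarrow> \<bar>v i\<bar> \<le> e0" for v :: "nat \<Rightarrow> real"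
  proof -
    have "\<bar>\<Sum>i\<le>degree T. real_of_int (coeff T i) * v i\<bar> \<le> real (degree T + 1) * (2 ^ d * mahler_measure T) * e0"
      using that a(3) cT by (rule abs_poly_pairing_le)
    also have "\<dots> \<le> real (d + 1) * (2 ^ d * mahler_measure T) * e0"
      using degP P(3) mT a(3) by (intro mult_right_mono) auto
    finally show ?thesis by (simp add: e_def mult.assoc)
  qed
  have e0: "0 \<le> e" unfolding e_def using mT a(3) by simp
  have step: "\<bar>real_of_int (b (Suc l)) - x * real_of_int (b l)\<bar> \<le> e" if "l < n - degree T" for l
  proof -
    have "real_of_int (b (Suc l)) - x * real_of_int (b l) =
       (\<Sum>i\<le>degree T. real_of_int (coeff T i) * (real_of_int (a (Suc (l + i))) - x * real_of_int (a (l + i))))"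
      by (simp add: b_def shift_act_def poly_pairing_def algebra_simps sum_subtractf sum_distrib_left)
    then show ?thesis using that a(2) by (simp only:) (intro sum_e, auto)
  qed
  have rec: "recurs p b (n - degree T)"
    unfolding recurs_def b_def
  proof (intro allI impI)
    fix l assume "l + degree p \<le> n - degree T"
    then have "l + degree P \<le> n" using degP degT by linarith
    then have "shift_act P a l = 0" using P(2) by (simp add: recurs_def)
    then show "shift_act p (shift_act T a) l = 0" unfolding P(1)[symmetric] shift_act_mult .
  qed
  obtain l where l: "l + degree T \<le> n" "b l \<noteq> 0" using T by (auto simp: recurs_def b_def)
  have "(R + 1) ^ (n - degree T) * e \<le> (R + 1) ^ n * e" using R e0 by (intro mult_right_mono power_increasing) auto
  then have e_small: "(R + 1) ^ (n - degree T) * e < 1" "e \<le> 1 / 2"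
  proof -
    have s: "(R + 1) ^ n * e \<le> 1 / 2" using small by (simp only: e_def)
    moreover have "1 * e \<le> (R + 1) ^ n * e" using R e0 by (intro mult_right_mono one_le_power) auto
    ultimately show "e \<le> 1 / 2" by linarith
    assume "(R + 1) ^ (n - degree T) * e \<le> (R + 1) ^ n * e"
    then show "(R + 1) ^ (n - degree T) * e < 1" using s by linarith
  qed
  have b0: "b 0 \<noteq> 0"
    by (rule nonzero_approximant_start[where b = b, OF step x e0 e_small(1), of l]) (use l in auto)
  \<comment> \<open>\<open>b 0\<close> is \<open>q\<close> times the value of \<open>T\<close> at
    \<open>x\<close> up to an error \<open>e \<le> 1 / 2\<close>. As a nonzero integer it is at
    least twice this error, which can therefore be absorbed by doubling the main term.\<close>
  have "real_of_int (b 0) - q * (\<Sum>i\<le>degree T. real_of_int (coeff T i) * x ^ i) =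
     (\<Sum>i\<le>degree T. real_of_int (coeff T i) * (real_of_int (a i) - x ^ i * q))"
    by (simp add: b_def shift_act_def poly_pairing_def algebra_simps sum_subtractf sum_distrib_left)
  also have "\<bar>\<dots>\<bar> \<le> e" by (rule sum_e) (use a(1) degP P(3) n in auto)
  finally have "\<bar>real_of_int (b 0)\<bar> \<le> \<bar>q\<bar> * pval T x + e" unfolding pval_altdef by (simp add: abs_mult[symmetric])
  moreover have "1 \<le> \<bar>real_of_int (b 0)\<bar>" using b0 by simp
  ultimately have "\<bar>real_of_int (b 0)\<bar> \<le> 2 * \<bar>q\<bar> * pval T x" using e_small(2) by linarith
  then show ?thesis using g le rec b0 step by (intro exI[of _ g]) (simp add: g_def)
qed

text \<open>The pigeonhole gives a relation for \<open>a 0, ..., a d\<close> only. It extends to the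
  whole window because its coefficients are \<open>O(q powr (1 / d))\<close>, the errors are
  \<open>O(c0 * \<delta>)\<close>, and \<open>c0\<close> pushes the product below \<open>1\<close>.
  Minimality is taken among all relations with the same Mahler bound, so that it applies to the
  cofactors.\<close>

lemma minimal_relation_exists:
  fixes a :: "nat \<Rightarrow> int" and x q \<delta> :: real
  assumes n: "1 \<le> d" "d \<le> n" and x: "\<bar>x\<bar> \<le> R" and q: "1 \<le> q" "real_of_int (a 0) = q"
    and A0: "A0 = (R + 1) ^ n + 1" and Y: "Y = 8 * real (d + 1) * A0"
    and a: "\<And>l. l \<le> n \<Longrightarrow> \<bar>real_of_int (a l) - x ^ l * q\<bar> \<le> c0 * \<delta>"
    and c0: "0 < c0" "c0 \<le> 1" "real (d + 1) * Y * A0 * c0 < 1" and \<delta>: "0 < \<delta>" "\<delta> \<le> 1" "q powr (1 / real d) * \<delta> \<le> 1"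
  shows "\<exists>P. content P = 1 \<and> 1 \<le> degree P \<and> degree P \<le> d \<and> mahler_measure P \<le> real (d + 1) * Y * q powr (1 / real d) \<and> recurs P a n \<and>
    (\<forall>T. content T = 1 \<longrightarrow> degree T < degree P \<longrightarrow> mahler_measure T \<le> real (d + 1) * Y * q powr (1 / real d) \<longrightarrow> \<not> recurs T a n)"
    and "\<And>l i. l + i \<le> n \<Longrightarrow> \<bar>real_of_int (a (l + i)) - x ^ l * real_of_int (a i)\<bar> \<le> A0 * c0 * \<delta>"
proof -
  have R: "0 \<le> R" using x by linarith
  have xl: "\<bar>x ^ l\<bar> \<le> (R + 1) ^ n" if "l \<le> n" for l
  proof -
    have "\<bar>x\<bar> ^ l \<le> (R + 1) ^ l" using x by (intro power_mono) auto
    also have "\<dots> \<le> (R + 1) ^ n" using that R by (intro power_increasing) auto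
    finally show ?thesis by (simp add: power_abs)
  qed
  have A1: "1 \<le> A0" unfolding A0 using R by simp
  have c\<delta>: "0 \<le> c0 * \<delta>" "c0 * \<delta> \<le> 1" using c0 \<delta> by (auto simp: mult_le_one)
  have aq: "\<bar>real_of_int (a l)\<bar> \<le> A0 * q" if "l \<le> n" for l
  proof -
    have "\<bar>x ^ l * q\<bar> \<le> (R + 1) ^ n * q" using xl[OF that] q(1) by (simp add: abs_mult)
    moreover have "c0 * \<delta> \<le> q" using c\<delta> q(1) by linarith
    ultimately show ?thesis using a[OF that] unfolding A0 distrib_right mult_1_left by linarith
  qed
  show diff: "\<bar>real_of_int (a (l + i)) - x ^ l * real_of_int (a i)\<bar> \<le> A0 * c0 * \<delta>" if "l + i \<le> n" for l i
  proof -
    have "real_of_int (a (l + i)) - x ^ l * real_of_int (a i) =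
       (real_of_int (a (l + i)) - x ^ (l + i) * q) - x ^ l * (real_of_int (a i) - x ^ i * q)"
      by (simp add: power_add algebra_simps)
    also have "\<bar>\<dots>\<bar> \<le> c0 * \<delta> + (R + 1) ^ n * (c0 * \<delta>)"
    proof (rule order_trans[OF abs_triangle_ineq4 add_mono])
      show "\<bar>x ^ l * (real_of_int (a i) - x ^ i * q)\<bar> \<le> (R + 1) ^ n * (c0 * \<delta>)"
        unfolding abs_mult using xl[of l] a[of i] that R by (intro mult_mono) auto
    qed (use a[OF that] in simp)
    finally show ?thesis by (simp add: A0 algebra_simps)
  qed
  let ?y = "q powr (1 / real d)"
  have y: "1 \<le> ?y" using q(1) by (intro ge_one_powr_ge_zero) auto
  have Aq: "1 \<le> A0 * q" using A1 q(1) by (rule mult_ge1_I)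
  obtain G where G: "G \<noteq> 0" "degree G \<le> d" "poly_pairing G a = 0"
    and cG: "\<And>i. \<bar>real_of_int (coeff G i)\<bar> \<le> 2 * (4 * real (d + 1) * (A0 * q)) powr (1 / real d)"
    using pigeonhole_relation[OF n(1) Aq, of a] aq n(2) by auto
  have "2 * (4 * real (d + 1) * (A0 * q)) powr (1 / real d) = 2 * (4 * real (d + 1) * A0) powr (1 / real d) * ?y"
    using A1 q(1) by (simp add: powr_mult[symmetric] mult.assoc)
  also have "\<dots> \<le> 2 * (4 * real (d + 1) * A0) powr 1 * ?y"
  proof -
    have "1 * 1 \<le> 4 * real (d + 1) * A0" using A1 by (intro mult_mono) auto
    then show ?thesis using n(1) by (intro mult_right_mono mult_left_mono powr_mono) auto
  qed
  also have "\<dots> = Y * ?y" using A1 by (simp add: Y)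
  finally have cG': "\<bar>real_of_int (coeff G i)\<bar> \<le> Y * ?y" for i using cG[of i] by linarith
  have Y0: "0 \<le> Y" using A1 by (simp add: Y)
  have "recurs G a n"
  proof (rule recurs_of_small[OF G(3) diff _ cG'])
    show "0 \<le> A0 * c0 * \<delta>" using A1 c0 \<delta> by simp
    have "real (degree G + 1) * (Y * ?y) * (A0 * c0 * \<delta>) \<le> real (d + 1) * (Y * ?y) * (A0 * c0 * \<delta>)"
      using G(2) Y0 A1 c0 \<delta> by (intro mult_right_mono) auto
    also have "\<dots> = (real (d + 1) * Y * A0 * c0) * (?y * \<delta>)" by (simp add: mult_ac)
    also have "\<dots> \<le> (real (d + 1) * Y * A0 * c0) * 1" using Y0 A1 c0 \<delta>(3) by (intro mult_left_mono) auto
    also have "\<dots> < 1" using c0 by simp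
    finally show "real (degree G + 1) * (Y * ?y) * (A0 * c0 * \<delta>) < 1" .
  qed
  moreover have "mahler_measure G \<le> real (d + 1) * Y * ?y"
  proof -
    have "mahler_measure G \<le> (\<Sum>i\<le>degree G. \<bar>real_of_int (coeff G i)\<bar>)" by (rule mahler_measure_le_sum_coeffs)
    also have "\<dots> \<le> (\<Sum>i\<le>degree G. Y * ?y)" using cG' by (intro sum_mono) auto
    also have "\<dots> = real (degree G + 1) * (Y * ?y)" by simp
    also have "\<dots> \<le> real (d + 1) * (Y * ?y)" using G(2) Y0 by (intro mult_right_mono) auto
    finally show ?thesis by simp
  qed
  moreover have "a 0 \<noteq> 0" using q by auto
  ultimately show "\<exists>P. content P = 1 \<and> 1 \<le> degree P \<and> degree P \<le> d \<and> mahler_measure P \<le> real (d + 1) * Y * q powr (1 / real d) \<and> recurs P a n \<and>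
    (\<forall>T. content T = 1 \<longrightarrow> degree T < degree P \<longrightarrow> mahler_measure T \<le> real (d + 1) * Y * q powr (1 / real d) \<longrightarrow> \<not> recurs T a n)"
    using minimal_relation[OF G(1,2)] n(2) by blast
qed

text \<open>There are finitely many pairs of a degree and a \<open>g\<close>, so one constant serves
  for all; logarithms turn \<open>mahler_measure_power_le_approximant\<close> into the assumption
  \<open>mahler\<close> of \<open>factor_logs\<close>.\<close>

lemma ln_mahler_measure_le_approximant:
  assumes R: "0 \<le> R"
  shows "\<exists>K\<ge>0. \<forall>P b x E g. irreducible (P :: int poly) \<longrightarrow> content P = 1 \<longrightarrow> 1 \<le> degree P \<longrightarrow> degree P \<le> d \<longrightarrow> g \<le> N \<longrightarrow>
    recurs P b (2 * degree P - 2 + g) \<longrightarrow> b 0 \<noteq> 0 \<longrightarrow> \<bar>x\<bar> \<le> R \<longrightarrow> 0 < E \<longrightarrow> E \<le> 1 \<longrightarrow>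
    (\<forall>l < 2 * degree P - 2 + g. \<bar>real_of_int (b (Suc l)) - x * real_of_int (b l)\<bar> \<le> E) \<longrightarrow>
    real g * ln (mahler_measure P) \<le> K + ln \<bar>real_of_int (b 0)\<bar> + (real (degree P) - 1) * ln E"
proof -
  let ?S = "\<lambda>k g C. C \<ge> 1 \<and> (\<forall>P W E b. irreducible (P :: int poly) \<longrightarrow> content P = 1 \<longrightarrow> degree P = k \<longrightarrow> 1 \<le> W \<longrightarrow> 0 \<le> E \<longrightarrow> E \<le> 1 \<longrightarrow>
     b \<in> approximants P (2 * k - 2 + g) R W E \<longrightarrow> mahler_measure P ^ g \<le> C * W * E ^ (k - 1))"
  have "\<forall>k g. \<exists>C :: real. 1 \<le> k \<longrightarrow> ?S k g C"
  proof (intro allI)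
    fix k g
    show "\<exists>C :: real. 1 \<le> k \<longrightarrow> ?S k g C"
    proof (cases "1 \<le> k")
      case True
      from mahler_measure_power_le_approximant[OF this R, of g] show ?thesis by blast
    qed auto
  qed
  then obtain f where f: "\<And>k g. 1 \<le> k \<Longrightarrow> ?S k g (f k g)" by metis
  define K where "K = (\<Sum>k\<in>{1..d}. \<Sum>g\<le>N. ln (f k g))"
  have lnf: "0 \<le> ln (f k g)" if "1 \<le> k" for k g using f[OF that, of g] by simp
  have K: "0 \<le> K" unfolding K_def using lnf by (intro sum_nonneg) auto
  have Kf: "ln (f k g) \<le> K" if "1 \<le> k" "k \<le> d" "g \<le> N" for k g
  proof -
    have "ln (f k g) \<le> (\<Sum>g\<le>N. ln (f k g))" using that lnf by (intro member_le_sum) auto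
    also have "\<dots> \<le> K" unfolding K_def using that lnf by (intro member_le_sum[of k "{1..d}" "\<lambda>k. \<Sum>g\<le>N. ln (f k g)"] sum_nonneg) auto
    finally show ?thesis .
  qed
  have "real g * ln (mahler_measure P) \<le> K + ln \<bar>real_of_int (b 0)\<bar> + (real (degree P) - 1) * ln E"
    if irr: "irreducible (P :: int poly)" and P: "content P = 1" "1 \<le> degree P" "degree P \<le> d" "g \<le> N" and
    r: "recurs P b (2 * degree P - 2 + g)" "b 0 \<noteq> 0" and x: "\<bar>x\<bar> \<le> R" and E: "0 < E" "E \<le> 1" and
    ap: "\<forall>l < 2 * degree P - 2 + g. \<bar>real_of_int (b (Suc l)) - x * real_of_int (b l)\<bar> \<le> E" for P b x E g
  proof -
    let ?N = "2 * degree P - 2 + g"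
    let ?b = "\<lambda>l. if l \<le> ?N then b l else 0"
    let ?W = "\<bar>real_of_int (b 0)\<bar>"
    have W: "1 \<le> ?W" using r(2) by simp
    have "?b \<in> approximants P ?N R ?W E" unfolding approximants_def
    proof (intro CollectI conjI exI[of _ x] allI impI)
      show "recurs P ?b ?N" using r(1) by (rule recurs_truncate)
    qed (use x r ap in auto)
    note mem = this
    have st: "mahler_measure P ^ g \<le> f (degree P) g * ?W * E ^ (degree P - 1)" and f1: "1 \<le> f (degree P) g"
      using conjunct2[OF f[OF P(2), of g], rule_format, OF irr P(1) refl W less_imp_le[OF E(1)] E(2) mem]
        conjunct1[OF f[OF P(2), of g]] by blast+
    have h1: "1 \<le> mahler_measure P" using mahler_measure_ge_1[of P] irr by auto
    have "real g * ln (mahler_measure P) = ln (mahler_measure P ^ g)" using h1 by (simp add: ln_realpow)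
    also have "\<dots> \<le> ln (f (degree P) g * ?W * E ^ (degree P - 1))" using st h1 by (intro ln_mono) auto
    also have "\<dots> = ln (f (degree P) g) + ln ?W + real (degree P - 1) * ln E"
      using f1 W E by (simp add: ln_mult_pos ln_realpow)
    also have "real (degree P - 1) = real (degree P) - 1" using P(2) by simp
    finally show ?thesis using Kf[OF P(2-4)] by linarith
  qed
  then show ?thesis using K by blast
qed

text \<open>The minimal relation and its factors form an instance of \<open>factor_logs\<close>,
  whose two selection lemmas yield the two alternatives. Arguing by contradiction makes all factors
  nonzero at \<open>x\<close>, so that their logarithms are meaningful.\<close>

lemma diophantine_data:
  assumes n: "1 \<le> n" "n \<le> 2 * d" "2 * d \<le> n + 1" and R: "0 \<le> R"
    and s: "1 / 2 \<le> s" "s \<le> 1" "(1 - s) * (real n + 2) < real d"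
  shows "\<exists>c0>0. \<exists>C\<ge>1. \<exists>\<eta>>0. \<forall>x q a. \<bar>x\<bar> \<le> R \<longrightarrow> 1 \<le> q \<longrightarrow> real_of_int (a 0) = q \<longrightarrow>
    (\<forall>l\<le>n. \<bar>real_of_int (a l) - x ^ l * q\<bar> \<le> c0 * q powr (- 2 / real n)) \<longrightarrow>
    near_root_data d s C \<eta> x q \<or> near_approximant_data n d s C \<eta> x q"
proof -
  have d: "1 \<le> d" "d \<le> n" using n by linarith+
  define A0 where "A0 = (R + 1) ^ n + 1"
  define Y where "Y = 8 * real (d + 1) * A0"
  define D where "D = real (d + 1) * 2 ^ d"
  \<comment> \<open>Small enough that \<open>(R + 1) ^ n\<close> times the error of a cofactor
    sequence is at most \<open>1 / 2\<close> for every cofactor whose Mahler measure obeys the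
    pigeonhole bound.\<close>
  define c0 where "c0 = 1 / (2 * (D * A0) * (real (d + 1) * Y) * (R + 1) ^ n)"
  have Rn: "1 \<le> (R + 1) ^ n" using R by simp
  have A0: "1 \<le> A0" unfolding A0_def using Rn by simp
  have Y: "1 \<le> Y"
  proof -
    have "1 * 1 \<le> 8 * real (d + 1) * A0" using A0 by (intro mult_mono) auto
    then show ?thesis by (simp add: Y_def)
  qed
  have D: "1 \<le> D" unfolding D_def by (intro mult_ge1_I one_le_power) auto
  have dY: "1 \<le> real (d + 1) * Y" using Y by (intro mult_ge1_I) auto
  have DA: "1 \<le> D * A0" using D A0 by (rule mult_ge1_I)
  define V where "V = (D * A0) * (real (d + 1) * Y) * (R + 1) ^ n"
  have V: "1 \<le> V" unfolding V_def by (rule mult_ge1_I[OF mult_ge1_I[OF DA dY] Rn])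
  have c0V: "c0 = 1 / (2 * V)" unfolding c0_def V_def by (simp only: mult.assoc)
  have c0: "0 < c0" "c0 \<le> 1" using V unfolding c0V by auto
  have c0_eq: "(R + 1) ^ n * (D * A0 * c0 * (real (d + 1) * Y)) = 1 / 2"
  proof -
    have "(R + 1) ^ n * (D * A0 * c0 * (real (d + 1) * Y)) = V * c0" by (simp only: V_def mult_ac)
    also have "\<dots> = 1 / 2" using V unfolding c0V by simp
    finally show ?thesis .
  qed
  have c0_small: "real (d + 1) * Y * A0 * c0 < 1"
  proof -
    have "1 \<le> (R + 1) ^ n * D" using Rn D by (rule mult_ge1_I)
    then have "1 * (A0 * c0 * (real (d + 1) * Y)) \<le> ((R + 1) ^ n * D) * (A0 * c0 * (real (d + 1) * Y))"
      using A0 c0 dY by (intro mult_right_mono) auto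
    also have "\<dots> = (R + 1) ^ n * (D * A0 * c0 * (real (d + 1) * Y))" by (simp only: mult_ac)
    also have "\<dots> = 1 / 2" by (rule c0_eq)
    finally have h: "1 * (A0 * c0 * (real (d + 1) * Y)) \<le> 1 / 2" .
    have eq: "real (d + 1) * Y * A0 * c0 = 1 * (A0 * c0 * (real (d + 1) * Y))" by (simp only: mult_1_left mult_ac)
    show ?thesis unfolding eq using h by linarith
  qed
  obtain K0 where K0: "K0 \<ge> 0" and mahler: "\<And>P b x E g. irreducible (P :: int poly) \<Longrightarrow> content P = 1 \<Longrightarrow> 1 \<le> degree P \<Longrightarrow> degree P \<le> d \<Longrightarrow> g \<le> n + 1 \<Longrightarrow>
    recurs P b (2 * degree P - 2 + g) \<Longrightarrow> b 0 \<noteq> 0 \<Longrightarrow> \<bar>x\<bar> \<le> R \<Longrightarrow> 0 < E \<Longrightarrow> E \<le> 1 \<Longrightarrow>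
    (\<forall>l < 2 * degree P - 2 + g. \<bar>real_of_int (b (Suc l)) - x * real_of_int (b l)\<bar> \<le> E) \<Longrightarrow>
    real g * ln (mahler_measure P) \<le> K0 + ln \<bar>real_of_int (b 0)\<bar> + (real (degree P) - 1) * ln E"
    using ln_mahler_measure_le_approximant[OF R, of d "n + 1"] by metis
  define c1 where "c1 = D * A0 * c0"
  have c1: "0 < c1" using D A0 c0 by (simp add: c1_def)
  define K where "K = K0 + 1 + \<bar>ln c1\<bar>"
  have K: "0 \<le> K" "ln 2 \<le> K" "ln c1 \<le> K" "K0 \<le> K" using K0 ln_le_minus_one[of 2] by (auto simp: K_def)
  \<comment> \<open>The excess of \<open>s\<close> over the critical exponent, multiplied by
    \<open>n + 2\<close>.\<close>
  define \<eta>0 where "\<eta>0 = real d - (1 - s) * (real n + 2)"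
  have \<eta>0: "0 < \<eta>0" using s(3) by (simp add: \<eta>0_def)
  \<comment> \<open>Averaging over at most \<open>d\<close> factors divides the decay by
    \<open>d\<close>, and \<open>L = ln q / n\<close> divides it by \<open>n\<close>; the entry
    \<open>1 / 2\<close> is the gain in \<open>small_value_factor\<close>.\<close>
  define \<eta> where "\<eta> = min (\<eta>0 / real d / real n) (1 / 2 / real d / real n)"
  have \<eta>: "0 < \<eta>" using \<eta>0 d n by (simp add: \<eta>_def)
  define C where "C = 1 + real (d + 1) * Y + 2 * (D * (R + 1) ^ n) * (real (d + 1) * Y) + 1 / c1 + 13 * (real d)\<^sup>2 * K"
  have Cparts: "1 \<le> C" "real (d + 1) * Y \<le> C" "2 * (D * (R + 1) ^ n) * (real (d + 1) * Y) \<le> C" "1 / c1 \<le> C" "13 * (real d)\<^sup>2 * K \<le> C"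
  proof -
    have "0 \<le> real (d + 1) * Y" "0 \<le> 2 * (D * (R + 1) ^ n) * (real (d + 1) * Y)" "0 \<le> 1 / c1" "0 \<le> 13 * (real d)\<^sup>2 * K"
      using dY D Rn c1 K(1) by auto
    then show "1 \<le> C" "real (d + 1) * Y \<le> C" "2 * (D * (R + 1) ^ n) * (real (d + 1) * Y) \<le> C" "1 / c1 \<le> C" "13 * (real d)\<^sup>2 * K \<le> C"
      unfolding C_def by linarith+
  qed
  have "near_root_data d s C \<eta> x q \<or> near_approximant_data n d s C \<eta> x q"
    if x: "\<bar>x\<bar> \<le> R" and q: "1 \<le> q" "real_of_int (a 0) = q" and a: "\<forall>l\<le>n. \<bar>real_of_int (a l) - x ^ l * q\<bar> \<le> c0 * q powr (- 2 / real n)"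
    for x q and a :: "nat \<Rightarrow> int"
  proof (rule ccontr)
    assume contr: "\<not> (near_root_data d s C \<eta> x q \<or> near_approximant_data n d s C \<eta> x q)"
    define \<delta> where "\<delta> = q powr (- 2 / real n)"
    define L where "L = ln q / real n"
    define X where "X = real (d + 1) * Y * q powr (1 / real d)"
    have L: "0 \<le> L" "ln q = real n * L" using q(1) n by (auto simp: L_def)
    have \<delta>: "0 < \<delta>" "\<delta> \<le> 1" "ln \<delta> = - 2 * L"
    proof -
      show "0 < \<delta>" "ln \<delta> = - 2 * L" using q(1) by (auto simp: \<delta>_def L_def ln_powr)
      have "q powr (- 2 / real n) \<le> q powr 0" using q(1) by (intro powr_mono) auto
      then show "\<delta> \<le> 1" using q(1) by (simp add: \<delta>_def)
    qed
    \<comment> \<open>By \<open>n \<le> 2 * d\<close>, the size \<open>q powr (1 / d)\<close> of the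
      relation does not exceed \<open>1 / \<delta> = q powr (2 / n)\<close>.\<close>
    have q\<delta>: "q powr (1 / real d) * \<delta> \<le> 1"
    proof -
      have "1 / real d + - 2 / real n \<le> 0" using n d by (simp add: field_simps)
      then have "q powr (1 / real d + - 2 / real n) \<le> q powr 0" using q(1) by (intro powr_mono) auto
      then show ?thesis using q(1) unfolding \<delta>_def by (simp add: powr_add[symmetric])
    qed
    have qd: "q powr (1 / real d) \<le> q"
      using powr_mono[of "1 / real d" 1 q] q(1) d by simp
    have q2: "1 / q\<^sup>2 \<le> \<delta>"
    proof -
      have "q powr (- 2) \<le> q powr (- 2 / real n)" using q(1) n by (intro powr_mono) (auto simp: field_simps)
      then show ?thesis using q(1) by (simp add: \<delta>_def powr_minus_divide powr_numeral)
    qed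
    have al: "\<bar>real_of_int (a l) - x ^ l * q\<bar> \<le> c0 * \<delta>" if "l \<le> n" for l using a that by (simp add: \<delta>_def)
    note rel = minimal_relation_exists[where a = a and ?c0.0 = c0 and \<delta> = \<delta>, OF d x q A0_def Y_def al c0 c0_small \<delta>(1,2) q\<delta>]
    obtain P where P: "content P = 1" "1 \<le> degree P" "degree P \<le> d" "mahler_measure P \<le> X" "recurs P a n"
      and Pmin: "\<And>T. content T = 1 \<Longrightarrow> degree T < degree P \<Longrightarrow> mahler_measure T \<le> X \<Longrightarrow> \<not> recurs T a n"
      using rel(1) unfolding X_def by blast
    have diff: "\<bar>real_of_int (a (l + i)) - x ^ l * real_of_int (a i)\<bar> \<le> A0 * c0 * \<delta>" if "l + i \<le> n" for l i
      by (rule rel(2)) (use that in auto)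
    define e0 where "e0 = A0 * c0 * \<delta>"
    have e0: "0 < e0" using A0 c0 \<delta> by (simp add: e0_def)
    have a_e0: "\<bar>real_of_int (a l) - x ^ l * q\<bar> \<le> e0" if "l \<le> n" for l
    proof -
      have "1 * (c0 * \<delta>) \<le> A0 * (c0 * \<delta>)" using A0 c0 \<delta> by (intro mult_right_mono) auto
      then show ?thesis using al[OF that] by (simp add: e0_def mult.assoc)
    qed
    have a_step: "\<bar>real_of_int (a (Suc l)) - x * real_of_int (a l)\<bar> \<le> e0" if "l < n" for l
      using diff[of 1 l] that by (simp add: e0_def)
    obtain ps where ps: "P = prod_list ps" "\<And>p. p \<in> set ps \<Longrightarrow> irreducible p \<and> content p = 1 \<and> 1 \<le> degree p"
      using primitive_factorization[OF P(1,2)] by blast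
    define r where "r = length ps"
    define p where "p i = ps ! i" for i
    define T where "T i = P div p i" for i
    have pi: "irreducible (p i)" "content (p i) = 1" "1 \<le> degree (p i)" "p i \<noteq> 0" if "i < r" for i
      using ps(2)[of "p i"] that by (auto simp: p_def r_def)
    have PT: "p i * T i = P" if "i < r" for i
    proof -
      have "p i dvd P" unfolding ps(1) p_def using that by (intro prod_list_dvd) (simp add: r_def)
      then show ?thesis by (simp add: T_def)
    qed
    have P0: "P \<noteq> 0" using P(2) by auto
    have T0: "T i \<noteq> 0" if "i < r" for i using PT[OF that] P0 by auto
    have conT: "content (T i) = 1" if "i < r" for i
      using content_mult[of "p i" "T i"] PT[OF that] P(1) pi(2)[OF that] by simp
    have degT: "degree (T i) + degree (p i) = degree P" if "i < r" for i
      using PT[OF that] T0[OF that] pi(4)[OF that] by (metis degree_mult_eq add.commute)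
    have mmPT: "mahler_measure P = mahler_measure (p i) * mahler_measure (T i)" if "i < r" for i
      using PT[OF that] mahler_measure_mult by metis
    have mm1: "1 \<le> mahler_measure (p i)" "1 \<le> mahler_measure (T i)" if "i < r" for i
      using mahler_measure_ge_1 pi(4)[OF that] T0[OF that] by auto
    have mm_le: "mahler_measure (p i) \<le> X" "mahler_measure (T i) \<le> X" if "i < r" for i
    proof -
      have "mahler_measure (p i) * 1 \<le> mahler_measure P" "1 * mahler_measure (T i) \<le> mahler_measure P"
        unfolding mmPT[OF that] using mm1[OF that] by (auto intro: mult_mono)
      then show "mahler_measure (p i) \<le> X" "mahler_measure (T i) \<le> X" using P(4) by auto
    qed
    have XC: "X \<le> C * q"
      unfolding X_def using Cparts(2) qd dY q(1) by (intro mult_mono) auto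
    have nrT: "\<not> recurs (T i) a n" if "i < r" for i
      using Pmin[OF conT[OF that] _ mm_le(2)[OF that]] degT[OF that] pi(3)[OF that] by simp
    define b where "b i = shift_act (T i) a" for i
    define e where "e i = c1 * mahler_measure (T i) * \<delta>" for i
    have e_eq: "e i = real (d + 1) * 2 ^ d * mahler_measure (T i) * e0" for i
      by (simp add: e_def c1_def e0_def D_def mult_ac)
    have small: "(R + 1) ^ n * e i \<le> 1 / 2" if "i < r" for i
    proof -
      have "mahler_measure (T i) * \<delta> \<le> (real (d + 1) * Y) * 1"
      proof -
        have "mahler_measure (T i) * \<delta> \<le> X * \<delta>" using mm_le(2)[OF that] \<delta> by (intro mult_right_mono) auto
        also have "\<dots> = (real (d + 1) * Y) * (q powr (1 / real d) * \<delta>)" by (simp add: X_def mult_ac)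
        also have "\<dots> \<le> (real (d + 1) * Y) * 1" using q\<delta> dY by (intro mult_left_mono) auto
        finally show ?thesis .
      qed
      then have "(R + 1) ^ n * c1 * (mahler_measure (T i) * \<delta>) \<le> (R + 1) ^ n * c1 * (real (d + 1) * Y)"
        using Rn c1 by (intro mult_left_mono) auto
      also have "\<dots> = 1 / 2" using c0_eq by (simp add: c1_def mult_ac)
      finally show ?thesis by (simp add: e_def mult_ac)
    qed
    have e_pos: "0 < e i" if "i < r" for i using mm1[OF that] c1 \<delta> by (simp add: e_def)
    have e_le: "e i \<le> 1" if "i < r" for i
      using small[OF that] mult_right_mono[OF Rn, of "e i"] e_pos[OF that] by linarith
    have cof: "\<exists>g. g = n + 2 - degree P - degree (p i) \<and> 1 \<le> g \<and> degree P + degree (p i) \<le> n + 1 \<and> recurs (p i) (b i) (2 * degree (p i) - 2 + g) \<and> b i 0 \<noteq> 0 \<and>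
     (\<forall>l < 2 * degree (p i) - 2 + g. \<bar>real_of_int (b i (Suc l)) - x * real_of_int (b i l)\<bar> \<le> e i) \<and>
     \<bar>real_of_int (b i 0)\<bar> \<le> 2 * \<bar>q\<bar> * pval (T i) x" if "i < r" for i
      unfolding b_def e_eq
      by (rule cofactor_approximant[OF PT[OF that] P(5,3) pi(4)[OF that] T0[OF that] pi(3)[OF that] nrT[OF that] n(3) x a_e0 a_step less_imp_le[OF e0]])
        (use small[OF that] e_eq in auto)
    define g where "g i = n + 2 - degree P - degree (p i)" for i
    have g: "1 \<le> g i" "g i \<le> n + 1" "real (g i) = real n + 2 - real (degree P) - real (degree (p i))"
      "recurs (p i) (b i) (2 * degree (p i) - 2 + g i)" "b i 0 \<noteq> 0"
      "\<forall>l < 2 * degree (p i) - 2 + g i. \<bar>real_of_int (b i (Suc l)) - x * real_of_int (b i l)\<bar> \<le> e i"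
      "\<bar>real_of_int (b i 0)\<bar> \<le> 2 * q * pval (T i) x" if "i < r" for i
    proof -
      have g': "1 \<le> g i \<and> degree P + degree (p i) \<le> n + 1 \<and> recurs (p i) (b i) (2 * degree (p i) - 2 + g i) \<and> b i 0 \<noteq> 0 \<and>
        (\<forall>l < 2 * degree (p i) - 2 + g i. \<bar>real_of_int (b i (Suc l)) - x * real_of_int (b i l)\<bar> \<le> e i) \<and>
        \<bar>real_of_int (b i 0)\<bar> \<le> 2 * \<bar>q\<bar> * pval (T i) x"
        using cof[OF that] unfolding g_def by blast
      then show "1 \<le> g i" "recurs (p i) (b i) (2 * degree (p i) - 2 + g i)" "b i 0 \<noteq> 0"
        "\<forall>l < 2 * degree (p i) - 2 + g i. \<bar>real_of_int (b i (Suc l)) - x * real_of_int (b i l)\<bar> \<le> e i" by blast+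
      show "\<bar>real_of_int (b i 0)\<bar> \<le> 2 * q * pval (T i) x" using g' q(1) by simp
      have le: "degree P + degree (p i) \<le> n + 1" using g' by blast
      then show "real (g i) = real n + 2 - real (degree P) - real (degree (p i))" unfolding g_def by simp
      show "g i \<le> n + 1" using pi(3)[OF that] P(2) unfolding g_def by simp
    qed
    have deg_le: "degree (p i) \<le> d" if "i < r" for i using degT[OF that] P(3) by simp
    \<comment> \<open>If \<open>x\<close> is a root of a factor, \<open>near_root_data\<close> holds
      through its first alternative. With this excluded, the convention \<open>ln 0 = 0\<close>
      cannot falsify the logarithmic inequalities.\<close>
    have nz: "0 < pval (p i) x" if "i < r" for i
    proof (rule ccontr)
      assume "\<not> 0 < pval (p i) x"
      then have "pval (p i) x = 0" by (simp add: less_le)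
      then have "near_root_data d s C \<eta> x q"
        unfolding near_root_data_def using pi[OF that] deg_le[OF that] order_trans[OF mm_le(1)[OF that] XC] by blast
      then show False using contr by blast
    qed
    have pvPT: "pval P x = pval (p i) x * pval (T i) x" if "i < r" for i using PT[OF that] pval_mult by metis
    have pvP: "0 < pval P x" unfolding ps(1) pval_prod_list using nz by (auto simp: p_def r_def prod.list_conv_set_nth intro!: prod_pos)
    have pvT: "0 < pval (T i) x" if "i < r" for i using pvP nz[OF that] unfolding pvPT[OF that] by (simp add: zero_less_mult_iff)
    let ?\<mu> = "ln (mahler_measure P)" and ?p = "ln (pval P x)"
    \<comment> \<open>With constants absorbed in \<open>K\<close>: \<open>w\<close> bounds
      \<open>b i 0\<close> by \<open>q\<close> times the value of the cofactor, \<open>e\<close> is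
      the Mahler measure of the cofactor times \<open>\<delta>\<close>, \<open>P\<close> bounds the
      value of the relation at \<open>x\<close>, and \<open>mahler\<close> is the determinant
      comparison with \<open>g i\<close> spare terms.\<close>
    interpret fl: factor_logs n d "degree P" r s K L ?\<mu> ?p "\<lambda>i. ln (mahler_measure (p i))" "\<lambda>i. ln (pval (p i) x)"
      "\<lambda>i. ln \<bar>real_of_int (b i 0)\<bar>" "\<lambda>i. ln (e i)" "\<lambda>i. degree (p i)"
    proof
      show "1 \<le> r" using P(2) ps(1) by (cases ps) (auto simp: r_def)
      show "degree P = (\<Sum>i<r. degree (p i))"
        unfolding ps(1) r_def p_def by (rule degree_prod_list_nth) (use ps(2) in force)
      show "?\<mu> = (\<Sum>i<r. ln (mahler_measure (p i)))"
        unfolding ps(1) mahler_prod_list r_def p_def using mm1 by (intro ln_prod_list_nth) (force simp: p_def r_def)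
      show "?p = (\<Sum>i<r. ln (pval (p i) x))"
        unfolding ps(1) pval_prod_list r_def p_def using nz by (intro ln_prod_list_nth) (auto simp: p_def r_def)
      show "?p \<le> K + ?\<mu> - (real n + 2) * L"
      proof -
        \<comment> \<open>The recurrence at \<open>0\<close> allows \<open>q * x ^ i\<close> to be
          replaced by the small errors \<open>a i - x ^ i * q\<close>.\<close>
        have "q * (\<Sum>i\<le>degree P. real_of_int (coeff P i) * x ^ i) =
           - (\<Sum>i\<le>degree P. real_of_int (coeff P i) * (real_of_int (a i) - x ^ i * q)) + real_of_int (shift_act P a 0)"
          by (simp add: shift_act_def poly_pairing_def algebra_simps sum_subtractf sum_distrib_left)
        also have "shift_act P a 0 = 0" using P(3,5) d(2) by (simp add: recurs_def)
        finally have qV: "q * (\<Sum>i\<le>degree P. real_of_int (coeff P i) * x ^ i) =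
          - (\<Sum>i\<le>degree P. real_of_int (coeff P i) * (real_of_int (a i) - x ^ i * q))" by simp
        have "q * pval P x = \<bar>q * (\<Sum>i\<le>degree P. real_of_int (coeff P i) * x ^ i)\<bar>"
          unfolding pval_altdef abs_mult using q(1) by simp
        also have "\<dots> = \<bar>\<Sum>i\<le>degree P. real_of_int (coeff P i) * (real_of_int (a i) - x ^ i * q)\<bar>"
          unfolding qV by simp
        also have "\<dots> \<le> real (degree P + 1) * (2 ^ d * mahler_measure P) * e0"
        proof (rule abs_poly_pairing_le)
          show "\<bar>real_of_int (coeff P i)\<bar> \<le> 2 ^ d * mahler_measure P" for i
            using P(3) by (intro order_trans[OF abs_coeff_le_mahler] mult_right_mono power_increasing mahler_measure_ge_0) auto
        qed (use a_e0 P(3) d(2) e0 in auto)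
        also have "\<dots> \<le> real (d + 1) * (2 ^ d * mahler_measure P) * e0"
          using P(3) e0 mahler_measure_ge_0[of P] by (intro mult_right_mono) auto
        also have "\<dots> = c1 * mahler_measure P * \<delta>" by (simp add: c1_def e0_def D_def mult_ac)
        finally have "ln (q * pval P x) \<le> ln (c1 * mahler_measure P * \<delta>)" using q(1) pvP by (intro ln_mono) auto
        moreover have "ln (q * pval P x) = real n * L + ?p" using q(1) pvP L(2) by (simp add: ln_mult_pos)
        moreover have "ln (c1 * mahler_measure P * \<delta>) = ln c1 + ?\<mu> - 2 * L"
          using c1 \<delta> mahler_measure_ge_1[OF P0] by (simp add: ln_mult_pos)
        ultimately show ?thesis using K(3) by (simp add: algebra_simps)
      qed
      fix i assume i: "i < r"
      show "1 \<le> degree (p i)" using pi(3)[OF i] .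
      show "0 \<le> ln (mahler_measure (p i))" using mm1[OF i] by simp
      show "ln \<bar>real_of_int (b i 0)\<bar> \<le> K + real n * L + (?p - ln (pval (p i) x))"
      proof -
        have "ln \<bar>real_of_int (b i 0)\<bar> \<le> ln (2 * q * pval (T i) x)" using g(5,7)[OF i] by (intro ln_mono) auto
        also have "\<dots> = ln 2 + ln q + ln (pval (T i) x)" using q(1) pvT[OF i] by (simp add: ln_mult_pos)
        also have "ln (pval (T i) x) = ?p - ln (pval (p i) x)" unfolding pvPT[OF i] using nz[OF i] pvT[OF i] by (simp add: ln_mult_pos)
        finally show ?thesis using K(2) L(2) by linarith
      qed
      show "ln (e i) \<le> K + ?\<mu> - ln (mahler_measure (p i)) - 2 * L"
      proof -
        have "ln (e i) = ln c1 + ln (mahler_measure (T i)) - 2 * L" unfolding e_def using c1 \<delta> mm1[OF i] by (simp add: ln_mult_pos)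
        moreover have "?\<mu> = ln (mahler_measure (p i)) + ln (mahler_measure (T i))" unfolding mmPT[OF i] using mm1[OF i] by (simp add: ln_mult_pos)
        ultimately show ?thesis using K(3) by linarith
      qed
      show "(real n + 2 - real (degree P) - real (degree (p i))) * ln (mahler_measure (p i)) \<le>
          K + ln \<bar>real_of_int (b i 0)\<bar> + (real (degree (p i)) - 1) * ln (e i)"
        using mahler[OF pi(1-3)[OF i] deg_le[OF i] g(2,4,5)[OF i] x e_pos[OF i] e_le[OF i] g(6)[OF i]] K(4) g(3)[OF i] by simp
    qed (use P(3) n K L s in auto)
    show False
    proof (cases "d \<le> 2 * degree P")
      case True
      obtain i where i: "i < r" and cost: "(real (degree (p i)) + 1 - (real n + 2 - real (degree P) - real (degree (p i)))) * ln (mahler_measure (p i)) +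
         (1 - s) * ln \<bar>real_of_int (b i 0)\<bar> + (real (degree (p i)) - 1 + s) * ln (e i) \<le> - (\<eta>0 / real d) * L + 12 * (real d)\<^sup>2 * K"
        using fl.approximant_factor[OF True less_imp_le[OF \<eta>0]] by (auto simp: \<eta>0_def)
      have "\<eta> * ln q \<le> (\<eta>0 / real d / real n) * ln q" using q(1) by (intro mult_right_mono) (auto simp: \<eta>_def)
      also have "\<dots> = (\<eta>0 / real d) * L" by (simp add: L_def)
      finally have "\<eta> * ln q \<le> (\<eta>0 / real d) * L" .
      moreover have "12 * (real d)\<^sup>2 * K \<le> 13 * (real d)\<^sup>2 * K" using K(1) by (intro mult_right_mono) auto
      moreover have "- (\<eta>0 / real d) * L = - ((\<eta>0 / real d) * L)" by simp
      ultimately have "- (\<eta>0 / real d) * L + 12 * (real d)\<^sup>2 * K \<le> C - \<eta> * ln q" using Cparts(5) by linarith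
      then have cost': "(real (degree (p i)) + 1 - real (g i)) * ln (mahler_measure (p i)) +
         (1 - s) * ln \<bar>real_of_int (b i 0)\<bar> + (real (degree (p i)) - 1 + s) * ln (e i) \<le> C - \<eta> * ln q"
        using cost unfolding g(3)[OF i] by linarith
      have "pval (T i) x \<le> D * (R + 1) ^ n * mahler_measure (T i)"
      proof -
        have dT: "degree (T i) \<le> d" "degree (T i) \<le> n" using degT[OF i] P(3) d(2) by auto
        have "pval (T i) x \<le> real (degree (T i) + 1) * (2 ^ d * mahler_measure (T i)) * (R + 1) ^ n"
          unfolding pval_altdef
        proof (rule abs_poly_pairing_le)
          show "\<bar>real_of_int (coeff (T i) j)\<bar> \<le> 2 ^ d * mahler_measure (T i)" for j
            using dT by (intro order_trans[OF abs_coeff_le_mahler] mult_right_mono power_increasing mahler_measure_ge_0) auto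
          fix j assume "j \<le> degree (T i)"
          have "\<bar>x\<bar> ^ j \<le> (R + 1) ^ j" using x by (intro power_mono) auto
          also have "\<dots> \<le> (R + 1) ^ n" using \<open>j \<le> degree (T i)\<close> dT R by (intro power_increasing) auto
          finally show "\<bar>x ^ j\<bar> \<le> (R + 1) ^ n" by (simp add: power_abs)
        qed (use R in auto)
        also have "\<dots> \<le> real (d + 1) * (2 ^ d * mahler_measure (T i)) * (R + 1) ^ n"
          using dT R mahler_measure_ge_0[of "T i"] by (intro mult_right_mono) auto
        finally show ?thesis by (simp add: D_def mult_ac)
      qed
      also have "\<dots> \<le> D * (R + 1) ^ n * (real (d + 1) * Y * q)"
      proof (intro mult_left_mono)
        have "X \<le> real (d + 1) * Y * q" unfolding X_def using qd dY by (intro mult_left_mono) auto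
        then show "mahler_measure (T i) \<le> real (d + 1) * Y * q" using mm_le(2)[OF i] by linarith
      qed (use D R in auto)
      finally have "2 * q * pval (T i) x \<le> 2 * q * (D * (R + 1) ^ n * (real (d + 1) * Y * q))" using q(1) by (intro mult_left_mono) auto
      also have "\<dots> = (2 * (D * (R + 1) ^ n) * (real (d + 1) * Y)) * q\<^sup>2" by (simp add: power2_eq_square mult_ac)
      also have "\<dots> \<le> C * q\<^sup>2" using Cparts(3) by (intro mult_right_mono) auto
      finally have b0: "\<bar>real_of_int (b i 0)\<bar> \<le> C * q\<^sup>2" using g(7)[OF i] by linarith
      \<comment> \<open>The lower bound for \<open>e i\<close> limits the number of dyadic classes
        of errors.\<close>
      have "1 / (C * q\<^sup>2) \<le> c1 * (1 / q\<^sup>2)"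
      proof -
        have "1 \<le> C * c1" using Cparts(4) c1 by (simp add: divide_le_eq)
        then have "1 / C \<le> c1" using Cparts(1) by (simp add: divide_le_eq mult.commute)
        from mult_right_mono[OF this, of "1 / q\<^sup>2"] show ?thesis by simp
      qed
      also have "\<dots> \<le> c1 * \<delta>" using q2 c1 by (intro mult_left_mono) auto
      also have "\<dots> \<le> e i" unfolding e_def using mm1(2)[OF i] c1 \<delta> by simp
      finally have e_low: "1 / (C * q\<^sup>2) \<le> e i" .
      have "near_approximant_data n d s C \<eta> x q"
        unfolding near_approximant_data_def
        by (rule exI[of _ "p i"], rule exI[of _ "b i"], rule exI[of _ "g i"], rule exI[of _ "e i"])
          (intro conjI pi(1-3)[OF i] deg_le[OF i] order_trans[OF mm_le(1)[OF i] XC] g(1,2,4-6)[OF i] b0 e_pos[OF i] e_le[OF i] e_low cost')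
      then show False using contr by blast
    next
      case False
      then have "2 * degree P < d" by simp
      from fl.small_value_factor[OF this] obtain i where i: "i < r" and cost: "(real (degree (p i)) + 1) * ln (mahler_measure (p i)) +
         s * (ln (pval (p i) x) + (2 * real (degree (p i)) - 1) * ln (mahler_measure (p i))) \<le> - (1 / 2 / real d) * L + 13 * (real d)\<^sup>2 * K"
        by blast
      have "\<eta> * ln q \<le> (1 / 2 / real d / real n) * ln q" using q(1) by (intro mult_right_mono) (auto simp: \<eta>_def)
      also have "\<dots> = (1 / 2 / real d) * L" by (simp add: L_def)
      finally have "\<eta> * ln q \<le> (1 / 2 / real d) * L" .
      moreover have "- (1 / 2 / real d) * L = - ((1 / 2 / real d) * L)" by simp
      ultimately have "- (1 / 2 / real d) * L + 13 * (real d)\<^sup>2 * K \<le> C - \<eta> * ln q" using Cparts(5) by linarith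
      then have "near_root_data d s C \<eta> x q"
        unfolding near_root_data_def using pi[OF i] deg_le[OF i] order_trans[OF mm_le(1)[OF i] XC] order_trans[OF cost] by blast
      then show False using contr by blast
    qed
  qed
  then show ?thesis using c0 Cparts(1) \<eta> by blast
qed

subsection \<open>Dyadic covers\<close>

lemma dyadic_scale:
  fixes y :: real
  assumes "1 \<le> y"
  shows "\<exists>u :: nat. 2 ^ u \<le> y \<and> y \<le> 2 * 2 ^ u \<and> (\<forall>N. y \<le> 2 ^ N \<longrightarrow> u \<le> N)"
proof -
  have "1 \<le> nat \<lfloor>y\<rfloor>" using assms by linarith
  then obtain u where u: "2 ^ u \<le> nat \<lfloor>y\<rfloor>" "nat \<lfloor>y\<rfloor> < 2 ^ (u + 1)"
    using ex_power_ivl1[of 2 "nat \<lfloor>y\<rfloor>"] by auto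
  have "real (2 ^ u) \<le> real (nat \<lfloor>y\<rfloor>)" using u(1) by (simp only: of_nat_le_iff)
  also have "\<dots> \<le> y" using assms by simp
  finally have 1: "2 ^ u \<le> y" by simp
  have "nat \<lfloor>y\<rfloor> + 1 \<le> 2 ^ (u + 1)" using u(2) by simp
  then have "real (nat \<lfloor>y\<rfloor> + 1) \<le> real (2 ^ (u + 1))" by (simp only: of_nat_le_iff)
  moreover have "y \<le> real (nat \<lfloor>y\<rfloor> + 1)" using assms by linarith
  ultimately have 2: "y \<le> 2 * 2 ^ u" by simp
  have "u \<le> N" if "y \<le> 2 ^ N" for N
    using power_le_imp_le_exp[of "2::real" u N] 1 that by linarith
  then show ?thesis using 1 2 by blast
qed

text \<open>Half of the exponential decay absorbs the polynomial factor; the other half is summed as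
  a geometric series.\<close>

lemma summable_poly_geometric:
  assumes "0 < \<eta>"
  shows "summable (\<lambda>j. K * real (j + 1) ^ m * 2 powr (- \<eta> * real j))"
proof -
  define t where "t = \<eta> * ln 2 / 2"
  have t: "0 < t" using assms by (simp add: t_def)
  define M where "M = (real (Suc m) / t) ^ Suc m * exp t"
  have pm: "real (j + 1) ^ m \<le> M * exp (t * real j)" for j
  proof -
    let ?y = "t * real (j + 1) / real (Suc m)"
    have "?y \<le> exp ?y" using exp_ge_add_one_self[of ?y] by linarith
    then have "?y ^ Suc m \<le> exp ?y ^ Suc m" by (rule power_mono) (use t in simp)
    also have "\<dots> = exp (real (Suc m) * ?y)" by (rule exp_of_nat_mult[symmetric])
    also have "real (Suc m) * ?y = t * real (j + 1)" by simp
    finally have "real (j + 1) ^ Suc m * (t / real (Suc m)) ^ Suc m \<le> exp (t * real (j + 1))"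
      by (simp add: power_mult_distrib[symmetric] mult.commute del: power_Suc)
    then have "real (j + 1) ^ Suc m \<le> (real (Suc m) / t) ^ Suc m * exp (t * real (j + 1))"
      using t by (simp add: power_divide field_simps del: power_Suc)
    also have "\<dots> = M * exp (t * real j)" by (simp add: M_def distrib_left exp_add mult_ac)
    finally have "real (j + 1) ^ Suc m \<le> M * exp (t * real j)" .
    moreover have "real (j + 1) ^ m \<le> real (j + 1) ^ Suc m" by (rule power_increasing) auto
    ultimately show ?thesis by linarith
  qed
  have pw: "2 powr (- \<eta> * real j) = exp (- (2 * t) * real j)" for j
    by (simp add: powr_def t_def)
  have "summable (\<lambda>j. \<bar>K\<bar> * M * exp (- t) ^ j)"
    using t by (intro summable_mult summable_geometric) auto
  then show ?thesis
  proof (rule summable_comparison_test'[where N = 0])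
    fix j :: nat
    have "norm (K * real (j + 1) ^ m * 2 powr (- \<eta> * real j)) = \<bar>K\<bar> * real (j + 1) ^ m * exp (- (2 * t) * real j)"
      unfolding pw by (simp add: abs_mult)
    also have "\<dots> \<le> \<bar>K\<bar> * (M * exp (t * real j)) * exp (- (2 * t) * real j)"
      using pm by (intro mult_right_mono mult_left_mono) auto
    also have "\<dots> = \<bar>K\<bar> * M * (exp (t * real j) * exp (- (2 * t) * real j))" by simp
    also have "exp (t * real j) * exp (- (2 * t) * real j) = exp (real j * (- t))"
      by (simp add: exp_add[symmetric] algebra_simps)
    also have "\<dots> = exp (- t) ^ j" by (rule exp_of_nat_mult)
    finally show "norm (K * real (j + 1) ^ m * 2 powr (- \<eta> * real j)) \<le> \<bar>K\<bar> * M * exp (- t) ^ j" .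
  qed
qed

text \<open>Points with data for \<open>q\<close> between \<open>2 ^ j\<close> and
  \<open>2 ^ (j + 1)\<close> are sorted by degree and dyadic size of the Mahler measure:
  \<open>O(j)\<close> classes, each of cost \<open>O(2 powr (- \<eta> * j))\<close>. The threshold
  \<open>j0\<close> makes the values small enough for
  \<open>near_root_of_small_value\<close>.\<close>

lemma near_root_levels:
  assumes C: "1 \<le> C" and \<eta>: "0 < \<eta>" and s: "0 < s" and R: "0 \<le> R"
  shows "\<exists>K m E j0. (\<forall>j. finitely_coverable s (E j) (K * real (j + 1) ^ m * 2 powr (- \<eta> * real j))) \<and>
    (\<forall>j\<ge>j0. \<forall>x q. \<bar>x\<bar> \<le> R \<longrightarrow> 2 ^ j \<le> q \<longrightarrow> q \<le> 2 * 2 ^ j \<longrightarrow> near_root_data d s C \<eta> x q \<longrightarrow> x \<in> E j)"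
proof -
  obtain \<kappa> where \<kappa>: "C \<le> 2 ^ \<kappa>" using real_arch_pow[of 2 C] by (auto intro: less_imp_le)
  let ?S = "\<lambda>k c B. c > 0 \<and> B > 0 \<and> (\<forall>P x. irreducible (P :: int poly) \<longrightarrow> degree P = k \<longrightarrow> \<bar>x\<bar> \<le> R \<longrightarrow>
     pval P x * mahler_measure P ^ (2 * k - 1) < c \<longrightarrow>
     (\<exists>\<alpha>\<in>croots P. cmod (complex_of_real x - \<alpha>) \<le> B * pval P x * mahler_measure P ^ (2 * k - 1)))"
  have "\<forall>k. \<exists>cB :: real \<times> real. 1 \<le> k \<longrightarrow> ?S k (fst cB) (snd cB)"
  proof
    fix k
    show "\<exists>cB :: real \<times> real. 1 \<le> k \<longrightarrow> ?S k (fst cB) (snd cB)"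
    proof (cases "1 \<le> k")
      case True
      from near_root_of_small_value[OF this R] obtain c B where "?S k c B" by blast
      then show ?thesis by (intro exI[of _ "(c, B)"]) simp
    qed auto
  qed
  from choice[OF this] obtain cB where cB: "\<And>k. 1 \<le> k \<Longrightarrow> ?S k (fst (cB k)) (snd (cB k))" by blast
  define B where "B k = snd (cB k)" for k
  have B: "0 < B k" if "1 \<le> k" for k using cB[OF that] by (simp add: B_def)
  \<comment> \<open>The radius is solved from the desired cost: the factor
    \<open>(2 ^ u) ^ (k + 1)\<close> counting polynomials cancels, so the cost of a class does not
    depend on \<open>u\<close>.\<close>
  define y where "y j k u = exp C * 2 powr (- \<eta> * real j) / (2 ^ u) ^ (k + 1)" for j k u :: nat
  define \<rho> where "\<rho> j k u = B k * y j k u powr (1 / s)" for j k u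
  define I where "I j = {1..d} \<times> {..\<kappa> + j + 1}" for j :: nat
  define blk where "blk j t = {x. \<exists>P \<alpha>. irreducible P \<and> 1 \<le> degree P \<and> degree P = fst t \<and> mahler_measure P \<le> 2 * 2 ^ snd t \<and> \<alpha> \<in> croots P \<and>
      cmod (complex_of_real x - \<alpha>) \<le> \<rho> j (fst t) (snd t)}" for j t
  define E where "E j = (\<Union>t\<in>I j. blk j t)" for j
  define H where "H k = real k * (2 ^ (k + 3)) ^ (k + 1) * (2 * B k) powr s * exp C" for k
  define K where "K = (\<Sum>k\<in>{1..d}. H k) * real (\<kappa> + 2)"
  have H: "0 \<le> H k" for k unfolding H_def by simp
  have y: "0 < y j k u" for j k u by (simp add: y_def)
  have cost: "real k * (2 ^ (k + 3) * 2 ^ u) ^ (k + 1) * (2 * \<rho> j k u) powr s = H k * 2 powr (- \<eta> * real j)" if "1 \<le> k" for j k u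
  proof -
    define M :: real where "M = (2 ^ u) ^ (k + 1)"
    have M: "0 < M" by (simp add: M_def)
    have "(2 * \<rho> j k u) powr s = ((2 * B k) * y j k u powr (1 / s)) powr s" by (simp only: \<rho>_def mult.assoc)
    also have "\<dots> = (2 * B k) powr s * y j k u" using s B[OF that] y[of j k u] by (simp add: powr_mult powr_powr)
    also have "y j k u = exp C * 2 powr (- \<eta> * real j) / M" by (simp add: y_def M_def)
    finally show ?thesis unfolding power_mult_distrib M_def[symmetric] H_def using M by simp
  qed
  have "finitely_coverable s (E j) (K * real (j + 1) ^ 1 * 2 powr (- \<eta> * real j))" for j
  proof -
    have "finitely_coverable s (E j) (\<Sum>t\<in>I j. H (fst t) * 2 powr (- \<eta> * real j))"
      unfolding E_def
    proof (rule finitely_coverable_UN)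
      show "finite (I j)" by (simp add: I_def)
      fix t assume "t \<in> I j"
      then have k: "1 \<le> fst t" by (auto simp: I_def)
      have "0 \<le> \<rho> j (fst t) (snd t)" using B[OF k] by (simp add: \<rho>_def)
      from coverable_near_roots[OF _ this, of "2 ^ snd t" s "fst t"] cost[OF k, of "snd t" j]
      show "finitely_coverable s (blk j t) (H (fst t) * 2 powr (- \<eta> * real j))" by (simp add: blk_def)
    qed
    moreover have "(\<Sum>t\<in>I j. H (fst t) * 2 powr (- \<eta> * real j)) \<le> K * real (j + 1) ^ 1 * 2 powr (- \<eta> * real j)"
    proof -
      have "(\<Sum>t\<in>I j. H (fst t) * 2 powr (- \<eta> * real j)) = (\<Sum>k\<in>{1..d}. \<Sum>u\<in>{..\<kappa> + j + 1}. H k * 2 powr (- \<eta> * real j))"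
        unfolding I_def by (subst sum.cartesian_product') simp
      also have "\<dots> = (\<Sum>k\<in>{1..d}. H k) * real (\<kappa> + j + 2) * 2 powr (- \<eta> * real j)"
        unfolding sum_distrib_right by (simp add: mult_ac)
      also have "\<dots> \<le> (\<Sum>k\<in>{1..d}. H k) * (real (\<kappa> + 2) * real (j + 1)) * 2 powr (- \<eta> * real j)"
        using H by (intro mult_right_mono mult_left_mono sum_nonneg) (auto simp: algebra_simps)
      finally show ?thesis by (simp add: K_def mult.assoc)
    qed
    ultimately show ?thesis by (rule finitely_coverable_mono[OF _ order_refl])
  qed
  moreover have "\<exists>j0. \<forall>j\<ge>j0. \<forall>x q. \<bar>x\<bar> \<le> R \<longrightarrow> 2 ^ j \<le> q \<longrightarrow> q \<le> 2 * 2 ^ j \<longrightarrow> near_root_data d s C \<eta> x q \<longrightarrow> x \<in> E j"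
  proof -
    define c where "c = Min (insert 1 ((\<lambda>k. fst (cB k)) ` {1..d}))"
    have c: "0 < c" unfolding c_def using cB by (auto simp: Min_gr_iff)
    have c_le: "c \<le> fst (cB k)" if "1 \<le> k" "k \<le> d" for k
      unfolding c_def using that by (intro Min_le) auto
    \<comment> \<open>Beyond \<open>j0\<close> the cost inequality pushes
      \<open>pval p x * mahler_measure p ^ (2 * degree p - 1)\<close> below the common threshold
      \<open>c\<close>.\<close>
    obtain j0 :: nat where j0: "(C - s * ln c) / (\<eta> * ln 2) < real j0" using reals_Archimedean2 by blast
    have "x \<in> E j" if j: "j0 \<le> j" and x: "\<bar>x\<bar> \<le> R" and q: "2 ^ j \<le> q" "q \<le> 2 * 2 ^ j" and nd: "near_root_data d s C \<eta> x q" for j x q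
    proof -
      obtain p where p: "irreducible p" "1 \<le> degree p" "degree p \<le> d" "mahler_measure p \<le> C * q" and
        cost: "pval p x = 0 \<or> (real (degree p) + 1) * ln (mahler_measure p) + s * (ln (pval p x) + (2 * real (degree p) - 1) * ln (mahler_measure p))
        \<le> C - \<eta> * ln q" using nd unfolding near_root_data_def by blast
      let ?k = "degree p" and ?h = "mahler_measure p"
      have h1: "1 \<le> ?h" using mahler_measure_ge_1[of p] p(1) by auto
      obtain u where u: "2 ^ u \<le> ?h" "?h \<le> 2 * 2 ^ u" "\<And>N. ?h \<le> 2 ^ N \<Longrightarrow> u \<le> N" using dyadic_scale[OF h1] by blast
      have "?h \<le> 2 ^ (\<kappa> + j + 1)"
      proof -
        have "C * q \<le> 2 ^ \<kappa> * (2 * 2 ^ j)" using \<kappa> q C by (intro mult_mono) (auto intro: order_trans[OF _ q(1)])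
        then show ?thesis using p(4) by (simp add: power_add mult_ac)
      qed
      then have uN: "u \<le> \<kappa> + j + 1" by (rule u(3))
      let ?v = "pval p x * ?h ^ (2 * ?k - 1)"
      have q0: "0 < q" using q(1) by (rule less_le_trans[rotated]) simp
      have lnq: "real j * ln 2 \<le> ln q"
        using ln_mono[OF q(1)] by (simp add: ln_realpow)
      have v: "?v < c \<and> ?v \<le> y j ?k u powr (1 / s)"
      proof (cases "pval p x = 0")
        case False
        then have pv: "0 < pval p x" by (simp add: less_le)
        have v0: "0 < ?v" using pv h1 by simp
        have "ln ?v = ln (pval p x) + real (2 * ?k - 1) * ln ?h" using pv h1 by (simp add: ln_mult_pos ln_realpow)
        also have "real (2 * ?k - 1) = 2 * real ?k - 1" using p(2) by (simp add: of_nat_diff)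
        finally have cost': "(real ?k + 1) * ln ?h + s * ln ?v \<le> C - \<eta> * ln q" using cost False by simp
        have "\<eta> * (real j * ln 2) \<le> \<eta> * ln q" using lnq \<eta> by (intro mult_left_mono) auto
        then have cost2: "(real ?k + 1) * ln ?h + s * ln ?v \<le> C - \<eta> * real j * ln 2" using cost' by simp
        have "0 \<le> (real ?k + 1) * ln ?h" using h1 by simp
        then have "s * ln ?v \<le> C - \<eta> * real j * ln 2" using cost2 by linarith
        also have "\<dots> < s * ln c"
        proof -
          have "(C - s * ln c) < real j0 * (\<eta> * ln 2)" using j0 \<eta> by (simp add: divide_less_eq)
          also have "\<dots> \<le> real j * (\<eta> * ln 2)" using j \<eta> by (intro mult_right_mono) auto
          finally show ?thesis by (simp add: mult_ac)
        qed
        finally have "ln ?v < ln c" using s by simp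
        then have 1: "?v < c" using v0 c by simp
        have "real (?k + 1) * ln (2 ^ u) \<le> (real ?k + 1) * ln ?h" using u(1) h1 by (intro mult_mono) auto
        then have "s * ln ?v \<le> C - \<eta> * real j * ln 2 - real (?k + 1) * ln (2 ^ u)" using cost2 by linarith
        also have "\<dots> = ln (y j ?k u)"
          unfolding y_def by (simp add: ln_div ln_mult_pos ln_powr ln_realpow algebra_simps)
        finally have "ln ?v \<le> (1 / s) * ln (y j ?k u)" using s by (simp add: field_simps)
        also have "\<dots> = ln (y j ?k u powr (1 / s))" using y by (simp add: ln_powr)
        finally have "ln ?v \<le> ln (y j ?k u powr (1 / s))" .
        moreover have "0 < y j ?k u powr (1 / s)" using y[of j ?k u] by simp
        ultimately have "?v \<le> y j ?k u powr (1 / s)" using v0 ln_le_cancel_iff by blast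
        then show ?thesis using 1 by blast
      qed (use c in simp)
      have "?v < fst (cB ?k)" using v c_le[OF p(2,3)] by linarith
      then obtain \<alpha> where \<alpha>: "\<alpha> \<in> croots p" "cmod (complex_of_real x - \<alpha>) \<le> B ?k * pval p x * ?h ^ (2 * ?k - 1)"
        using cB[OF p(2)] p(1) x unfolding B_def by blast
      have "B ?k * pval p x * ?h ^ (2 * ?k - 1) \<le> \<rho> j ?k u"
        unfolding \<rho>_def mult.assoc using v B[OF p(2)] by (intro mult_left_mono) auto
      then have "cmod (complex_of_real x - \<alpha>) \<le> \<rho> j ?k u" using \<alpha>(2) by linarith
      then have "x \<in> blk j (?k, u)" unfolding blk_def using p(1,2) u(2) \<alpha>(1) by auto
      moreover have "(?k, u) \<in> I j" using p uN by (simp add: I_def)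
      ultimately show ?thesis unfolding E_def by blast
    qed
    then show ?thesis by blast
  qed
  ultimately show ?thesis by blast
qed

text \<open>Classes are given by degree, \<open>g\<close> and the dyadic sizes of the Mahler
  measure, of \<open>b 0\<close> and of \<open>1 / e\<close>; their number is polynomial in
  \<open>j\<close>. Not every class is cheap, but every class that contains data of the level
  is.\<close>

lemma near_approximant_levels:
  assumes C: "1 \<le> C" and \<eta>: "0 < \<eta>" and s: "0 \<le> s" "s \<le> 1" and R: "0 \<le> R"
  shows "\<exists>K m E. (\<forall>j. finitely_coverable s (E j) (K * real (j + 1) ^ m * 2 powr (- \<eta> * real j))) \<and>
    (\<forall>j x q. \<bar>x\<bar> \<le> R \<longrightarrow> 2 ^ j \<le> q \<longrightarrow> q \<le> 2 * 2 ^ j \<longrightarrow> near_approximant_data n d s C \<eta> x q \<longrightarrow> x \<in> E j)"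
proof -
  obtain \<kappa> where \<kappa>: "C \<le> 2 ^ \<kappa>" using real_arch_pow[of 2 C] by (auto intro: less_imp_le)
  let ?X = "\<lambda>k g U W E. {x. \<bar>x\<bar> \<le> R \<and> (\<exists>P b. irreducible (P :: int poly) \<and> content P = 1 \<and> degree P = k \<and>
        U \<le> mahler_measure P \<and> mahler_measure P \<le> 2 * U \<and> recurs P b (2 * k - 2 + g) \<and> b 0 \<noteq> 0 \<and>
        W \<le> \<bar>real_of_int (b 0)\<bar> \<and> \<bar>real_of_int (b 0)\<bar> \<le> 2 * W \<and>
        (\<forall>l < 2 * k - 2 + g. \<bar>real_of_int (b (Suc l)) - x * real_of_int (b l)\<bar> \<le> E))}"
  let ?w = "\<lambda>k g U W E :: real. U ^ (k + 1) * (W * E ^ (k - 1) / U ^ g) * (E / W) powr s"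
  let ?S = "\<lambda>k g A. A > 0 \<and> (\<forall>U W E. 1 \<le> U \<longrightarrow> 1 \<le> W \<longrightarrow> 0 < E \<longrightarrow> E \<le> 1 \<longrightarrow>
    finitely_coverable s (?X k g U W E) (A * (1 + ln (U * W)) ^ k * (U ^ (k + 1) * (W * E ^ (k - 1) / U ^ g)) * (E / W) powr s))"
  have "\<forall>kg. \<exists>A :: real. 1 \<le> fst kg \<and> 1 \<le> snd kg \<longrightarrow> ?S (fst kg) (snd kg) A"
  proof
    fix kg :: "nat \<times> nat"
    show "\<exists>A :: real. 1 \<le> fst kg \<and> 1 \<le> snd kg \<longrightarrow> ?S (fst kg) (snd kg) A"
    proof (cases "1 \<le> fst kg \<and> 1 \<le> snd kg")
      case True
      then show ?thesis using coverable_near_approximants[of "fst kg" "snd kg" R s] R by blast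
    qed auto
  qed
  from choice[OF this] obtain A where A': "\<forall>kg. 1 \<le> fst kg \<and> 1 \<le> snd kg \<longrightarrow> ?S (fst kg) (snd kg) (A kg)" by (rule exE)
  have A: "?S k g (A (k, g))" if "1 \<le> k" "1 \<le> g" for k g
    using spec[OF A', of "(k, g)"] that unfolding fst_conv snd_conv by blast
  \<comment> \<open>The powers of \<open>2\<close> pay for rounding the Mahler measure and the error
    to powers of \<open>2\<close>.\<close>
  define G where "G = exp (C + (real n + 2 * real d + 4) * ln 2)"
  define M where "M = \<kappa> + 2"
  define I where "I j = ({1..d} \<times> {1..n + 1}) \<times> ({..M * (j + 1)} \<times> {..M * (j + 1)} \<times> {..M * (j + 1)})" for j
  \<comment> \<open>Expensive classes are replaced by the empty set; the cost inequality in the data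
    shows below that no required point is lost.\<close>
  define blk where "blk j t = (case t of ((k, g), (u, w, v)) \<Rightarrow>
     if ?w k g (2 ^ u) (2 ^ w) (1 / 2 ^ v) \<le> G * 2 powr (- \<eta> * real j) then ?X k g (2 ^ u) (2 ^ w) (1 / 2 ^ v) else {})" for j t
  define E where "E j = (\<Union>t\<in>I j. blk j t)" for j
  define \<sigma> where "\<sigma> j t = A (fst t) * (1 + 2 * real (M * (j + 1))) ^ d * (G * 2 powr (- \<eta> * real j))"
    for j and t :: "(nat \<times> nat) \<times> nat \<times> nat \<times> nat"
  define K where "K = (\<Sum>kg\<in>{1..d} \<times> {1..n + 1}. A kg) * (1 + 2 * real M) ^ d * (1 + real M) ^ 3 * G"
  have G: "0 < G" by (simp add: G_def)
  have "finitely_coverable s (E j) (K * real (j + 1) ^ (d + 3) * 2 powr (- \<eta> * real j))" for j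
  proof -
    have "finitely_coverable s (E j) (\<Sum>t\<in>I j. \<sigma> j t)"
      unfolding E_def
    proof (rule finitely_coverable_UN)
      show "finite (I j)" by (simp add: I_def)
      fix t assume t: "t \<in> I j"
      obtain k g u w v where tt: "t = ((k, g), (u, w, v))" by (metis surj_pair)
      have k: "1 \<le> k" "k \<le> d" "1 \<le> g" and uw: "u \<le> M * (j + 1)" "w \<le> M * (j + 1)" using t by (auto simp: I_def tt)
      have Akg: "0 < A (k, g)" using A[OF k(1,3)] by blast
      let ?U = "2 ^ u :: real" and ?W = "2 ^ w :: real" and ?E = "1 / 2 ^ v :: real"
      show "finitely_coverable s (blk j t) (\<sigma> j t)"
      proof (cases "?w k g ?U ?W ?E \<le> G * 2 powr (- \<eta> * real j)")
        case True
        have UWE: "1 \<le> ?U" "1 \<le> ?W" "0 < ?E" "?E \<le> 1" by simp_all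
        have "finitely_coverable s (?X k g ?U ?W ?E) (A (k, g) * (1 + ln (?U * ?W)) ^ k * (?U ^ (k + 1) * (?W * ?E ^ (k - 1) / ?U ^ g)) * (?E / ?W) powr s)"
          by (rule conjunct2[OF A[OF k(1,3)], rule_format, OF UWE])
        moreover have "A (k, g) * (1 + ln (?U * ?W)) ^ k * (?U ^ (k + 1) * (?W * ?E ^ (k - 1) / ?U ^ g)) * (?E / ?W) powr s \<le> \<sigma> j t"
        proof -
          have l: "0 \<le> ln (?U * ?W)" "ln (?U * ?W) \<le> 2 * real (M * (j + 1))"
          proof -
            have "ln (?U * ?W) = (real u + real w) * ln 2" by (simp add: ln_mult_pos ln_realpow algebra_simps)
            moreover have "(real u + real w) * ln 2 \<le> (real u + real w) * 1" using ln_le_minus_one[of "2::real"] by (intro mult_left_mono) auto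
            moreover have "real u \<le> real (M * (j + 1))" "real w \<le> real (M * (j + 1))" using uw by (simp_all only: of_nat_le_iff)
            ultimately show "0 \<le> ln (?U * ?W)" "ln (?U * ?W) \<le> 2 * real (M * (j + 1))" by auto
          qed
          have "(1 + ln (?U * ?W)) ^ k \<le> (1 + 2 * real (M * (j + 1))) ^ k" using l by (intro power_mono) auto
          also have "\<dots> \<le> (1 + 2 * real (M * (j + 1))) ^ d" using k by (intro power_increasing) auto
          finally have pw: "(1 + ln (?U * ?W)) ^ k \<le> (1 + 2 * real (M * (j + 1))) ^ d" .
          have "A (k, g) * (1 + ln (?U * ?W)) ^ k * ?w k g ?U ?W ?E \<le> A (k, g) * (1 + 2 * real (M * (j + 1))) ^ d * (G * 2 powr (- \<eta> * real j))"
            by (rule mult_mono[OF mult_left_mono[OF pw less_imp_le[OF Akg]] True]) (use Akg in simp_all)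
          then show ?thesis by (simp add: \<sigma>_def tt mult.assoc)
        qed
        ultimately have "finitely_coverable s (?X k g ?U ?W ?E) (\<sigma> j t)" by (rule finitely_coverable_mono[OF _ order_refl])
        then show ?thesis unfolding blk_def tt prod.case if_P[OF True] .
      next
        case False
        have "0 \<le> \<sigma> j t" using Akg G by (simp add: \<sigma>_def tt)
        moreover have "finitely_coverable s {} 0" unfolding finitely_coverable_def by (rule exI[of _ "{}"]) simp
        ultimately show ?thesis using False finitely_coverable_mono[of s "{}" 0 "{}"]
          unfolding blk_def tt prod.case if_not_P[OF False] by blast
      qed
    qed
    moreover have "(\<Sum>t\<in>I j. \<sigma> j t) \<le> K * real (j + 1) ^ (d + 3) * 2 powr (- \<eta> * real j)"
    proof -
      let ?J = "{1..d} \<times> {1..n + 1}"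
      let ?N = "real (M * (j + 1) + 1)"
      have A0: "0 \<le> (\<Sum>kg\<in>?J. A kg)"
      proof (rule sum_nonneg)
        fix kg assume "kg \<in> ?J"
        then have "1 \<le> fst kg" "1 \<le> snd kg" by auto
        from A[OF this] show "0 \<le> A kg" unfolding prod.collapse by (blast intro: less_imp_le)
      qed
      have le: "1 + 2 * real (M * (j + 1)) \<le> (1 + 2 * real M) * real (j + 1)" "?N \<le> (1 + real M) * real (j + 1)"
        by (auto simp: algebra_simps)
      have "(\<Sum>t\<in>I j. \<sigma> j t) = (\<Sum>kg\<in>?J. \<Sum>y\<in>{..M * (j + 1)} \<times> {..M * (j + 1)} \<times> {..M * (j + 1)}. A kg * (1 + 2 * real (M * (j + 1))) ^ d * (G * 2 powr (- \<eta> * real j)))"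
        unfolding I_def by (subst sum.cartesian_product') (simp add: \<sigma>_def)
      also have "\<dots> = (\<Sum>kg\<in>?J. A kg) * ((1 + 2 * real (M * (j + 1))) ^ d * ?N ^ 3 * (G * 2 powr (- \<eta> * real j)))"
      proof -
        have "card ({..M * (j + 1)} \<times> {..M * (j + 1)} \<times> {..M * (j + 1)}) = (M * (j + 1) + 1) ^ 3"
          by (simp add: card_cartesian_product power3_eq_cube)
        then have "real (card ({..M * (j + 1)} \<times> {..M * (j + 1)} \<times> {..M * (j + 1)})) = ?N ^ 3"
          by (simp only: semiring_1_class.of_nat_power)
        then show ?thesis unfolding sum_distrib_right sum_constant by (simp only: mult_ac)
      qed
      also have "\<dots> \<le> (\<Sum>kg\<in>?J. A kg) * (((1 + 2 * real M) * real (j + 1)) ^ d * ((1 + real M) * real (j + 1)) ^ 3 * (G * 2 powr (- \<eta> * real j)))"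
        using A0 G le by (intro mult_left_mono mult_right_mono mult_mono power_mono) auto
      also have "\<dots> = K * real (j + 1) ^ (d + 3) * 2 powr (- \<eta> * real j)"
        by (simp add: K_def power_mult_distrib power_add mult_ac)
      finally show ?thesis .
    qed
    ultimately show ?thesis by (rule finitely_coverable_mono[OF _ order_refl])
  qed
  moreover have "x \<in> E j" if x: "\<bar>x\<bar> \<le> R" and q: "2 ^ j \<le> q" "q \<le> 2 * 2 ^ j" and nd: "near_approximant_data n d s C \<eta> x q" for j x q
  proof -
    obtain p b g e where p: "irreducible p" "content p = 1" "1 \<le> degree p" "degree p \<le> d" "mahler_measure p \<le> C * q"
      and g: "1 \<le> g" "g \<le> n + 1" and b: "recurs p b (2 * degree p - 2 + g)" "b 0 \<noteq> 0" "\<bar>real_of_int (b 0)\<bar> \<le> C * q ^ 2"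
      and e: "0 < e" "e \<le> 1" "1 / (C * q ^ 2) \<le> e"
      and ap: "\<forall>l < 2 * degree p - 2 + g. \<bar>real_of_int (b (Suc l)) - x * real_of_int (b l)\<bar> \<le> e"
      and cost: "(real (degree p) + 1 - real g) * ln (mahler_measure p) + (1 - s) * ln \<bar>real_of_int (b 0)\<bar> + (real (degree p) - 1 + s) * ln e
        \<le> C - \<eta> * ln q"
      using nd unfolding near_approximant_data_def by blast
    let ?k = "degree p" and ?h = "mahler_measure p" and ?b = "\<bar>real_of_int (b 0)\<bar>"
    have h1: "1 \<le> ?h" using mahler_measure_ge_1[of p] p(1) by auto
    have b1: "1 \<le> ?b" using b(2) by simp
    have e1: "1 \<le> 1 / e" using e by simp
    have q1: "1 \<le> q" using q(1) by (rule order_trans[rotated]) simp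
    obtain u where u: "2 ^ u \<le> ?h" "?h \<le> 2 * 2 ^ u" "\<And>N. ?h \<le> 2 ^ N \<Longrightarrow> u \<le> N" using dyadic_scale[OF h1] by blast
    obtain w where w: "2 ^ w \<le> ?b" "?b \<le> 2 * 2 ^ w" "\<And>N. ?b \<le> 2 ^ N \<Longrightarrow> w \<le> N" using dyadic_scale[OF b1] by blast
    obtain v where v: "2 ^ v \<le> 1 / e" "1 / e \<le> 2 * 2 ^ v" "\<And>N. 1 / e \<le> 2 ^ N \<Longrightarrow> v \<le> N" using dyadic_scale[OF e1] by blast
    \<comment> \<open>The polynomial bounds in the data keep all three dyadic indices below a
      multiple of \<open>j + 1\<close>.\<close>
    have Cq2: "C * q\<^sup>2 \<le> 2 ^ (M * (j + 1))"
    proof -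
      have "C * q\<^sup>2 \<le> 2 ^ \<kappa> * (2 * 2 ^ j)\<^sup>2" using \<kappa> q C q1 by (intro mult_mono power_mono) auto
      also have "\<dots> = 2 ^ (\<kappa> + 2 * (j + 1))" by (simp add: power_add power_mult power2_eq_square mult_ac)
      also have "\<dots> \<le> 2 ^ (M * (j + 1))" by (intro power_increasing) (auto simp: M_def algebra_simps)
      finally show ?thesis .
    qed
    have "C * q \<le> C * q\<^sup>2" using C q1 by (simp add: power2_eq_square)
    then have uN: "u \<le> M * (j + 1)" using p(5) Cq2 by (intro u(3)) linarith
    have wN: "w \<le> M * (j + 1)" using b(3) Cq2 by (intro w(3)) linarith
    have "1 / e \<le> C * q\<^sup>2" using e C q1 by (simp add: field_simps)
    then have vN: "v \<le> M * (j + 1)" using Cq2 by (intro v(3)) linarith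
    let ?U = "2 ^ u :: real" and ?W = "2 ^ w :: real" and ?E = "1 / 2 ^ v :: real"
    have E: "e \<le> ?E" "?E \<le> 2 * e" using v(1,2) e(1) by (auto simp: field_simps)
    have lnU: "ln ?U \<le> ln ?h" "ln ?h \<le> ln ?U + ln 2"
      using ln_mono[OF u(1)] ln_mono[OF u(2)] h1 by (auto simp: ln_mult_pos)
    have lnW: "ln ?W \<le> ln ?b" using ln_mono[OF w(1)] by simp
    have lnE: "ln ?E \<le> ln 2 + ln e" using ln_mono[OF E(2)] e(1) by (simp add: ln_mult_pos)
    have "?w ?k g ?U ?W ?E \<le> G * 2 powr (- \<eta> * real j)"
    proof -
      \<comment> \<open>The factor \<open>?k + 1 - g\<close> may be negative, and then rounding the
        Mahler measure down raises the cost, by at most \<open>ln 2\<close> times its absolute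
        value.\<close>
      have c1: "(real ?k + 1 - real g) * ln ?U \<le> (real ?k + 1 - real g) * ln ?h + (real n + real d + 2) * ln 2"
      proof -
        have "(real ?k + 1 - real g) * ln ?U = (real ?k + 1 - real g) * ln ?h + (real g - real ?k - 1) * (ln ?h - ln ?U)"
          by (simp add: algebra_simps)
        also have "(real g - real ?k - 1) * (ln ?h - ln ?U) \<le> (real n + real d + 2) * (ln ?h - ln ?U)"
          using g lnU by (intro mult_right_mono) auto
        also have "\<dots> \<le> (real n + real d + 2) * ln 2" using lnU by (intro mult_left_mono) auto
        finally show ?thesis by simp
      qed
      have c2: "(1 - s) * ln ?W \<le> (1 - s) * ln ?b" using lnW s by (intro mult_left_mono) auto
      have c3: "(real ?k - 1 + s) * ln ?E \<le> (real ?k - 1 + s) * ln e + (real d + 1) * ln 2"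
      proof -
        have "(real ?k - 1 + s) * ln ?E \<le> (real ?k - 1 + s) * (ln 2 + ln e)" using lnE p(3) s by (intro mult_left_mono) auto
        moreover have "(real ?k - 1 + s) * ln 2 \<le> (real d + 1) * ln 2" using p(4) s by (intro mult_right_mono) auto
        ultimately show ?thesis by (simp add: algebra_simps)
      qed
      have pos: "0 < ?w ?k g ?U ?W ?E" by simp
      have "ln (?w ?k g ?U ?W ?E) = (real ?k + 1 - real g) * ln ?U + (1 - s) * ln ?W + (real ?k - 1 + s) * ln ?E"
      proof -
        define U W E where "U = ?U" and "W = ?W" and "E = ?E"
        have "0 < U" "0 < W" "0 < E" by (auto simp: U_def W_def E_def)
        then have "ln (?w ?k g U W E) = real (?k + 1) * ln U + (ln W + real (?k - 1) * ln E - real g * ln U) + s * (ln E - ln W)"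
          by (simp add: ln_mult_pos ln_div ln_powr ln_realpow algebra_simps)
        also have "real (?k - 1) = real ?k - 1" using p(3) by simp
        finally show ?thesis unfolding U_def W_def E_def by (simp add: algebra_simps)
      qed
      also have "\<dots> \<le> C - \<eta> * ln q + (real n + 2 * real d + 3) * ln 2"
        using c1 c2 c3 cost by (simp add: algebra_simps)
      also have "\<dots> \<le> C - \<eta> * (real j * ln 2) + (real n + 2 * real d + 4) * ln 2"
      proof -
        have "real j * ln 2 \<le> ln q" using ln_mono[OF q(1)] by (simp add: ln_realpow)
        then have "\<eta> * (real j * ln 2) \<le> \<eta> * ln q" using \<eta> by (intro mult_left_mono) auto
        moreover have "(real n + 2 * real d + 3) * ln 2 \<le> (real n + 2 * real d + 4) * ln 2" by (intro mult_right_mono) auto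
        ultimately show ?thesis by linarith
      qed
      also have "\<dots> = ln (G * 2 powr (- \<eta> * real j))" by (simp add: G_def ln_mult_pos ln_powr)
      finally have "ln (?w ?k g ?U ?W ?E) \<le> ln (G * 2 powr (- \<eta> * real j))" .
      moreover have "0 < G * 2 powr (- \<eta> * real j)" using G by simp
      ultimately show ?thesis using pos ln_le_cancel_iff by blast
    qed
    moreover have "x \<in> ?X ?k g ?U ?W ?E"
    proof -
      have "\<forall>l < 2 * ?k - 2 + g. \<bar>real_of_int (b (Suc l)) - x * real_of_int (b l)\<bar> \<le> ?E" using ap E(1) by (meson order_trans)
      then show ?thesis using x p u w b by blast
    qed
    ultimately have "x \<in> blk j ((?k, g), (u, w, v))" unfolding blk_def prod.case by (simp only: if_True)
    moreover have "((?k, g), (u, w, v)) \<in> I j" using p g uN wN vN by (simp add: I_def)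
    ultimately show ?thesis unfolding E_def by blast
  qed
  ultimately show ?thesis by blast
qed

text \<open>Each dyadic range contains finitely many \<open>q\<close>, so infinitely many
  \<open>q\<close> meet infinitely many ranges.\<close>

lemma infinite_levels:
  fixes E :: "nat \<Rightarrow> 'a set" and Q :: "nat set"
  assumes "infinite Q" "\<And>j q. j0 \<le> j \<Longrightarrow> q \<in> Q \<Longrightarrow> 2 ^ j \<le> q \<Longrightarrow> q \<le> 2 * 2 ^ j \<Longrightarrow> x \<in> E j"
  shows "infinite {j. x \<in> E j}"
  unfolding infinite_nat_iff_unbounded_le
proof
  fix J
  obtain q where q: "q \<in> Q" "2 ^ (max j0 J) \<le> q" using assms(1) infinite_nat_iff_unbounded_le by blast
  have "1 \<le> q" using q(2) by (rule order_trans[rotated]) simp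
  then obtain j where j: "2 ^ j \<le> q" "q < 2 ^ (j + 1)" using ex_power_ivl1[of 2 q] by auto
  have "(2::nat) ^ max j0 J < 2 ^ (j + 1)" using q(2) j(2) by linarith
  then have "max j0 J < j + 1" using power_less_imp_less_exp[of "2::nat" "max j0 J" "j + 1"] by linarith
  then have "max j0 J \<le> j" by simp
  then have "x \<in> E j" using assms(2)[of j q] q(1) j by simp
  then show "\<exists>j\<ge>J. j \<in> {j. x \<in> E j}" using \<open>max j0 J \<le> j\<close> by auto
qed

text \<open>Infinitely many \<open>q\<close> work for some \<open>l > t\<close>, and for large
  \<open>q\<close> the surplus factor \<open>q powr (t - l)\<close> is below any constant
  \<open>c\<close>. This supplies the small \<open>c0\<close> that \<open>diophantine_data\<close>
  demands.\<close>

lemma lambda_exponent_gt_imp: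
  assumes "1 \<le> n" "lambda_exponent n x > ereal t" "0 < c"
  shows "infinite {q :: nat. 1 \<le> q \<and> (\<forall>i\<in>{1..n}. dist_nearest_int (real q * x ^ i) \<le> c * real q powr (- t))}"
proof -
  obtain l where l: "t < l" and inf: "infinite {q::nat. 0 < q \<and> Max ((\<lambda>i. dist_nearest_int (real q * x ^ i)) ` {1..n}) \<le> real q powr (- l)}"
    using assms(2) unfolding lambda_exponent_def less_Sup_iff by auto
  let ?Q = "{q::nat. 0 < q \<and> Max ((\<lambda>i. dist_nearest_int (real q * x ^ i)) ` {1..n}) \<le> real q powr (- l)}"
  obtain N :: nat where N: "(1 / c) powr (1 / (l - t)) < real N" using reals_Archimedean2 by blast
  have "infinite (?Q - {..N})" using inf by (rule Diff_infinite_finite[rotated]) simp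
  moreover have "?Q - {..N} \<subseteq> {q :: nat. 1 \<le> q \<and> (\<forall>i\<in>{1..n}. dist_nearest_int (real q * x ^ i) \<le> c * real q powr (- t))}"
  proof (rule subsetI, rule CollectI, intro conjI ballI)
    fix q i assume "q \<in> ?Q - {..N}" and i: "i \<in> {1..n}"
    then have q: "0 < q" "q \<notin> {..N}" "Max ((\<lambda>i. dist_nearest_int (real q * x ^ i)) ` {1..n}) \<le> real q powr (- l)"
      by auto
    have "dist_nearest_int (real q * x ^ i) \<le> Max ((\<lambda>i. dist_nearest_int (real q * x ^ i)) ` {1..n})" using i by (intro Max_ge) auto
    also have "\<dots> \<le> real q powr (- l)" by (rule q(3))
    also have "\<dots> = real q powr (t - l) * real q powr (- t)" by (simp add: powr_add[symmetric])
    also have "\<dots> \<le> c * real q powr (- t)"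
    proof (rule mult_right_mono)
      have "(1 / c) powr (1 / (l - t)) \<le> real q" using N q(2) by simp
      then have "((1 / c) powr (1 / (l - t))) powr (l - t) \<le> real q powr (l - t)" using l by (intro powr_mono2) auto
      then have "1 / c \<le> real q powr (l - t)" using l assms(3) by (simp add: powr_powr)
      then have "1 \<le> c * real q powr (l - t)" using assms(3) by (simp add: field_simps)
      then have "1 * real q powr (t - l) \<le> c * real q powr (l - t) * real q powr (t - l)" by (intro mult_right_mono) auto
      also have "\<dots> = c" using q(1) by (simp add: mult.assoc powr_add[symmetric])
      finally show "real q powr (t - l) \<le> c" by simp
    qed simp
    finally show "dist_nearest_int (real q * x ^ i) \<le> c * real q powr (- t)" .
  qed auto
  ultimately show ?thesis using infinite_super by blast
qed

text \<open>All constants depend on the bound \<open>R\<close> for \<open>x\<close>, hence the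
  restriction to a bounded part. The levels of the two kinds of cover are united, and both costs are
  summable.\<close>

lemma hausdorff_measure_bounded_part_zero:
  assumes n: "1 \<le> n" "n \<le> 2 * d" "2 * d \<le> n + 1" and R: "0 \<le> R"
    and s: "1 / 2 \<le> s" "s \<le> 1" "(1 - s) * (real n + 2) < real d"
  shows "hausdorff_measure s {x \<in> S_set n I (2 / real n). \<bar>x\<bar> \<le> R} = 0"
proof -
  obtain c0 C \<eta> where c: "0 < c0" "1 \<le> C" "0 < \<eta>" and data: "\<And>x q a. \<bar>x\<bar> \<le> R \<Longrightarrow> 1 \<le> q \<Longrightarrow> real_of_int (a 0) = q \<Longrightarrow>
    (\<forall>l\<le>n. \<bar>real_of_int (a l) - x ^ l * q\<bar> \<le> c0 * q powr (- 2 / real n)) \<Longrightarrow>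
    near_root_data d s C \<eta> x q \<or> near_approximant_data n d s C \<eta> x q"
    using diophantine_data[OF n R s] by blast
  have s0: "0 < s" "0 \<le> s" using s(1) by auto
  obtain KA mA EA j0 where A: "\<And>j. finitely_coverable s (EA j) (KA * real (j + 1) ^ mA * 2 powr (- \<eta> * real j))"
    "\<And>j x q. j0 \<le> j \<Longrightarrow> \<bar>x\<bar> \<le> R \<Longrightarrow> 2 ^ j \<le> q \<Longrightarrow> q \<le> 2 * 2 ^ j \<Longrightarrow> near_root_data d s C \<eta> x q \<Longrightarrow> x \<in> EA j"
    using near_root_levels[OF c(2,3) s0(1) R, of d] by blast
  obtain KB mB EB where B: "\<And>j. finitely_coverable s (EB j) (KB * real (j + 1) ^ mB * 2 powr (- \<eta> * real j))"
    "\<And>j x q. \<bar>x\<bar> \<le> R \<Longrightarrow> 2 ^ j \<le> q \<Longrightarrow> q \<le> 2 * 2 ^ j \<Longrightarrow> near_approximant_data n d s C \<eta> x q \<Longrightarrow> x \<in> EB j"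
    using near_approximant_levels[OF c(2,3) s0(2) s(2) R, of n d] by blast
  define \<sigma> where "\<sigma> j = KA * real (j + 1) ^ mA * 2 powr (- \<eta> * real j) + KB * real (j + 1) ^ mB * 2 powr (- \<eta> * real j)" for j
  show ?thesis
  proof (rule hausdorff_measure_limsup_zero[OF s0(1)])
    show "finitely_coverable s (EA j \<union> EB j) (\<sigma> j)" for j
    proof -
      have "finitely_coverable s (\<Union>t\<in>{True, False}. if t then EA j else EB j)
        (\<Sum>t\<in>{True, False}. if t then KA * real (j + 1) ^ mA * 2 powr (- \<eta> * real j) else KB * real (j + 1) ^ mB * 2 powr (- \<eta> * real j))"
        by (rule finitely_coverable_UN) (simp, use A(1)[of j] B(1)[of j] in presburger)
      then show ?thesis by (simp add: \<sigma>_def Un_commute)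
    qed
    show "summable \<sigma>" unfolding \<sigma>_def by (intro summable_add summable_poly_geometric c(3))
    fix x assume x: "x \<in> {x \<in> S_set n I (2 / real n). \<bar>x\<bar> \<le> R}"
    then have "lambda_exponent n x > ereal (2 / real n)" by (simp add: S_set_def)
    then have inf: "infinite {q :: nat. 1 \<le> q \<and> (\<forall>i\<in>{1..n}. dist_nearest_int (real q * x ^ i) \<le> c0 * real q powr - (2 / real n))}"
      using n(1) c(1) by (intro lambda_exponent_gt_imp)
    show "infinite {j. x \<in> EA j \<union> EB j}"
    proof (rule infinite_levels[OF inf, where ?j0.0 = j0])
      fix j q assume j: "j0 \<le> j" and q: "q \<in> {q. 1 \<le> q \<and> (\<forall>i\<in>{1..n}. dist_nearest_int (real q * x ^ i) \<le> c0 * real q powr - (2 / real n))}"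
        and jq: "2 ^ j \<le> q" "q \<le> 2 * 2 ^ j"
      define a where "a l = round (real q * x ^ l)" for l
      have a0: "real_of_int (a 0) = real q" by (simp add: a_def)
      have "\<forall>l\<le>n. \<bar>real_of_int (a l) - x ^ l * real q\<bar> \<le> c0 * real q powr (- 2 / real n)"
      proof (intro allI impI)
        fix l assume "l \<le> n"
        show "\<bar>real_of_int (a l) - x ^ l * real q\<bar> \<le> c0 * real q powr (- 2 / real n)"
        proof (cases "l = 0")
          case True
          then show ?thesis using a0 c(1) by simp
        next
          case False
          then have "dist_nearest_int (real q * x ^ l) \<le> c0 * real q powr - (2 / real n)" using q \<open>l \<le> n\<close> by auto
          then show ?thesis by (simp add: a_def dist_nearest_int_def abs_minus_commute mult.commute)
        qed
      qed
      then have "near_root_data d s C \<eta> x (real q) \<or> near_approximant_data n d s C \<eta> x (real q)"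
        using x q a0 by (intro data) auto
      moreover have "2 ^ j \<le> real q" "real q \<le> 2 * 2 ^ j"
        using of_nat_le_iff[of "2 ^ j" q, where ?'a = real] of_nat_le_iff[of q "2 * 2 ^ j", where ?'a = real] jq by simp_all
      ultimately show "x \<in> EA j \<union> EB j" using A(2)[OF j] B(2) x by blast
    qed
  qed
qed

section \<open>The value of the bound and its asymptotics\<close>

lemma dim_bound_odd: "dim_bound (2 * m + 1) = (real m + 2) / (2 * real m + 3)"
proof -
  have "nat \<lfloor>(real (2 * m + 1) - 1) / 2\<rfloor> = m" by simp
  then show ?thesis by (simp add: dim_bound_def Let_def)
qed

lemma dim_bound_even: "dim_bound (2 * m + 2) = (real m + 3) / (2 * real m + 4)"
proof -
  have "\<lfloor>(real (2 * m + 2) - 1) / 2\<rfloor> = int m" by (simp add: floor_eq_iff)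
  then have "nat \<lfloor>(real (2 * m + 2) - 1) / 2\<rfloor> = m" by simp
  then show ?thesis by (simp add: dim_bound_def Let_def)
qed

lemma odd_or_even_form:
  fixes n :: nat
  assumes "1 \<le> n"
  obtains m where "n = 2 * m + 1" | m where "n = 2 * m + 2"
proof (cases "odd n")
  case True
  then show ?thesis using that(1) by (auto elim: oddE)
next
  case False
  then obtain k where "n = 2 * k" by (auto elim: evenE)
  then have "n = 2 * (k - 1) + 2" using assms by simp
  then show ?thesis using that(2) by blast
qed

text \<open>For \<open>n = 2 * m + 1\<close> and \<open>n = 2 * m + 2\<close> alike
  \<open>d = m + 1\<close>, and \<open>dim_bound n\<close> solves
  \<open>(1 - s) * (n + 2) = d\<close>; larger exponents below \<open>1\<close> satisfy the strict
  inequality needed for measure zero. As \<open>I\<close> may be unbounded, the set is exhausted by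
  countably many bounded parts.\<close>

lemma hausdorff_dim_S_set_le:
  assumes "1 \<le> n"
  shows "hausdorff_dim (S_set n I (2 / real n)) \<le> ereal (dim_bound n)"
proof -
  have "\<exists>d. n \<le> 2 * d \<and> 2 * d \<le> n + 1 \<and> (1 - dim_bound n) * (real n + 2) = real d \<and> 1 / 2 \<le> dim_bound n \<and> dim_bound n < 1"
    using assms
  proof (cases rule: odd_or_even_form)
    case (1 m)
    have "(1 - (real m + 2) / (2 * real m + 3)) * (2 * real m + 3) = real m + 1" by (simp add: field_simps)
    then show ?thesis unfolding 1 dim_bound_odd by (intro exI[of _ "m + 1"]) (auto simp: add_ac divide_less_eq le_divide_eq)
  next
    case (2 m)
    have "(1 - (real m + 3) / (2 * real m + 4)) * (2 * real m + 4) = real m + 1" by (simp add: field_simps)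
    then show ?thesis unfolding 2 dim_bound_even by (intro exI[of _ "m + 1"]) (auto simp: add_ac divide_less_eq le_divide_eq)
  qed
  then obtain d where d: "n \<le> 2 * d" "2 * d \<le> n + 1" "(1 - dim_bound n) * (real n + 2) = real d" "1 / 2 \<le> dim_bound n" "dim_bound n < 1"
    by blast
  show ?thesis
  proof (rule hausdorff_dim_le[OF _ d(5)])
    show "0 \<le> dim_bound n" using d(4) by linarith
    fix s assume s: "dim_bound n < s" "s < 1"
    have "(1 - s) * (real n + 2) < (1 - dim_bound n) * (real n + 2)" using s by (intro mult_strict_right_mono) auto
    then have "hausdorff_measure s {x \<in> S_set n I (2 / real n). \<bar>x\<bar> \<le> real R} = 0" for R :: nat
      using assms d s by (intro hausdorff_measure_bounded_part_zero[where d = d]) auto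
    then have "hausdorff_measure s (\<Union>R::nat. {x \<in> S_set n I (2 / real n). \<bar>x\<bar> \<le> real R}) = 0"
      by (rule hausdorff_measure_countable_UN_zero)
    moreover have "(\<Union>R::nat. {x \<in> S_set n I (2 / real n). \<bar>x\<bar> \<le> real R}) = S_set n I (2 / real n)"
      using real_arch_simple by auto
    ultimately show "hausdorff_measure s (S_set n I (2 / real n)) = 0" by simp
  qed
qed

lemma dim_bound_asymptotics: "(\<lambda>n. dim_bound n - 1 / 2) \<in> O(\<lambda>n. 1 / real n)"
proof (rule bigoI[where c = 1], rule eventually_sequentiallyI[of 1])
  fix n :: nat assume "1 \<le> n"
  then show "norm (dim_bound n - 1 / 2) \<le> 1 * norm (1 / real n)"
  proof (cases rule: odd_or_even_form)
    case (1 m)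
    have "dim_bound n - 1 / 2 = 1 / (2 * (2 * real m + 3))" unfolding 1 dim_bound_odd by (simp add: field_simps)
    also have "norm \<dots> \<le> 1 / real n" unfolding 1 by (simp add: field_simps)
    finally show ?thesis by simp
  next
    case (2 m)
    have "dim_bound n - 1 / 2 = 1 / (2 * real m + 4)" unfolding 2 dim_bound_even by (simp add: field_simps)
    also have "norm \<dots> \<le> 1 / real n" unfolding 2 by (simp add: field_simps)
    finally show ?thesis by simp
  qed
qed

theorem corollary1:
  shows "(\<forall>(n::nat) (I::real set). 1 \<le> n \<and> open I \<and> is_interval I \<and> I \<noteq> {} \<longrightarrow>
            hausdorff_dim (S_set n I (2 / real n)) \<le> ereal (dim_bound n))
         \<and> (\<lambda>n. dim_bound n - 1 / 2) \<in> O(\<lambda>n. 1 / real n)"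
  using hausdorff_dim_S_set_le dim_bound_asymptotics by blast

end
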